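(* Let $H$ be a finite simple connected graph with maximum degree $\Delta(H)\geq 5$ and clique number $\omega(H)$. Let $p\geq 3$ and $q\geq 3$ be integers with $\omega(H)=p$ and $p+q=\Delta(H)+1$. Then there exists $V_1\subseteq V(H)$ such that $V_1$ is a maximum $K_p$-free subset of $V(H)$ and $H[V(H)\setminus V_1]$ is $K_q$-free.
   Context: All graphs are finite, simple and undirected. $K_p$ denotes the complete graph on $p$ vertices; $\omega(H)$ is the largest order of a complete subgraph of $H$. For $W\subseteq V(H)$, $H[W]$ is the induced subgraph on $W$. A set $W\subseteq V(H)$ is $K_p$-free if $H[W]$ contains no subgraph isomorphic to $K_p$; it is a maximum $K_p$-free subset if it has the largest cardinality among all $K_p$-free subsets of $V(H)$. *)

theory Defs
  imports "Graph_Theory.Graph_Theory"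
begin

text \<open>
  A finite simple undirected graph is a model of the locale \<open>graph\<close>: a finite digraph without
  loops or parallel arcs whose arc relation is symmetric. An undirected edge is a pair of opposite
  arcs, so the degree of a vertex is its out-degree.
\<close>

definition max_degree :: "('a, 'b) pre_digraph \<Rightarrow> nat" where
  "max_degree H = Max (out_degree H ` verts H)"

definition clique_number :: "('a, 'b) pre_digraph \<Rightarrow> nat" where
  "clique_number H = Max {n. \<exists>S. subgraph S H \<and> complete_digraph n S}"

definition complete_free :: "nat \<Rightarrow> ('a, 'b) pre_digraph \<Rightarrow> bool" where
  "complete_free n H \<longleftrightarrow> \<not> (\<exists>S. subgraph S H \<and> complete_digraph n S)"

definition max_complete_free_subset :: "nat \<Rightarrow> ('a, 'b) pre_digraph \<Rightarrow> 'a set \<Rightarrow> bool" where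
  "max_complete_free_subset n H W \<longleftrightarrow>
     W \<subseteq> verts H \<and> complete_free n (H \<restriction> W) \<and>
     (\<forall>U. U \<subseteq> verts H \<and> complete_free n (H \<restriction> U) \<longrightarrow> card U \<le> card W)"

lemma (in graph) clique_number_set:
  shows "finite {n. \<exists>S. subgraph S G \<and> complete_digraph n S}"
    and "{n. \<exists>S. subgraph S G \<and> complete_digraph n S} \<noteq> {}"
proof -
  have "{n. \<exists>S. subgraph S G \<and> complete_digraph n S} \<subseteq> {..card (verts G)}"
    by (auto simp: complete_digraph_def subgraph_def intro: card_mono)
  then show "finite {n. \<exists>S. subgraph S G \<and> complete_digraph n S}"
    by (rule finite_subset) simp
  let ?E = "G \<restriction> {}"
  have "graph ?E"
    by unfold_locales (auto simp: symmetric_def arcs_ends_def)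
  moreover have "subgraph ?E G"
    using induced_induce[of "{}"] by (auto simp: induced_subgraph_def)
  ultimately have "subgraph ?E G \<and> complete_digraph 0 ?E"
    by (auto simp: complete_digraph_def arcs_ends_def)
  then show "{n. \<exists>S. subgraph S G \<and> complete_digraph n S} \<noteq> {}" by blast
qed

end

theory Submission
  imports Defs
begin

text \<open>
  If \<open>q > p\<close> there is no \<open>K\<^sub>q\<close> at all, so let \<open>q \<le> p\<close>, and take a vertex-minimal graph, subject to the degree
  bound and \<open>\<omega> \<le> p\<close> only, in which every maximum \<open>K\<^sub>p\<close>-free set \<open>A\<close> leaves a \<open>K\<^sub>q\<close> outside. Deleting a
  vertex \<open>t\<close> of such a \<open>K\<^sub>q\<close> gives, by minimality, a maximum \<open>A\<close> such that all \<open>q\<close>-cliques outside \<open>A\<close> pass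
  through \<open>t\<close>. Such a pair \<open>(A, t)\<close> survives two moves: \<open>t\<close> may be replaced by another common vertex of these
  \<open>q\<close>-cliques, and \<open>t\<close> may be exchanged with a vertex \<open>u\<close> common to all \<open>(p-1)\<close>-cliques of \<open>A \<inter> N(t)\<close>, which gives
  \<open>(A \<union> {t} - {u}, u)\<close>. Since \<open>\<Delta> \<le> p + q - 1\<close>, the set \<open>A \<union> {t}\<close> contains one \<open>p\<close>-clique, or two that share
  \<open>p - 1\<close> vertices. Alternating the moves so that no vertex which has left \<open>A\<close> ever returns must end by
  finiteness, while local analysis shows that the alternation can always be continued. For \<open>p \<ge> 4\<close> it suffices
  to keep the private cliques of new vertices away from the earlier \<open>p\<close>-cliques. For \<open>p = q = 3\<close> one starts from a
  set \<open>A\<close> with as many edges as possible, and freezes the initial triangle, or pair of triangles.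
\<close>

text \<open>Everything runs on a slack of one. A vertex outside a maximum \<open>A\<close> needs
  \<open>p - 1\<close> neighbours in \<open>A\<close>, or it could be added; a vertex of an outer
  \<open>q\<close>-clique has \<open>q - 1\<close> neighbours outside; degrees are at most
  \<open>p + q - 1\<close>. A vertex under both demands has one spare neighbour, and once that is
  located, one side of its neighbourhood is a known set. The local lemmas locate it and end in an
  excessive degree or a clique on \<open>p + 1\<close> vertices. The obstacle is that all candidates
  for the next exchange may already have left \<open>A\<close>. For \<open>p >= 4\<close>, disjoint
  sets of \<open>p - 1\<close> and \<open>p - 2\<close> neighbours in \<open>A\<close> are too many,
  since \<open>2p - 3 > p\<close>; this keeps the vertices that left from spanning triangles. For
  \<open>p = 3\<close> the inequality is an equality. There all vertices that left lie in the
  initial configuration, whose triangles share a kernel; freezing a kernel vertex destroys all their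
  triangles at once. Edge maximality sorts the starting states: two exchangeable vertices of full
  inner degree, or two initial triangles, give enough to freeze; otherwise all edge-maximal states
  are so sparse that the vertices which left, apart from the first token, are independent.\<close>

definition clq :: "('a \<Rightarrow> 'a \<Rightarrow> bool) \<Rightarrow> 'a set \<Rightarrow> bool" where
  "clq adj C \<longleftrightarrow> (\<forall>u\<in>C. \<forall>v\<in>C. u \<noteq> v \<longrightarrow> adj u v)"

lemma clq_subset: "clq adj C \<Longrightarrow> D \<subseteq> C \<Longrightarrow> clq adj D"
  by (auto simp: clq_def)

lemma clq_diff: "clq adj C \<Longrightarrow> clq adj (C - D)"
  by (auto simp: clq_def)

lemma clqD: "clq adj C \<Longrightarrow> u \<in> C \<Longrightarrow> v \<in> C \<Longrightarrow> u \<noteq> v \<Longrightarrow> adj u v"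
  by (auto simp: clq_def)

locale clique_graph =
  fixes V :: "'a set" and adj :: "'a \<Rightarrow> 'a \<Rightarrow> bool" and p q :: nat
  assumes finV: "finite V"
    and adj_sym: "adj u v \<Longrightarrow> adj v u"
    and adj_irrefl: "\<not> adj v v"
begin

definition nb :: "'a \<Rightarrow> 'a set" where
  "nb v = {u \<in> V. adj v u}"

definition free :: "'a set \<Rightarrow> bool" where
  "free A \<longleftrightarrow> A \<subseteq> V \<and> (\<forall>C\<subseteq>A. clq adj C \<longrightarrow> card C \<noteq> p)"

definition opt :: "'a set \<Rightarrow> bool" where
  "opt A \<longleftrightarrow> free A \<and> (\<forall>B. free B \<longrightarrow> card B \<le> card A)"

definition qs :: "'a set \<Rightarrow> 'a set set" where
  "qs A = {Q. Q \<subseteq> V - A \<and> clq adj Q \<and> card Q = q}"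

text \<open>
  The state \<open>(A, t)\<close> of the argument; \<open>core A t\<close> consists of the vertices with which \<open>t\<close> can be exchanged.
\<close>

definition tok :: "'a set \<Rightarrow> 'a \<Rightarrow> bool" where
  "tok A t \<longleftrightarrow> opt A \<and> t \<in> V - A \<and> (\<forall>Q\<in>qs A. t \<in> Q)"

definition core :: "'a set \<Rightarrow> 'a \<Rightarrow> 'a set" where
  "core A t = {u \<in> A. \<forall>E. E \<subseteq> A \<inter> nb t \<and> clq adj E \<and> card E = p - 1 \<longrightarrow> u \<in> E}"

lemma core_sub: "u \<in> core A t \<Longrightarrow> u \<in> A" by (simp add: core_def)

lemma coreD:
  assumes "u \<in> core A t" "E \<subseteq> A \<inter> nb t" "clq adj E" "card E = p - 1" shows "u \<in> E"
  using assms unfolding core_def by blast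

lemma nb_sub: "nb v \<subseteq> V" by (auto simp: nb_def)
lemma fin_nb: "finite (nb v)" using finV nb_sub finite_subset by blast
lemma fin_sub: "A \<subseteq> V \<Longrightarrow> finite A" using finV finite_subset by blast
lemma adj_neq: "adj u v \<Longrightarrow> u \<noteq> v" using adj_irrefl by auto
lemma adj_comm: "adj u v \<longleftrightarrow> adj v u" using adj_sym by auto
lemma nb_irrefl: "v \<notin> nb v" by (simp add: nb_def adj_irrefl)

lemma clq_insert: "clq adj (insert x C) \<longleftrightarrow> clq adj C \<and> (\<forall>c\<in>C. c \<noteq> x \<longrightarrow> adj x c)"
  by (auto simp: clq_def adj_comm)

lemma opt_free: "opt A \<Longrightarrow> free A" by (simp add: opt_def)
lemma free_sub: "free A \<Longrightarrow> A \<subseteq> V" by (simp add: free_def)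
lemma opt_sub: "opt A \<Longrightarrow> A \<subseteq> V" by (simp add: opt_def free_def)

end

text \<open>A counterexample: \<open>bad\<close> negates the conclusion, and \<open>tok_ex\<close>
  is the only consequence of vertex-minimality that the argument keeps.\<close>

locale clique_part = clique_graph +
  assumes deg: "v \<in> V \<Longrightarrow> card {u \<in> V. adj v u} + 1 \<le> p + q"
    and no_big: "C \<subseteq> V \<Longrightarrow> clq adj C \<Longrightarrow> card C \<le> p"
    and q3: "3 \<le> q" and qp: "q \<le> p"
    and bad: "opt A \<Longrightarrow> qs A \<noteq> {}"
    and tok_ex: "\<exists>A t. tok A t"
begin

section \<open>Exchanges and degree counts in a counterexample\<close>

lemma deg_nb: "v \<in> V \<Longrightarrow> card (nb v) + 1 \<le> p + q"
  using deg by (simp add: nb_def)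

text \<open>By maximality \<open>insert x A\<close> contains a \<open>p\<close>-clique, and since
  \<open>A\<close> is free this clique passes through \<open>x\<close>.\<close>

lemma private_clique:
  assumes "opt A" "x \<in> V - A"
  obtains E where "E \<subseteq> A \<inter> nb x" "clq adj E" "card E = p - 1"
proof -
  have "\<not> free (insert x A)"
  proof
    assume "free (insert x A)"
    then have "card (insert x A) \<le> card A" using assms by (simp add: opt_def)
    then show False using assms fin_sub opt_sub by fastforce
  qed
  then obtain C where C: "C \<subseteq> insert x A" "clq adj C" "card C = p"
    using assms opt_sub by (auto simp: free_def)
  have "x \<in> C" using C assms by (auto simp: opt_def free_def)
  show ?thesis
  proof (rule that[of "C - {x}"])
    show "C - {x} \<subseteq> A \<inter> nb x"
      using C assms \<open>x \<in> C\<close> opt_sub by (fastforce simp: nb_def clq_def)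
    show "clq adj (C - {x})" using C clq_diff by blast
    show "card (C - {x}) = p - 1" using C \<open>x \<in> C\<close> by simp
  qed
qed

text \<open>A \<open>p\<close>-clique created by inserting \<open>x\<close> is \<open>x\<close> with
  a \<open>(p-1)\<close>-clique of \<open>A\<close> in its neighbourhood, and \<open>u\<close> meets
  all of these.\<close>

lemma swap_opt:
  assumes "opt A" "x \<in> V - A" "u \<in> core A x"
  shows "opt (insert x A - {u})"
proof -
  have uA: "u \<in> A" using assms by (simp add: core_def)
  have AV: "A \<subseteq> V" using assms opt_sub by blast
  have "free (insert x A - {u})"
    unfolding free_def
  proof (intro conjI allI impI)
    show "insert x A - {u} \<subseteq> V" using AV assms by auto
    fix C assume C: "C \<subseteq> insert x A - {u}" "clq adj C"
    show "card C \<noteq> p"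
    proof
      assume cp: "card C = p"
      have "x \<in> C" using C cp assms by (auto simp: opt_def free_def)
      have "C - {x} \<subseteq> A \<inter> nb x" using C AV \<open>x \<in> C\<close> by (fastforce simp: nb_def clq_def)
      moreover have "clq adj (C - {x})" "card (C - {x}) = p - 1"
        using C cp \<open>x \<in> C\<close> clq_diff by auto
      ultimately have "u \<in> C - {x}" using coreD[OF assms(3)] by blast
      then show False using C by auto
    qed
  qed
  moreover have "card (insert x A - {u}) = card A"
    using assms uA fin_sub[OF AV] by auto
  ultimately show ?thesis using assms by (simp add: opt_def)
qed

text \<open>An outer \<open>q\<close>-clique of the new set that misses \<open>u\<close> is already
  outside \<open>A\<close>, so it contains \<open>t\<close>; but \<open>t\<close> is now
  inside.\<close>

lemma swap_tok:
  assumes "tok A t" "u \<in> core A t"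
  shows "tok (insert t A - {u}) u"
proof -
  have o: "opt A" and t: "t \<in> V - A" using assms by (auto simp: tok_def)
  have uA: "u \<in> A" using assms by (simp add: core_def)
  have "u \<in> Q" if "Q \<in> qs (insert t A - {u})" for Q
  proof (rule ccontr)
    assume "u \<notin> Q"
    then have "Q \<in> qs A" using that by (auto simp: qs_def)
    then have "t \<in> Q" using assms by (auto simp: tok_def)
    then show False using that uA t by (auto simp: qs_def)
  qed
  then show ?thesis using swap_opt[OF o t assms(2)] uA opt_sub[OF o] t by (auto simp: tok_def)
qed

lemma tok_q:
  assumes "tok A t"
  obtains D where "D \<subseteq> V - A - {t}" "clq adj (insert t D)" "card D = q - 1" "D \<subseteq> nb t" "insert t D \<in> qs A"
proof -
  obtain Q where Q: "Q \<in> qs A" using bad assms by (auto simp: tok_def)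
  then have "t \<in> Q" using assms by (auto simp: tok_def)
  have i: "insert t (Q - {t}) = Q" using \<open>t \<in> Q\<close> by auto
  show ?thesis
  proof (rule that[of "Q - {t}"])
    show "Q - {t} \<subseteq> V - A - {t}" using Q by (auto simp: qs_def)
    show "clq adj (insert t (Q - {t}))" using Q i by (auto simp: qs_def)
    show "card (Q - {t}) = q - 1" using Q \<open>t \<in> Q\<close> by (auto simp: qs_def)
    show "Q - {t} \<subseteq> nb t" using Q \<open>t \<in> Q\<close> by (auto simp: qs_def nb_def clq_def)
    show "insert t (Q - {t}) \<in> qs A" using Q i by simp
  qed
qed

lemma card_split:
  assumes "finite S" shows "card (S \<inter> A) + card (S - A) = card S"
proof -
  have "S = (S \<inter> A) \<union> (S - A)" by auto
  moreover have "card ((S \<inter> A) \<union> (S - A)) = card (S \<inter> A) + card (S - A)"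
    using assms by (intro card_Un_disjoint) auto
  ultimately show ?thesis by simp
qed

lemma nb_split: "card (nb v \<inter> A) + card (nb v - A) = card (nb v)"
  by (rule card_split[OF fin_nb])

lemma opt_nb_ge:
  assumes "opt A" "x \<in> V - A" shows "p - 1 \<le> card (nb x \<inter> A)"
proof -
  obtain E where E: "E \<subseteq> A \<inter> nb x" "clq adj E" "card E = p - 1" using private_clique[OF assms] .
  have "card E \<le> card (nb x \<inter> A)" by (rule card_mono) (use E fin_nb in auto)
  then show ?thesis using E by simp
qed

lemma out_le:
  assumes "opt A" "x \<in> V - A" shows "card (nb x - A) \<le> q"
  using opt_nb_ge[OF assms] nb_split[of x A] deg_nb[of x] assms q3 qp by auto

lemma in_le:
  assumes "x \<in> V" "q - 1 \<le> card (nb x - A)" shows "card (nb x \<inter> A) \<le> p"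
  using nb_split[of x A] deg_nb[of x] assms q3 qp by auto

lemma q_vertex_out:
  assumes "Q \<in> qs A" "x \<in> Q" shows "Q - {x} \<subseteq> nb x - A" "q - 1 \<le> card (nb x - A)"
proof -
  show *: "Q - {x} \<subseteq> nb x - A" using assms by (auto simp: qs_def nb_def clq_def)
  have "card (Q - {x}) = q - 1" using assms by (auto simp: qs_def)
  then show "q - 1 \<le> card (nb x - A)" using card_mono[OF _ *] fin_nb by auto
qed

lemma q_vertex_in: "Q \<in> qs A \<Longrightarrow> x \<in> Q \<Longrightarrow> card (nb x \<inter> A) \<le> p"
  using q_vertex_out(2)[of Q A x] in_le[of x A] by (auto simp: qs_def)

lemma tok_in: "tok A t \<Longrightarrow> card (nb t \<inter> A) \<le> p"
proof -
  assume t: "tok A t"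
  then obtain Q where "Q \<in> qs A" using bad by (auto simp: tok_def)
  then show ?thesis using t q_vertex_in by (auto simp: tok_def)
qed

text \<open>
  A configuration is the set \<open>A \<union> {t}\<close>; every vertex of its kernel can play the role of \<open>t\<close>.
\<close>

definition kern :: "'a set \<Rightarrow> 'a set" where
  "kern B = {u \<in> B. \<forall>K\<subseteq>B. clq adj K \<and> card K = p \<longrightarrow> u \<in> K}"

definition cfg :: "'a set \<Rightarrow> bool" where
  "cfg B \<longleftrightarrow> (\<exists>A t. tok A t \<and> B = insert t A)"

lemma pclq_decomp:
  assumes "A \<subseteq> V" "t \<in> V - A" "free A" "K \<subseteq> insert t A" "clq adj K" "card K = p"
  shows "t \<in> K" "K - {t} \<subseteq> A \<inter> nb t" "clq adj (K - {t})" "card (K - {t}) = p - 1"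
proof -
  show t: "t \<in> K" using assms by (auto simp: free_def)
  show "K - {t} \<subseteq> A \<inter> nb t" using assms t by (fastforce simp: nb_def clq_def)
  show "clq adj (K - {t})" using assms clq_diff by blast
  show "card (K - {t}) = p - 1" using assms t by simp
qed

lemma kern_core:
  assumes "tok A t" shows "kern (insert t A) = insert t (core A t)"
proof -
  have o: "opt A" "t \<in> V - A" "free A" "A \<subseteq> V" using assms opt_sub by (auto simp: tok_def opt_def)
  have 1: "t \<in> kern (insert t A)" using pclq_decomp(1)[OF o(4,2,3)] unfolding kern_def by blast
  have "u \<in> kern (insert t A)" if "u \<in> core A t" for u
    unfolding kern_def
  proof (intro CollectI conjI allI impI)
    show "u \<in> insert t A" using core_sub[OF that] by blast
    fix K assume K: "K \<subseteq> insert t A" "clq adj K \<and> card K = p"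
    then have "u \<in> K - {t}"
      using coreD[OF that] pclq_decomp(2-4)[OF o(4,2,3) K(1)] by blast
    then show "u \<in> K" by simp
  qed
  moreover have "u \<in> core A t" if u: "u \<in> kern (insert t A)" "u \<noteq> t" for u
    unfolding core_def
  proof (intro CollectI conjI allI impI)
    show "u \<in> A" using u unfolding kern_def by blast
    fix E assume E: "E \<subseteq> A \<inter> nb t \<and> clq adj E \<and> card E = p - 1"
    have fE: "finite E" using E fin_nb finite_subset by blast
    have "t \<notin> E" using E o by auto
    have "clq adj (insert t E)" using E by (auto simp: clq_insert nb_def)
    moreover have "card (insert t E) = p" using E \<open>t \<notin> E\<close> fE q3 qp by simp
    moreover have "insert t E \<subseteq> insert t A" using E by blast
    ultimately have "u \<in> insert t E" using u(1) unfolding kern_def by blast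
    then show "u \<in> E" using u by simp
  qed
  ultimately show ?thesis using 1 by auto
qed

lemma cfg_kern_tok:
  assumes "cfg B" "u \<in> kern B" shows "tok (B - {u}) u"
proof -
  obtain A t where At: "tok A t" "B = insert t A" using assms by (auto simp: cfg_def)
  have "t \<notin> A" using At by (auto simp: tok_def)
  show ?thesis
  proof (cases "u = t")
    case True then show ?thesis using At \<open>t \<notin> A\<close> by simp
  next
    case False
    then have "u \<in> core A t" using assms kern_core[OF At(1)] At by auto
    then show ?thesis using swap_tok At by auto
  qed
qed

lemma cfg_sub: "cfg B \<Longrightarrow> B \<subseteq> V"
  by (auto simp: cfg_def tok_def opt_def free_def)

lemma cfg_tok: "tok A t \<Longrightarrow> cfg (insert t A)" by (auto simp: cfg_def)

lemma cfg_D: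
  assumes "cfg B" "u \<in> kern B"
  obtains D where "D \<subseteq> nb u - B" "clq adj (insert u D)" "card D = q - 1" "insert u D \<in> qs (B - {u})"
proof -
  have uB: "u \<in> B" using assms by (auto simp: kern_def)
  obtain D where D: "D \<subseteq> V - (B - {u}) - {u}" "clq adj (insert u D)" "card D = q - 1" "D \<subseteq> nb u" "insert u D \<in> qs (B - {u})"
    using tok_q[OF cfg_kern_tok[OF assms]] .
  show ?thesis by (rule that[of D]) (use D uB in auto)
qed

lemma cfg_in_le:
  assumes "cfg B" "u \<in> kern B" shows "card (nb u \<inter> B) \<le> p"
proof -
  have "nb u \<inter> B = nb u \<inter> (B - {u})" using nb_irrefl by auto
  then show ?thesis using tok_in[OF cfg_kern_tok[OF assms]] by simp
qed

lemma cfg_pclq: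
  assumes "cfg B" obtains K where "K \<subseteq> B" "clq adj K" "card K = p"
proof -
  obtain A t where At: "tok A t" "B = insert t A" using assms by (auto simp: cfg_def)
  obtain E where E: "E \<subseteq> A \<inter> nb t" "clq adj E" "card E = p - 1"
    using private_clique At by (auto simp: tok_def)
  have fE: "finite E" using E fin_nb finite_subset by blast
  have "t \<notin> E" using E nb_irrefl by auto
  show ?thesis
  proof (rule that[of "insert t E"])
    show "insert t E \<subseteq> B" using E At by auto
    show "clq adj (insert t E)" using E by (auto simp: clq_insert nb_def)
    show "card (insert t E) = p" using E \<open>t \<notin> E\<close> fE q3 qp by simp
  qed
qed

lemma cfg_kern_ne: "cfg B \<Longrightarrow> kern B \<noteq> {}"
  using kern_core by (auto simp: cfg_def)

lemma kern_sub: "u \<in> kern B \<Longrightarrow> u \<in> B" by (auto simp: kern_def)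
lemma kernD: "u \<in> kern B \<Longrightarrow> K \<subseteq> B \<Longrightarrow> clq adj K \<Longrightarrow> card K = p \<Longrightarrow> u \<in> K" by (auto simp: kern_def)

definition pclq :: "'a set \<Rightarrow> 'a set \<Rightarrow> bool" where
  "pclq B K \<longleftrightarrow> K \<subseteq> B \<and> clq adj K \<and> card K = p"

definition priv :: "'a set \<Rightarrow> 'a \<Rightarrow> 'a set \<Rightarrow> bool" where
  "priv A x E \<longleftrightarrow> E \<subseteq> A \<inter> nb x \<and> clq adj E \<and> card E = p - 1"

lemma tokD: "tok A t \<Longrightarrow> opt A" "tok A t \<Longrightarrow> A \<subseteq> V" "tok A t \<Longrightarrow> t \<in> V" "tok A t \<Longrightarrow> t \<notin> A"
  "tok A t \<Longrightarrow> Q \<in> qs A \<Longrightarrow> t \<in> Q"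
  by (simp_all add: tok_def opt_def free_def)

lemma fin_card: "card S = p \<Longrightarrow> finite S" "card S = q \<Longrightarrow> finite S"
  "card S = p - 1 \<Longrightarrow> finite S" "card S = q - 1 \<Longrightarrow> finite S"
  using q3 qp by (auto intro!: card_ge_0_finite)

lemma nb_bound: "v \<in> V \<Longrightarrow> S \<subseteq> nb v \<Longrightarrow> card S + 1 \<le> p + q"
  using card_mono[OF fin_nb, of S v] deg_nb[of v] by simp

lemma clq_nb: "clq adj C \<Longrightarrow> C \<subseteq> V \<Longrightarrow> u \<in> C \<Longrightarrow> C - {u} \<subseteq> nb u"
  by (auto simp: clq_def nb_def)

lemma nb_sym: "u \<in> V \<Longrightarrow> x \<in> nb u \<Longrightarrow> u \<in> nb x"
  using adj_sym by (auto simp: nb_def)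

lemma clq_insert_nb: "clq adj C \<Longrightarrow> C \<subseteq> nb x \<Longrightarrow> clq adj (insert x C)"
  by (auto simp: clq_insert nb_def)

text \<open>Equality in the degree bound: \<open>p\<close> neighbours inside leave room for just the
  \<open>q - 1\<close> vertices of \<open>D\<close>. Hence the outer neighbourhood is a clique,
  which is how most later contradictions begin.\<close>

lemma cfg_out_le:
  assumes "cfg B" "u \<in> kern B" "p \<le> card (nb u \<inter> B)"
    and "D \<subseteq> nb u - B" "card D = q - 1"
  shows "nb u - B = D"
proof -
  have "u \<in> V" using assms cfg_sub kern_sub by blast
  then have "card (nb u - B) \<le> q - 1" using nb_split[of u B] deg_nb[of u] assms(3) by simp
  then show ?thesis using card_seteq[of "nb u - B" D] assms fin_nb by auto
qed

lemma kernI: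
  assumes "u \<in> B" "\<And>K. pclq B K \<Longrightarrow> u \<in> K" shows "u \<in> kern B"
  unfolding kern_def using assms unfolding pclq_def by simp

section \<open>The \<open>p\<close>-cliques of a configuration\<close>

text \<open>A kernel vertex \<open>u\<close> has at most \<open>p\<close> neighbours in
  \<open>B\<close>. If a second \<open>p\<close>-clique brings a vertex \<open>a\<close> outside
  \<open>K\<close>, these neighbours are exactly \<open>a\<close> and the rest of \<open>K\<close>,
  so all \<open>p\<close>-cliques of \<open>B\<close> lie in \<open>insert a K\<close>. The vertex
  \<open>b\<close> exists because \<open>insert a K\<close> is too large to be a clique.\<close>

lemma cfg_structure:
  assumes "cfg B"
  obtains (single) K where "pclq B K" "kern B = K" "\<And>K'. pclq B K' \<Longrightarrow> K' = K"
  | (double) K a b where "pclq B K" "a \<in> B" "a \<notin> K" "b \<in> K" "\<not> adj a b"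
      "pclq B (insert a (K - {b}))" "kern B = K - {b}"
      "\<And>K'. pclq B K' \<Longrightarrow> K' = K \<or> K' = insert a (K - {b})"
      "\<And>u. u \<in> K - {b} \<Longrightarrow> nb u \<inter> B = insert a K - {u}"
      "\<And>u. u \<in> K - {b} \<Longrightarrow> card (nb u \<inter> B) = p"
proof -
  obtain K where K: "K \<subseteq> B" "clq adj K" "card K = p" using cfg_pclq[OF assms] .
  have pK: "pclq B K" using K by (simp add: pclq_def)
  have BV: "B \<subseteq> V" using cfg_sub[OF assms] .
  have fK: "finite K" using K fin_card by blast
  have pg: "p \<ge> 3" using q3 qp by simp
  show thesis
  proof (cases "\<forall>K'. pclq B K' \<longrightarrow> K' = K")
    case True
    have "kern B = K"
    proof
      show "kern B \<subseteq> K" using kernD K by blast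
      show "K \<subseteq> kern B" using True K(1) by (blast intro: kernI)
    qed
    then show ?thesis using single[OF pK] True by blast
  next
    case False
    then obtain K' where K': "K' \<subseteq> B" "clq adj K'" "card K' = p" "K' \<noteq> K" by (auto simp: pclq_def)
    have fK': "finite K'" using K' fin_card by blast
    obtain a where a: "a \<in> K'" "a \<notin> K" using card_subset_eq[OF fK, of K'] K K' by auto
    have aB: "a \<in> B" "a \<in> V" using a K' BV by auto
    have nbk: "nb u \<inter> B = insert a K - {u}" if u: "u \<in> kern B" for u
    proof -
      have uK: "u \<in> K" "u \<in> K'" using u kernD K K' by auto
      have ua: "u \<noteq> a" using uK a by auto
      have "insert a K - {u} \<subseteq> nb u \<inter> B"
        using clq_nb[OF K(2) _ uK(1)] clq_nb[OF K'(2) _ uK(2)] K K' BV a ua by blast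
      moreover have "card (insert a K - {u}) = p" using uK a K fK ua by simp
      ultimately show ?thesis
        using cfg_in_le[OF assms u] fin_nb by (metis card_seteq finite_Int)
    qed
    have nbc: "card (nb u \<inter> B) = p" if u: "u \<in> kern B" for u
    proof -
      have "u \<in> K" "u \<noteq> a" using u kernD K a by auto
      then show ?thesis using nbk[OF u] K a fK by simp
    qed
    obtain u where u: "u \<in> kern B" using cfg_kern_ne[OF assms] by blast
    have sub: "J \<subseteq> insert a K" if "J \<subseteq> B" "clq adj J" "card J = p" for J
    proof -
      have uJ: "u \<in> J" using kernD[OF u that] .
      have "J - {u} \<subseteq> nb u" using clq_nb[OF that(2) _ uJ] that BV by blast
      then show ?thesis using nbk[OF u] that(1) kernD[OF u K] by blast
    qed
    have "K' \<subset> insert a K"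
    proof -
      have "card (insert a K) = Suc p" using K a fK by simp
      then have "K' \<noteq> insert a K" using K'(3) by force
      then show ?thesis using sub[OF K'(1-3)] by blast
    qed
    then obtain b where b: "b \<in> K" "b \<notin> K'" using a by auto
    have K'eq: "K' = insert a (K - {b})"
    proof (rule card_seteq)
      show "finite (insert a (K - {b}))" using fK by simp
      show "K' \<subseteq> insert a (K - {b})" using sub[OF K'(1-3)] b by auto
      show "card (insert a (K - {b})) \<le> card K'" using fK a b K K' pg by simp
    qed
    have nab: "\<not> adj a b"
    proof
      assume ab: "adj a b"
      have "clq adj (insert a K)"
      proof -
        have "\<forall>c\<in>K. c \<noteq> a \<longrightarrow> adj a c"
        proof (intro ballI impI)
          fix c assume c: "c \<in> K" "c \<noteq> a"
          show "adj a c"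
          proof (cases "c = b")
            case False
            then have "c \<in> K'" using K'eq c by auto
            then show ?thesis using clqD[OF K'(2) a(1)] c by auto
          qed (use ab in simp)
        qed
        then show ?thesis using K(2) by (simp add: clq_insert)
      qed
      then have "card (insert a K) \<le> p" using no_big[of "insert a K"] K aB BV by blast
      then show False using K a fK by simp
    qed
    have uni: "J = K \<or> J = insert a (K - {b})" if "pclq B J" for J
    proof -
      have J: "J \<subseteq> B" "clq adj J" "card J = p" using that by (auto simp: pclq_def)
      have JK: "J \<subseteq> insert a K" using sub[OF J] .
      have ab: "a \<noteq> b" using a b by auto
      have "\<not> (a \<in> J \<and> b \<in> J)" using clqD[OF J(2)] nab ab by blast
      then have "J \<subseteq> K \<or> J \<subseteq> insert a (K - {b})" using JK by blast
      then show ?thesis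
      proof
        assume "J \<subseteq> K" then show ?thesis using card_subset_eq[OF fK] J K by auto
      next
        assume "J \<subseteq> insert a (K - {b})"
        then show ?thesis using card_subset_eq[OF fK', of J] K'eq J K' by auto
      qed
    qed
    have kern: "kern B = K - {b}"
    proof
      show "kern B \<subseteq> K - {b}" using kernD K K' b by blast
      show "K - {b} \<subseteq> kern B"
        using K(1) uni by (blast intro: kernI)
    qed
    show ?thesis
    proof (rule double)
      show "pclq B K" "a \<in> B" "a \<notin> K" "b \<in> K" "\<not> adj a b" "kern B = K - {b}"
        using pK aB a b nab kern by auto
      show "pclq B (insert a (K - {b}))" using K' K'eq by (simp add: pclq_def)
      show "K' = K \<or> K' = insert a (K - {b})" if "pclq B K'" for K' using uni[OF that] .
      show "nb u \<inter> B = insert a K - {u}" if "u \<in> K - {b}" for u using nbk that kern by blast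
      show "card (nb u \<inter> B) = p" if "u \<in> K - {b}" for u using nbc that kern by blast
    qed
  qed
qed

lemma kern_card: assumes "cfg B" shows "p - 1 \<le> card (kern B)"
  using assms
proof (cases rule: cfg_structure)
  case (single K)
  have "card (kern B) = p" using single(1,2) by (simp add: pclq_def)
  then show ?thesis by simp
next
  case (double K a b)
  have "card K = p" using double(1) by (simp add: pclq_def)
  then show ?thesis using double(4,7) by simp
qed

lemma core_ne: assumes "tok A t" shows "core A t \<noteq> {}"
proof
  assume "core A t = {}"
  then have "card (kern (insert t A)) = 1" using kern_core[OF assms] by simp
  then show False using kern_card[OF cfg_tok[OF assms]] q3 qp by simp
qed

text \<open>The same dichotomy on the outer side, where \<open>d\<close> has at most
  \<open>q\<close> outer neighbours. That \<open>z1\<close> and \<open>z2\<close> are nonadjacent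
  does not come from the clique number, as \<open>q + 1\<close> may be at most \<open>p\<close>: a
  \<open>(q+1)\<close>-clique without \<open>d\<close> would be an outer \<open>q\<close>-clique
  that misses \<open>d\<close>.\<close>

lemma qs_shape:
  assumes "tok A d"
  obtains (one) Q where "qs A = {Q}"
  | (two) I z1 z2 where "qs A = {insert z1 I, insert z2 I}" "z1 \<noteq> z2" "z1 \<notin> I" "z2 \<notin> I"
      "d \<in> I" "card I = q - 1" "\<not> adj z1 z2"
proof -
  obtain Q1 where Q1: "Q1 \<in> qs A" using bad tokD[OF assms] by blast
  have N: "card (nb d - A) \<le> q" using out_le[OF tokD(1)[OF assms]] tokD[OF assms] by blast
  have sub: "Q \<subseteq> insert d (nb d - A)" if "Q \<in> qs A" for Q
    using q_vertex_out(1)[OF that tokD(5)[OF assms that]] by blast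
  have cq: "card Q = q" "finite Q" "clq adj Q" "Q \<subseteq> V - A" if "Q \<in> qs A" for Q
    using that fin_card by (auto simp: qs_def)
  show thesis
  proof (cases "qs A = {Q1}")
    case True then show ?thesis by (rule one)
  next
    case False
    then obtain Q2 where Q2: "Q2 \<in> qs A" "Q2 \<noteq> Q1" using Q1 by blast
    define I where "I = Q1 \<inter> Q2"
    have dQ: "d \<in> Q1" "d \<in> Q2" using tokD(5)[OF assms] Q1 Q2 by auto
    have fN: "finite (insert d (nb d - A))" using fin_nb by simp
    have cN: "card (insert d (nb d - A)) \<le> Suc q" using N fin_nb card_insert_if[of "nb d - A" d] by auto
    have un: "card (Q1 \<union> Q2) \<le> Suc q"
      using card_mono[OF fN, of "Q1 \<union> Q2"] sub Q1 Q2 cN by fastforce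
    obtain z1 where z1: "z1 \<in> Q1" "z1 \<notin> Q2" using card_subset_eq[OF cq(2)[OF Q2(1)], of Q1] cq Q1 Q2 by auto
    obtain z2 where z2: "z2 \<in> Q2" "z2 \<notin> Q1" using card_subset_eq[OF cq(2)[OF Q1], of Q2] cq Q1 Q2 by auto
    have e2: "Q1 \<union> Q2 = insert z2 Q1"
    proof (rule card_seteq[symmetric])
      show "card (Q1 \<union> Q2) \<le> card (insert z2 Q1)" using un cq[OF Q1] z2 by simp
    qed (use cq Q1 Q2 z2 in auto)
    have e1: "Q1 \<union> Q2 = insert z1 Q2"
    proof (rule card_seteq[symmetric])
      show "card (Q1 \<union> Q2) \<le> card (insert z1 Q2)" using un cq[OF Q2(1)] z1 by simp
    qed (use cq Q1 Q2 z1 in auto)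
    have Q1e: "Q1 = insert z1 I" and Q2e: "Q2 = insert z2 I" using e1 e2 z1 z2 I_def by auto
    have tot: "insert d (nb d - A) = Q1 \<union> Q2"
    proof (rule card_seteq[symmetric])
      show "card (insert d (nb d - A)) \<le> card (Q1 \<union> Q2)" using cN e2 cq[OF Q1] z2 by simp
    qed (use sub Q1 Q2 fN in auto)
    have nz: "\<not> adj z1 z2"
    proof
      assume z: "adj z1 z2"
      have "clq adj (insert z2 Q1)"
      proof -
        have "adj z2 c" if "c \<in> Q1" for c
        proof (cases "c = z1")
          case True then show ?thesis using z adj_sym by blast
        next
          case False
          then have "c \<in> Q2" using that Q1e Q2e by auto
          then show ?thesis using clqD[OF cq(3)[OF Q2(1)] z2(1)] that z2(2) by auto
        qed
        then show ?thesis using cq(3)[OF Q1] by (simp add: clq_insert)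
      qed
      then have "clq adj (insert z2 Q1 - {d})" by (rule clq_diff)
      moreover have "card (insert z2 Q1 - {d}) = q" using cq[OF Q1] z2 dQ by simp
      moreover have "insert z2 Q1 - {d} \<subseteq> V - A" using cq[OF Q1] cq[OF Q2(1)] z2 by auto
      ultimately have "insert z2 Q1 - {d} \<in> qs A" by (simp add: qs_def)
      then show False using tokD(5)[OF assms] by blast
    qed
    have "qs A = {Q1, Q2}"
    proof -
      have "Q = Q1 \<or> Q = Q2" if Q: "Q \<in> qs A" for Q
      proof -
        have "Q \<subseteq> Q1 \<union> Q2" using sub[OF Q] tot by simp
        moreover have "\<not> (z1 \<in> Q \<and> z2 \<in> Q)" using clqD[OF cq(3)[OF Q]] nz z1 z2 by blast
        ultimately have "Q \<subseteq> Q1 \<or> Q \<subseteq> Q2" using Q1e Q2e by blast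
        then show ?thesis using card_subset_eq cq Q Q1 Q2(1) by metis
      qed
      then show ?thesis using Q1 Q2 by blast
    qed
    moreover have "card I = q - 1"
    proof -
      have "I = Q1 - {z1}" using Q1e z1 z2 I_def by auto
      then show ?thesis using cq[OF Q1] z1 by simp
    qed
    ultimately show ?thesis
      using two[of z1 I z2] Q1e Q2e z1 z2 nz dQ I_def by (metis IntI IntD1 IntD2)
  qed
qed

section \<open>Private cliques that meet the kernel\<close>

lemma pclqD: "pclq B K \<Longrightarrow> K \<subseteq> B" "pclq B K \<Longrightarrow> clq adj K" "pclq B K \<Longrightarrow> card K = p" "pclq B K \<Longrightarrow> finite K"
  using fin_card(1)[of K] by (simp_all add: pclq_def)

lemma privD: "priv A x E \<Longrightarrow> E \<subseteq> A" "priv A x E \<Longrightarrow> E \<subseteq> nb x" "priv A x E \<Longrightarrow> clq adj E"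
  "priv A x E \<Longrightarrow> card E = p - 1" "priv A x E \<Longrightarrow> finite E"
  using fin_card(3)[of E] by (simp_all add: priv_def)

lemma no_join:
  assumes "clq adj K" "K \<subseteq> V" "card K = p" "x \<in> V" "x \<notin> K" "K \<subseteq> nb x" shows False
proof -
  have "clq adj (insert x K)" using clq_insert_nb assms by blast
  then have "card (insert x K) \<le> p" using no_big[of "insert x K"] assms by simp
  then show False using assms fin_card(1)[of K] by simp
qed

lemma core_priv: "u \<in> core A t \<Longrightarrow> priv A t E \<Longrightarrow> u \<in> E"
  unfolding priv_def using coreD by blast

lemma coreI:
  assumes "u \<in> A" "\<And>E. priv A t E \<Longrightarrow> u \<in> E" shows "u \<in> core A t"
  using assms unfolding core_def priv_def by simp

lemma opt_priv: assumes "opt A" "x \<in> V - A" obtains E where "priv A x E"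
proof -
  obtain E where E: "E \<subseteq> A \<inter> nb x" "clq adj E" "card E = p - 1"
    using private_clique[OF assms] by metis
  show ?thesis by (rule that[of E]) (use E in \<open>simp add: priv_def\<close>)
qed

lemma priv_ex: assumes "tok A t" obtains E where "priv A t E"
  using opt_priv[of A t] tokD[OF assms] by blast

lemma kern_priv:
  assumes "cfg B" "u \<in> kern B" "x \<in> V - B" obtains E where "priv (B - {u}) x E"
  using opt_priv[OF tokD(1)[OF cfg_kern_tok[OF assms(1,2)]], of x] assms(3) by blast

text \<open>All neighbours of \<open>g\<close> in \<open>B\<close> lie in \<open>insert a K\<close>,
  so \<open>E\<close> is confined to that set, and a clique cannot contain both \<open>a\<close> and
  \<open>b\<close>.\<close>

lemma priv_in_pclq_double:
  assumes "cfg B" "pclq B K" "a \<notin> K" "b \<in> K" "\<not> adj a b" "pclq B (insert a (K - {b}))"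
    and nbB: "\<And>u. u \<in> K - {b} \<Longrightarrow> nb u \<inter> B = insert a K - {u}"
    and "priv B x E" "g \<in> E" "g \<in> K - {b}"
  shows "\<exists>K'. pclq B K' \<and> E \<subseteq> K'"
proof -
  have "E - {g} \<subseteq> nb g"
    using clq_nb[OF privD(3)[OF assms(8)] _ assms(9)] privD(1)[OF assms(8)] cfg_sub[OF assms(1)] by blast
  then have "E - {g} \<subseteq> nb g \<inter> B" using privD(1)[OF assms(8)] by blast
  then have "E \<subseteq> insert a K" using nbB[OF assms(10)] assms(10) by blast
  moreover have "\<not> (a \<in> E \<and> b \<in> E)" using clqD[OF privD(3)[OF assms(8)]] assms(3-5) by blast
  ultimately have "E \<subseteq> K \<or> E \<subseteq> insert a (K - {b})" by blast
  then show ?thesis using assms(2,6) by blast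
qed

text \<open>A vertex \<open>s\<close> of \<open>E\<close> off \<open>K\<close> is the spare inner
  neighbour of every vertex of \<open>E\<close> in \<open>K\<close>. Hence \<open>x\<close> belongs
  to the outer clique of \<open>g\<close> and has at most \<open>p\<close> neighbours in
  \<open>B - {g}\<close>. A private clique of \<open>x\<close> there overlaps \<open>E - {g}\<close>
  in at least \<open>p - 3\<close> vertices but can share only \<open>s\<close>, so
  \<open>p = 4\<close>. The remaining case forces \<open>q = 3\<close> and ends in a clique on five
  vertices.\<close>

lemma priv_in_pclq_single:
  assumes cfg: "cfg B" and x: "x \<in> V - B" and K: "pclq B K" "kern B = K"
    and uni: "\<And>K'. pclq B K' \<Longrightarrow> K' = K"
    and E: "priv B x E" and g: "g \<in> E" "g \<in> K" and p4: "4 \<le> p"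
  shows "E \<subseteq> K"
proof (rule ccontr)
  assume "\<not> E \<subseteq> K"
  then obtain s where s: "s \<in> E" "s \<notin> K" by blast
  have BV: "B \<subseteq> V" using cfg_sub[OF cfg] .
  have KV: "K \<subseteq> V" using pclqD[OF K(1)] BV by blast
  have EV: "E \<subseteq> V" using privD[OF E] BV by blast
  have sB: "s \<in> B" "s \<in> V" using s privD(1)[OF E] BV by auto
  have gB: "g \<in> B" "g \<in> V" using g pclqD(1)[OF K(1)] BV by auto
  have nbB: "nb h \<inter> B = insert s K - {h}" "card (nb h \<inter> B) = p" if h: "h \<in> E" "h \<in> K" for h
  proof -
    have hs: "h \<noteq> s" using h s by auto
    have "insert s K - {h} \<subseteq> nb h \<inter> B"
      using clq_nb[OF pclqD(2)[OF K(1)] KV h(2)] clq_nb[OF privD(3)[OF E] EV h(1)] s sB pclqD(1)[OF K(1)] hs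
      by blast
    moreover have c: "card (insert s K - {h}) = p" using h(2) hs s pclqD[OF K(1)] by simp
    moreover have le: "card (nb h \<inter> B) \<le> p" using cfg_in_le[OF cfg] h K(2) by blast
    ultimately show e: "nb h \<inter> B = insert s K - {h}" using fin_nb card_seteq[of "nb h \<inter> B" "insert s K - {h}"] by simp
    show "card (nb h \<inter> B) = p" using e c by simp
  qed
  have gk: "g \<in> kern B" using g K by simp
  obtain D where D: "D \<subseteq> nb g - B" "clq adj (insert g D)" "card D = q - 1" "insert g D \<in> qs (B - {g})"
    using cfg_D[OF cfg gk] by metis
  have Dg: "nb g - B = D" using cfg_out_le[OF cfg gk _ D(1,3)] nbB[OF g] by simp
  have xg: "x \<in> nb g" using g privD(2)[OF E] nb_sym x by blast
  have xD: "x \<in> D" using xg Dg x by blast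
  let ?A = "B - {g}"
  have tg: "tok ?A g" using cfg_kern_tok[OF cfg gk] .
  have le: "card (nb x \<inter> ?A) \<le> p" using q_vertex_in[OF D(4)] xD by blast
  have xA: "x \<in> V - ?A" using x by blast
  have EK: "E \<subseteq> insert s K"
  proof -
    have "E - {g} \<subseteq> nb g \<inter> B" using clq_nb[OF privD(3)[OF E] EV g(1)] privD(1)[OF E] by blast
    then show ?thesis using nbB[OF g] g by blast
  qed
  have E1: "E - {g} \<subseteq> nb x \<inter> ?A" using privD[OF E] by blast
  have c1: "card (E - {g}) = p - 2" using privD[OF E] g by simp
  have common: "p - 3 \<le> card ((E - {g}) \<inter> F)" if F: "priv ?A x F" for F
  proof -
    have "card ((E - {g}) \<union> F) \<le> p"
      using card_mono[of "nb x \<inter> ?A" "(E - {g}) \<union> F"] E1 privD[OF F] fin_nb le by auto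
    moreover have "card ((E - {g}) \<union> F) + card ((E - {g}) \<inter> F) = (p - 2) + (p - 1)"
      using card_Un_Int[of "E - {g}" F] c1 privD[OF F] privD[OF E] by simp
    ultimately show ?thesis by simp
  qed
  \<comment> \<open>Sharing another vertex \<open>h\<close> would confine \<open>F\<close> to
    \<open>insert s K - {g}\<close>. Without \<open>s\<close> it is \<open>K - {g}\<close> and
    \<open>x\<close> is joined to all of \<open>K\<close>; with \<open>s\<close>,
    \<open>insert g F\<close> is a second \<open>p\<close>-clique of \<open>B\<close>.\<close>
  have claim: "(E - {g}) \<inter> F = {s}" if F: "priv ?A x F" for F
  proof -
    have disj: "h \<notin> F" if h: "h \<in> E" "h \<in> K" "h \<noteq> g" for h
    proof
      assume hF: "h \<in> F"
      have FB: "F \<subseteq> B" "g \<notin> F" using privD(1)[OF F] by auto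
      have FV: "F \<subseteq> V" using FB BV by blast
      have "F - {h} \<subseteq> nb h \<inter> B" using clq_nb[OF privD(3)[OF F] FV hF] FB by blast
      then have FK: "F \<subseteq> insert s K - {g}" using nbB[OF h(1,2)] h FB by blast
      show False
      proof (cases "s \<in> F")
        case False
        then have "F \<subseteq> K - {g}" using FK by blast
        moreover have "card (K - {g}) = p - 1" using pclqD[OF K(1)] g by simp
        ultimately have "F = K - {g}" using card_subset_eq[of "K - {g}" F] pclqD[OF K(1)] privD[OF F] by simp
        then have "K \<subseteq> nb x" using privD(2)[OF F] privD(2)[OF E] g by blast
        then show False using no_join[of K x] pclqD[OF K(1)] KV x by blast
      next
        case True
        have "F \<subseteq> nb g"
          using clq_nb[OF pclqD(2)[OF K(1)] KV g(2)] clq_nb[OF privD(3)[OF E] EV g(1)] FK s g by blast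
        then have "clq adj (insert g F)" using clq_insert_nb privD(3)[OF F] by blast
        moreover have "card (insert g F) = p" using privD[OF F] FB p4 by simp
        moreover have "insert g F \<subseteq> B" using FB gB by blast
        ultimately have "pclq B (insert g F)" by (simp add: pclq_def)
        then have "insert g F = K" by (rule uni)
        then show False using True s by blast
      qed
    qed
    then have sub: "(E - {g}) \<inter> F \<subseteq> {s}" using EK by blast
    have "p - 3 \<le> card ((E - {g}) \<inter> F)" using common[OF F] .
    then have "(E - {g}) \<inter> F \<noteq> {}" using p4 by auto
    then show ?thesis using sub by blast
  qed
  obtain F where F: "priv ?A x F" using opt_priv[OF tokD(1)[OF tg] xA] by metis
  have p_eq: "p = 4" using common[OF F] claim[OF F] p4 by simp
  have sF: "s \<in> F" using claim[OF F] by blast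
  have gs: "g \<noteq> s" using g s by auto
  have "card (E - {g} - {s}) = 1" using c1 p_eq s gs privD[OF E] by simp
  then obtain g2 where g2: "E - {g} - {s} = {g2}" by (auto simp: card_1_singleton_iff)
  have Ee: "E = {g, g2, s}" "g2 \<noteq> g" "g2 \<noteq> s" using g2 g s by auto
  have g2F: "g2 \<notin> F" using claim[OF F] Ee by blast
  have g2K: "g2 \<in> K" using EK Ee by blast
  have g2V: "g2 \<in> V" "g2 \<in> B" using Ee EV privD(1)[OF E] by auto
  have nx: "nb x \<inter> ?A = insert g2 F"
  proof (rule card_seteq[symmetric])
    show "card (nb x \<inter> ?A) \<le> card (insert g2 F)" using le privD[OF F] g2F p_eq by simp
    show "insert g2 F \<subseteq> nb x \<inter> ?A" using privD[OF F] E1 Ee by blast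
  qed (use fin_nb in simp)
  have nxo: "nb x - ?A = insert g D - {x}"
  proof (rule card_seteq[symmetric])
    have q1: "insert g D - {x} \<subseteq> nb x - ?A" using q_vertex_out(1)[OF D(4)] xD by blast
    then show "insert g D - {x} \<subseteq> nb x - ?A" .
    have "card (nb x \<inter> ?A) = p" using nx privD[OF F] g2F p_eq by simp
    then have "card (nb x - ?A) \<le> q - 1" using nb_split[of x ?A] deg_nb[of x] x by simp
    moreover have "card (insert g D) = q" using D(4) by (simp add: qs_def)
    then have "card (insert g D - {x}) = q - 1" using xD by simp
    ultimately show "card (nb x - ?A) \<le> card (insert g D - {x})" by simp
  qed (use fin_nb in simp)
  obtain D2 where D2: "D2 \<subseteq> nb g2 - B" "clq adj (insert g2 D2)" "card D2 = q - 1"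
    using cfg_D[OF cfg, of g2] g2K K(2) by metis
  have D2e: "nb g2 - B = D2" using cfg_out_le[OF cfg _ _ D2(1,3)] nbB[of g2] g2K K(2) Ee by blast
  have xD2: "x \<in> D2"
  proof -
    have "x \<in> nb g2" using Ee privD(2)[OF E] nb_sym[of x g2] x by blast
    then show ?thesis using D2e x by blast
  qed
  \<comment> \<open>The inner degree \<open>p\<close> of \<open>x\<close> leaves it no outer
    neighbours besides \<open>insert g D - {x}\<close>, and \<open>D2\<close> is a clique through
    \<open>x\<close>.\<close>
  have "D2 \<subseteq> D"
  proof
    fix z assume z: "z \<in> D2"
    show "z \<in> D"
    proof (cases "z = x")
      case True then show ?thesis using xD by simp
    next
      case False
      have zV: "z \<in> V" "z \<notin> B" using D2(1) z nb_sub by auto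
      have "adj x z" using clqD[OF D2(2), of x z] xD2 z False by blast
      then have "z \<in> nb x - ?A" using zV by (simp add: nb_def)
      then show ?thesis using nxo zV(2) gB(1) by fast
    qed
  qed
  then have D2D: "D2 = D" using card_subset_eq[of D D2] D(3) D2(3) fin_card(4)[OF D(3)] by simp
  have gg2: "adj g g2" using clqD[OF privD(3)[OF E]] Ee by blast
  have Cq: "clq adj (insert g (insert g2 D))"
  proof -
    have "\<forall>c\<in>insert g2 D. c \<noteq> g \<longrightarrow> adj g c" using D(2) gg2 by (auto simp: clq_insert)
    then show ?thesis using D2(2) D2D clq_insert[of g "insert g2 D"] by simp
  qed
  have gD: "g \<notin> D" "g2 \<notin> D" using D(1) gB g2V by auto
  have q_eq: "q = 3"
  proof -
    have "card (insert g (insert g2 D)) = Suc q" using gD D(3) Ee q3 fin_card(4)[OF D(3)] by simp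
    moreover have "insert g (insert g2 D) \<subseteq> V" using D(1) gB g2V nb_sub by blast
    ultimately have "Suc q \<le> p" using no_big[OF _ Cq] by simp
    then show ?thesis using p_eq q3 by simp
  qed
  obtain x2 where x2: "D = {x, x2}" "x2 \<noteq> x"
  proof -
    have "card (D - {x}) = 1" using D(3) q_eq xD by simp
    then obtain y where "D - {x} = {y}" by (auto simp: card_1_singleton_iff)
    then show ?thesis using that[of y] xD by blast
  qed
  \<comment> \<open>The only outer \<open>q\<close>-clique is \<open>insert g D\<close>, so
    \<open>x\<close> can take over from \<open>g\<close> and then be exchanged with
    \<open>s\<close>.\<close>
  have tx: "tok ?A x"
  proof -
    have "x \<in> Q" if Q: "Q \<in> qs ?A" for Q
    proof -
      have gQ: "g \<in> Q" using tokD(5)[OF tg Q] .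
      have "Q - {g} \<subseteq> nb g - ?A" using q_vertex_out(1)[OF Q gQ] .
      moreover have "nb g - ?A = D" using Dg nb_irrefl[of g] by blast
      moreover have "card (Q - {g}) = q - 1" using Q gQ by (simp add: qs_def)
      ultimately have "Q - {g} = D" using card_subset_eq[of D "Q - {g}"] D(3) fin_card(4)[OF D(3)] by simp
      then show ?thesis using xD by blast
    qed
    then show ?thesis using tokD(1)[OF tg] xA unfolding tok_def by blast
  qed
  have sc: "s \<in> core ?A x"
  proof (rule coreI)
    show "s \<in> ?A" using sB gs by blast
    show "s \<in> E'" if "priv ?A x E'" for E' using claim[OF that] by blast
  qed
  obtain D' where D': "D' \<subseteq> V - (insert x ?A - {s}) - {s}" "clq adj (insert s D')" "card D' = q - 1" "D' \<subseteq> nb s"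
    using tok_q[OF swap_tok[OF tx sc]] by metis
  have s1: "insert x (insert g2 (F - {s})) \<subseteq> nb s"
  proof -
    have "F \<subseteq> V" using privD(1)[OF F] BV by blast
    then have "F - {s} \<subseteq> nb s" using clq_nb[OF privD(3)[OF F]] sF by blast
    moreover have "x \<in> nb s" using s privD(2)[OF E] nb_sym[of x s] x by blast
    moreover have "g2 \<in> nb s" using clq_nb[OF privD(3)[OF E] EV s(1)] Ee by blast
    ultimately show ?thesis by blast
  qed
  have disj: "insert x (insert g2 (F - {s})) \<inter> D' = {}"
    using D'(1) privD(1)[OF F] g2V Ee by blast
  have c4: "card (insert x (insert g2 (F - {s}))) = 4"
  proof -
    have "x \<noteq> g2" "x \<notin> F" using x g2V privD(1)[OF F] by auto
    then show ?thesis using g2F privD[OF F] sF p_eq by simp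
  qed
  have "card (insert x (insert g2 (F - {s})) \<union> D') = 6"
    using card_Un_disjoint[OF _ _ disj] c4 D'(3) q_eq fin_card(4)[OF D'(3)] privD(5)[OF F] by simp
  moreover have "insert x (insert g2 (F - {s})) \<union> D' \<subseteq> nb s" using s1 D'(4) by blast
  moreover have "card (nb s) \<le> 6" using deg_nb[OF sB(2)] p_eq q_eq by simp
  ultimately have nbs: "nb s = insert x (insert g2 (F - {s})) \<union> D'"
    using card_seteq[OF fin_nb, of "insert x (insert g2 (F - {s})) \<union> D'" s] by simp
  \<comment> \<open>The degree of \<open>s\<close> is exhausted, so its neighbour \<open>g\<close>
    must be in \<open>D'\<close>. The other vertex of \<open>D'\<close> is then an outer neighbour
    of \<open>g\<close> different from \<open>x\<close>, namely \<open>x2\<close>.\<close>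
  have "g \<in> nb s" using clq_nb[OF privD(3)[OF E] EV s(1)] g gs by blast
  moreover have "g \<noteq> x" "g \<noteq> g2" "g \<notin> F" using x gB Ee privD(1)[OF F] by auto
  ultimately have gD': "g \<in> D'" using nbs by blast
  have "card (D' - {g}) = 1" using D'(3) q_eq gD' by simp
  then obtain z where z: "D' - {g} = {z}" by (auto simp: card_1_singleton_iff)
  have zD': "z \<in> D'" "z \<noteq> g" using z by auto
  have "z \<notin> B" "z \<noteq> x" "z \<in> V" using D'(1) zD' by auto
  moreover have "adj g z" using clqD[OF D'(2)] gD' zD' by blast
  ultimately have "z \<in> nb g - B" by (simp add: nb_def)
  then have zx2: "z = x2" using Dg x2 \<open>z \<noteq> x\<close> by blast
  have asx: "adj s x2" using D'(4) zD' zx2 by (auto simp: nb_def)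
  have C5: "clq adj (insert s (insert g (insert g2 D)))"
  proof -
    have "adj s c" if c: "c \<in> insert g (insert g2 D)" for c
    proof -
      have "adj s g" "adj s g2" using clqD[OF privD(3)[OF E], of s] Ee gs by auto
      moreover have "adj s x" using s1 by (simp add: nb_def)
      ultimately show ?thesis using c x2 asx by auto
    qed
    then show ?thesis using Cq clq_insert[of s] by simp
  qed
  have "s \<notin> D" using D(1) sB by blast
  then have "card (insert s (insert g (insert g2 D))) = 5"
    using gD D(3) Ee q_eq fin_card(4)[OF D(3)] gs by simp
  moreover have "insert s (insert g (insert g2 D)) \<subseteq> V" using sB D(1) gB g2V nb_sub by blast
  ultimately show False using no_big[OF _ C5] p_eq by simp
qed

lemma priv_in_pclq:
  assumes "cfg B" "x \<in> V - B" "priv B x E" "g \<in> E" "g \<in> kern B" "4 \<le> p"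
  shows "\<exists>K'. pclq B K' \<and> E \<subseteq> K'"
  using assms(1)
proof (cases rule: cfg_structure)
  case (single K)
  then show ?thesis using priv_in_pclq_single[OF assms(1,2) single assms(3,4) _ assms(6)] assms(5) by blast
next
  case (double K a b)
  show ?thesis
    by (rule priv_in_pclq_double[OF assms(1) double(1,3,4,5,6,9) assms(3,4)]) (use assms(5) double(7) in auto)
qed

text \<open>A private clique for \<open>B - {g}\<close> that met the kernel would lie in a
  \<open>p\<close>-clique \<open>K\<close> and equal \<open>K - {g}\<close>. As \<open>x\<close> is
  also adjacent to \<open>g\<close>, it would be joined to all of \<open>K\<close>.\<close>

lemma priv_off_kern:
  assumes "cfg B" "x \<in> V - B" "priv B x E" "g \<in> E" "g \<in> kern B" "4 \<le> p"
  obtains F where "priv B x F" "F \<inter> kern B = {}"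
proof -
  obtain F where F: "priv (B - {g}) x F" using kern_priv[OF assms(1,5,2)] .
  have pF: "priv B x F" using F by (auto simp: priv_def)
  have "F \<inter> kern B = {}"
  proof (rule ccontr)
    assume "F \<inter> kern B \<noteq> {}"
    then obtain h where h: "h \<in> F" "h \<in> kern B" by blast
    obtain K where K: "pclq B K" "F \<subseteq> K" using priv_in_pclq[OF assms(1,2) pF h assms(6)] by blast
    have gK: "g \<in> K" using kernD[OF assms(5)] pclqD[OF K(1)] by blast
    have "F = K - {g}"
      using card_subset_eq[of "K - {g}" F] pclqD[OF K(1)] gK K(2) privD[OF F] by auto
    then have "K \<subseteq> nb x" using privD(2)[OF F] privD(2)[OF assms(3)] assms(4) by blast
    then show False using no_join[of K x] pclqD[OF K(1)] cfg_sub[OF assms(1)] assms(2) by blast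
  qed
  then show ?thesis using that pF by blast
qed

end

section \<open>The case \<open>p \<ge> 4\<close>\<close>

text \<open>
  Step \<open>i\<close> exchanges \<open>x i\<close> with \<open>y i\<close>. By \<open>off\<close> the vertices of the kernels \<open>L j\<close>, apart from \<open>y j\<close>, are never
  moved again, and \<open>y j\<close> never returns.
\<close>

locale swap_walk = clique_part V adj p q
  for V :: "'a set" and adj p q +
  fixes A :: "nat \<Rightarrow> 'a set" and x y :: "nat \<Rightarrow> 'a" and n :: nat
  assumes start: "\<exists>t. tok (A 0) t"
    and tokx: "i < n \<Longrightarrow> tok (A i) (x i)"
    and ycore: "i < n \<Longrightarrow> y i \<in> core (A i) (x i)"
    and Anext: "i < n \<Longrightarrow> A (Suc i) = insert (x i) (A i) - {y i}"
    and off: "i < n \<Longrightarrow> \<exists>E. priv (A i) (x i) E \<and> (\<forall>j<i. E \<inter> kern (insert (x j) (A j)) = {})"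
    and fresh: "i < n \<Longrightarrow> j < i \<Longrightarrow> x i \<noteq> y j"
    and p4: "4 \<le> p"
begin

definition "B j = insert (x j) (A j)"
definition "L j = kern (B j)"

lemma cB: "i < n \<Longrightarrow> cfg (B i)"
  using cfg_tok[OF tokx] by (simp add: B_def)

lemma xA: "i < n \<Longrightarrow> x i \<notin> A i"
  using tokD(4)[OF tokx] .

lemma yA: "i < n \<Longrightarrow> y i \<in> A i"
  using core_sub[OF ycore] .

lemma Leq: "i < n \<Longrightarrow> L i = insert (x i) (core (A i) (x i))"
  using kern_core[OF tokx] by (simp add: B_def L_def)

lemma xL: "i < n \<Longrightarrow> x i \<in> L i" and yL: "i < n \<Longrightarrow> y i \<in> L i"
  using Leq ycore by auto

lemma L_sub: "L i \<subseteq> B i"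
  by (auto simp: L_def kern_def)

lemma E_ex:
  assumes "i < n"
  obtains E where "priv (A i) (x i) E" "\<And>j. j < i \<Longrightarrow> E \<inter> L j = {}" "L i \<subseteq> insert (x i) E"
proof -
  obtain E where E: "priv (A i) (x i) E" "\<forall>j<i. E \<inter> kern (insert (x j) (A j)) = {}"
    using off[OF assms] by blast
  have "L i \<subseteq> insert (x i) E" using Leq[OF assms] core_priv[OF _ E(1)] by blast
  then show ?thesis using that E by (simp add: L_def B_def)
qed

lemma up: "j \<le> k \<Longrightarrow> k \<le> n \<Longrightarrow> A k \<subseteq> A j \<union> x ` {j..<k}"
proof (induction k rule: dec_induct)
  case (step k)
  then have "A (Suc k) \<subseteq> insert (x k) (A k)" "A k \<subseteq> A j \<union> x ` {j..<k}" using Anext[of k] by auto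
  moreover have "{j..<Suc k} = insert k {j..<k}" using step by auto
  ultimately show ?case by auto
qed simp

lemma down: "j \<le> k \<Longrightarrow> k \<le> n \<Longrightarrow> A j \<subseteq> A k \<union> y ` {j..<k}"
proof (induction k rule: dec_induct)
  case (step k)
  then have "A k \<subseteq> insert (y k) (A (Suc k))" "A j \<subseteq> A k \<union> y ` {j..<k}" using Anext[of k] by auto
  moreover have "{j..<Suc k} = insert k {j..<k}" using step by auto
  ultimately show ?case by auto
qed simp

lemma B_down: assumes "j < k" "k \<le> n" shows "B j \<subseteq> A k \<union> y ` {j..<k}"
proof -
  have "B j \<subseteq> insert (y j) (A (Suc j))" using Anext[of j] assms by (auto simp: B_def)
  moreover have "A (Suc j) \<subseteq> A k \<union> y ` {Suc j..<k}" using down[of "Suc j" k] assms by simp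
  moreover have "{j..<k} = insert j {Suc j..<k}" using assms by auto
  ultimately show ?thesis by auto
qed

lemma stay: "j < k \<Longrightarrow> k \<le> n \<Longrightarrow> L j - {y j} \<subseteq> A k \<and> y j \<notin> A k"
proof (induction k)
  case (Suc k)
  show ?case
  proof (cases "j = k")
    case True
    then show ?thesis using Anext[of k] L_sub[of k] Suc by (auto simp: B_def)
  next
    case False
    then have jk: "j < k" using Suc by simp
    then have IH: "L j - {y j} \<subseteq> A k" "y j \<notin> A k" using Suc by auto
    obtain E where E: "priv (A k) (x k) E" "\<And>j. j < k \<Longrightarrow> E \<inter> L j = {}" "L k \<subseteq> insert (x k) E"
      using E_ex[of k] Suc.prems by auto
    have "y k \<in> E" using core_priv[OF ycore E(1)] Suc.prems by simp
    then have "y k \<notin> L j" using E(2)[OF jk] by blast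
    then show ?thesis using IH Anext[of k] fresh[of k j] jk Suc.prems by auto
  qed
qed simp

lemma y_notin_L: assumes "i < j" "j < n" shows "y j \<notin> L i"
proof -
  obtain E where E: "priv (A j) (x j) E" "\<And>i. i < j \<Longrightarrow> E \<inter> L i = {}" "L j \<subseteq> insert (x j) E"
    using E_ex[OF assms(2)] by metis
  have "y j \<in> E" using core_priv[OF ycore E(1)] assms by simp
  then show ?thesis using E(2)[OF assms(1)] by blast
qed

text \<open>Every entering \<open>x i\<close> is in \<open>L i\<close>, and \<open>y j\<close>
  avoids all earlier kernels. So a vertex that leaves did not enter before.\<close>

lemma y_in: assumes "i \<le> j" "j < n" shows "y j \<in> A i"
proof -
  have "y j \<in> A i \<union> x ` {i..<j}" using up[of i j] yA[of j] assms by auto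
  moreover have "y j \<notin> x ` {i..<j}"
    using y_notin_L[of _ j] xL assms by fastforce
  ultimately show ?thesis by blast
qed

lemma y_inj: assumes "i < n" "j < n" "y i = y j" shows "i = j"
proof -
  have "y a \<noteq> y b" if "a < b" "b < n" for a b
    using stay[of a b] yA[of b] that by auto
  then show ?thesis using assms by (metis linorder_neqE_nat)
qed

text \<open>Since \<open>y b\<close> is not in \<open>L a\<close>, it is the spare inner neighbour
  of \<open>y a\<close>. In the double case it would have to be one of the two tips. It would then
  see \<open>L a - {y a}\<close> and, disjoint from it, \<open>x b\<close> with the rest of a
  private clique: \<open>2p - 3 > p\<close> inner neighbours.\<close>

lemma later_nb:
  assumes ab: "a < b" "b < n" and adj: "adj (y a) (y b)"
  shows "nb (y a) \<inter> B a = insert (y b) (L a - {y a})" "card (nb (y a) \<inter> B a) = p"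
proof -
  have a: "a < n" using ab by simp
  have ca: "cfg (B a)" using cB[OF a] .
  have BV: "B a \<subseteq> V" using cfg_sub[OF ca] .
  have yk: "y a \<in> kern (B a)" using yL[OF a] by (simp add: L_def)
  have yb: "y b \<in> B a" "y b \<in> V" using y_in[of a b] ab BV by (auto simp: B_def)
  have yn: "y b \<in> nb (y a)" using adj yb by (simp add: nb_def)
  have yL': "y b \<notin> L a" using y_notin_L[OF ab] .
  have "nb (y a) \<inter> B a = insert (y b) (L a - {y a}) \<and> card (nb (y a) \<inter> B a) = p"
    using ca
  proof (cases rule: cfg_structure)
    case (single K)
    have LK: "L a = K" using single(2) by (simp add: L_def)
    have sub: "insert (y b) (L a - {y a}) \<subseteq> nb (y a) \<inter> B a"
      using clq_nb[OF pclqD(2)[OF single(1)] _ yk[unfolded single(2)]] pclqD(1)[OF single(1)] BV LK yn yb by blast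
    have c: "card (insert (y b) (L a - {y a})) = p"
      using pclqD[OF single(1)] LK yL' yL[OF a] p4 by simp
    have le: "card (nb (y a) \<inter> B a) \<le> p" using cfg_in_le[OF ca yk] .
    have 1: "nb (y a) \<inter> B a = insert (y b) (L a - {y a})"
      using card_seteq[OF _ sub] fin_nb c le by simp
    then show ?thesis using c by simp
  next
    case (double K a' b')
    have LK: "L a = K - {b'}" using double(7) by (simp add: L_def)
    have yaK: "y a \<in> K - {b'}" using yL[OF a] LK by simp
    have "y b \<in> insert a' K - {y a}" using double(9)[OF yaK] yn yb by blast
    then have yab: "y b = a' \<or> y b = b'" using yL' LK by blast
    have KV: "K \<subseteq> V" "insert a' (K - {b'}) \<subseteq> V" using pclqD(1)[OF double(1)] pclqD(1)[OF double(6)] BV by auto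
    have S2: "L a - {y a} \<subseteq> nb (y b)"
      using yab
    proof
      assume "y b = a'"
      then show ?thesis using clq_nb[OF pclqD(2)[OF double(6)] KV(2), of a'] double(3) LK by blast
    next
      assume "y b = b'"
      then show ?thesis using clq_nb[OF pclqD(2)[OF double(1)] KV(1), of b'] double(4) LK by blast
    qed
    have S2A: "L a - {y a} \<subseteq> A b" using stay[of a b] ab by simp
    obtain E where E: "priv (A b) (x b) E" "\<And>j. j < b \<Longrightarrow> E \<inter> L j = {}"
      using E_ex[OF ab(2)] by metis
    have ybE: "y b \<in> E" using core_priv[OF ycore E(1)] ab by simp
    have bV: "x b \<in> V" "A b \<subseteq> V" using tokD[OF tokx[OF ab(2)]] by auto
    have EV: "E \<subseteq> V" using privD(1)[OF E(1)] bV by blast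
    have S1: "insert (x b) (E - {y b}) \<subseteq> nb (y b)"
      using clq_nb[OF privD(3)[OF E(1)] EV ybE] privD(2)[OF E(1)] nb_sym[OF bV(1)] ybE by blast
    have S1B: "insert (x b) (E - {y b}) \<subseteq> B b" "S \<subseteq> A b \<Longrightarrow> S \<subseteq> B b" for S
      using privD(1)[OF E(1)] by (auto simp: B_def)
    have disj: "insert (x b) (E - {y b}) \<inter> (L a - {y a}) = {}"
      using E(2)[OF ab(1)] xA[OF ab(2)] S2A by blast
    have c1: "card (insert (x b) (E - {y b})) = p - 1"
    proof -
      have "x b \<notin> E" using privD(1)[OF E(1)] xA[OF ab(2)] by blast
      then show ?thesis using privD[OF E(1)] ybE p4 by simp
    qed
    have c2: "card (L a - {y a}) = p - 2" using yaK LK pclqD[OF double(1)] double(4) by simp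
    have f2: "finite (L a - {y a})" using LK pclqD[OF double(1)] by simp
    have "card (insert (x b) (E - {y b}) \<union> (L a - {y a})) = (p - 1) + (p - 2)"
      using card_Un_disjoint[OF _ f2 disj] c1 c2 privD(5)[OF E(1)] by simp
    moreover have "card (insert (x b) (E - {y b}) \<union> (L a - {y a})) \<le> card (nb (y b) \<inter> B b)"
      by (rule card_mono) (use fin_nb S1 S1B S2 S2A in auto)
    moreover have "card (nb (y b) \<inter> B b) \<le> p"
      using cfg_in_le[OF cB[OF ab(2)]] yL[OF ab(2)] by (simp add: L_def)
    ultimately have False using p4 by simp
    then show ?thesis by simp
  qed
  then show "nb (y a) \<inter> B a = insert (y b) (L a - {y a})" "card (nb (y a) \<inter> B a) = p" by blast+
qed

lemma later_unique:
  assumes "a < b" "b < n" "adj (y a) (y b)" "a < c" "c < n" "adj (y a) (y c)"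
  shows "y b = y c"
proof -
  have "y c \<in> nb (y a) \<inter> B a"
  proof -
    have "y c \<in> A a" using y_in[of a c] assms by simp
    moreover have "a < n" using assms by simp
    ultimately show ?thesis using assms(6) tokD(2)[OF tokx] by (auto simp: nb_def B_def)
  qed
  moreover have "y c \<notin> L a" using y_notin_L[OF assms(4,5)] .
  ultimately have "y c \<in> insert (y b) (L a - {y a}) - L a" using later_nb(1)[OF assms(1-3)] by simp
  then show ?thesis by auto
qed

text \<open>The vertex of the clique that left first has at most one neighbour among those that left
  later.\<close>

lemma Y_clique:
  assumes "C \<subseteq> y ` {..<n}" "clq adj C" shows "card C \<le> 2"
proof (cases "C = {}")
  case False
  then obtain i where i: "i < n" "y i \<in> C" using assms by blast
  define a where "a = (LEAST i. i < n \<and> y i \<in> C)"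
  have a: "a < n" "y a \<in> C" using LeastI[of "\<lambda>i. i < n \<and> y i \<in> C" i] i by (auto simp: a_def)
  have le: "a \<le> j" if "j < n" "y j \<in> C" for j using Least_le[of "\<lambda>i. i < n \<and> y i \<in> C" j] that by (auto simp: a_def)
  have fC: "finite C" using assms finite_subset by blast
  have "\<forall>u\<in>C - {y a}. \<forall>v\<in>C - {y a}. u = v"
  proof (intro ballI)
    fix u v assume u: "u \<in> C - {y a}" and v: "v \<in> C - {y a}"
    obtain b where b: "b < n" "u = y b" using u assms by blast
    obtain c where c: "c < n" "v = y c" using v assms by blast
    have "a \<le> b" "a \<noteq> b" "a \<le> c" "a \<noteq> c" using le u v b c by auto
    moreover have "adj (y a) u" "adj (y a) v" using clqD[OF assms(2) a(2)] u v by auto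
    ultimately show "u = v" using later_unique[of a b c] b c by simp
  qed
  then have "card (C - {y a}) \<le> Suc 0" using card_le_Suc0_iff_eq[of "C - {y a}"] fC by simp
  then show ?thesis using a fC by simp
qed simp

lemma outV: "t \<in> V \<Longrightarrow> t \<notin> A n \<Longrightarrow> t \<notin> y ` {..<n} \<Longrightarrow> j < n \<Longrightarrow> t \<in> V - B j"
  using B_down[of j n] by fastforce

text \<open>By \<open>Y_clique\<close>, candidates can run out only for \<open>q = 3\<close>, with
  two outer triangles on an edge \<open>d c\<close> of vertices that left. The vertex
  \<open>c\<close> left before \<open>d\<close>, so \<open>d\<close> is its spare inner neighbour
  and its outer neighbourhood at that time is a clique. It contains the nonadjacent
  \<open>z1\<close> and \<open>z2\<close>.\<close>

lemma candidate: obtains t where "tok (A n) t" "t \<notin> y ` {..<n}"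
proof (cases n)
  case 0
  then show ?thesis using start that by auto
next
  case (Suc m)
  define d where "d = y m"
  have m: "m < n" using Suc by simp
  have td: "tok (A n) d" using swap_tok[OF tokx[OF m] ycore[OF m]] Anext[OF m] Suc by (simp add: d_def)
  have o: "opt (A n)" using tokD[OF td] by blast
  show ?thesis
    using td
  proof (cases rule: qs_shape)
    case (one Q)
    have Q: "Q \<subseteq> V - A n" "clq adj Q" "card Q = q" using one by (auto simp: qs_def)
    have "\<not> Q \<subseteq> y ` {..<n}" using Y_clique[of Q] Q q3 by linarith
    then obtain t where t: "t \<in> Q" "t \<notin> y ` {..<n}" by blast
    have "tok (A n) t" using o Q t one by (auto simp: tok_def)
    then show ?thesis using that t by blast
  next
    case (two I z1 z2)
    have Q: "insert z1 I \<subseteq> V - A n" "clq adj (insert z1 I)" "insert z2 I \<subseteq> V - A n" "clq adj (insert z2 I)"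
    proof -
      have "insert z1 I \<in> qs (A n)" "insert z2 I \<in> qs (A n)" using two(1) by auto
      then show "insert z1 I \<subseteq> V - A n" "clq adj (insert z1 I)" "insert z2 I \<subseteq> V - A n" "clq adj (insert z2 I)"
        by (simp_all add: qs_def)
    qed
    have cI: "clq adj I" using Q clq_subset by blast
    have tI: "tok (A n) t" if "t \<in> I" for t using o Q that two by (auto simp: tok_def)
    show ?thesis
    proof (cases "I \<subseteq> y ` {..<n}")
      case False
      then show ?thesis using tI that by blast
    next
      case True
      have q: "q = 3" "card I = 2" using Y_clique[OF True cI] two(6) q3 by auto
      then have "card (I - {d}) = 1" using two(5) by simp
      then obtain c where c: "I - {d} = {c}" by (auto simp: card_1_singleton_iff)
      have cI': "c \<in> I" "c \<noteq> d" using c by auto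
      obtain a where a: "a < n" "c = y a" using True cI' by blast
      have am: "a < m" using a cI' Suc d_def by (metis less_antisym)
      have acd: "adj (y a) (y m)" using clqD[OF cI cI'(1) two(5) cI'(2)] a d_def by simp
      have ca: "cfg (B a)" and ya: "y a \<in> kern (B a)" using cB[OF a(1)] yL[OF a(1)] by (auto simp: L_def)
      obtain D where D: "D \<subseteq> nb (y a) - B a" "clq adj (insert (y a) D)" "card D = q - 1"
        using cfg_D[OF ca ya] by metis
      have De: "nb (y a) - B a = D" using cfg_out_le[OF ca ya _ D(1,3)] later_nb(2)[OF am m acd] by simp
      have zz: "z \<in> D" if zI: "z \<notin> I" and zQ: "insert z I \<subseteq> V - A n" "clq adj (insert z I)" for z
      proof -
        have ac: "adj z c" "adj z d" using clqD[OF zQ(2), of z] cI' two(5) zI by auto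
        have "z \<notin> y ` {..<n}"
        proof
          assume "z \<in> y ` {..<n}"
          then obtain e where e: "e < n" "z = y e" by blast
          have "e \<noteq> a" "e \<noteq> m" using e zI cI' two(5) a d_def by auto
          then consider "a < e" | "e < a" by linarith
          then show False
          proof cases
            case 1
            then show False using later_unique[of a e m] e am m acd ac(1) adj_sym a zI two(5) d_def by auto
          next
            case 2
            then show False using later_unique[of e a m] e am m ac a cI' d_def by auto
          qed
        qed
        then have "z \<in> V - B a" using outV[of z a] zQ a by blast
        then show ?thesis using De ac(1) adj_sym a by (auto simp: nb_def)
      qed
      have "z1 \<in> D" "z2 \<in> D" using zz two(3,4) Q by auto
      then have "adj z1 z2" using clqD[OF D(2), of z1 z2] two(2) by blast
      then show ?thesis using two(7) by blast
    qed
  qed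
qed

text \<open>Let \<open>L m\<close> be the last kernel that a private clique \<open>E\<close> meets.
  A private clique \<open>F\<close> off \<open>L m\<close> cannot have survived in
  \<open>A n\<close>, since together with \<open>L m - {y m}\<close> it gives too many inner
  neighbours. When \<open>F\<close> first loses a vertex \<open>y c\<close>, it lies in a
  \<open>p\<close>-clique of \<open>B c\<close>; counting again leaves only \<open>p = 4\<close> and
  a double configuration at step \<open>c\<close>. There a vertex \<open>b\<close> of both
  \<open>E\<close> and \<open>F\<close> is exchangeable, and its degree is too large.\<close>

lemma private_off_kernels:
  assumes tt: "tok (A n) t" and tY: "t \<notin> y ` {..<n}"
  shows "\<exists>E. priv (A n) t E \<and> (\<forall>j<n. E \<inter> L j = {})"
proof (rule ccontr)
  assume neg: "\<not> ?thesis"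
  have tV: "t \<in> V" "t \<notin> A n" using tokD[OF tt] by auto
  have tB: "t \<in> V - B j" if "j < n" for j using outV[OF tV tY that] .
  have in_le: "card (nb t \<inter> A n) \<le> p" using tok_in[OF tt] .
  obtain E where E: "priv (A n) t E" using priv_ex[OF tt] .
  define S where "S = {j. j < n \<and> E \<inter> L j \<noteq> {}}"
  have "S \<noteq> {}" "finite S" using neg E by (auto simp: S_def)
  define m where "m = Max S"
  have mS: "m \<in> S" using Max_in \<open>S \<noteq> {}\<close> \<open>finite S\<close> by (simp add: m_def)
  have m: "m < n" "E \<inter> L m \<noteq> {}" using mS by (auto simp: S_def)
  have mx: "E \<inter> L i = {}" if "m < i" "i < n" for i
  proof (rule ccontr)
    assume "E \<inter> L i \<noteq> {}"
    then have "i \<in> S" using that by (simp add: S_def)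
    then have "i \<le> m" using Max_ge[OF \<open>finite S\<close>] by (simp add: m_def)
    then show False using that by simp
  qed
  \<comment> \<open>No vertex of \<open>E\<close> entered after step \<open>i\<close>: it would lie
    in its own kernel, which \<open>E\<close> misses.\<close>
  have Esub: "E \<subseteq> B i" if i: "m \<le> i" "i < n" for i
  proof
    fix e assume e: "e \<in> E"
    have "e \<in> A (Suc i) \<union> x ` {Suc i..<n}" using up[of "Suc i" n] privD(1)[OF E] e i by auto
    moreover have "e \<notin> x ` {Suc i..<n}"
    proof
      assume "e \<in> x ` {Suc i..<n}"
      then obtain k where "k \<in> {Suc i..<n}" "e = x k" by blast
      then show False using mx[of k] xL[of k] e i by auto
    qed
    ultimately have "e \<in> A (Suc i)" by blast
    then show "e \<in> B i" using Anext[of i] i by (auto simp: B_def)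
  qed
  have EB: "priv (B m) t E" using E Esub[of m] m by (auto simp: priv_def)
  obtain g where g: "g \<in> E" "g \<in> kern (B m)" using m by (auto simp: L_def)
  have cm: "cfg (B m)" using cB[OF m(1)] .
  obtain K where K: "pclq (B m) K" "E \<subseteq> K" using priv_in_pclq[OF cm tB[OF m(1)] EB g p4] by blast
  have ymK: "y m \<in> K" using kernD[of "y m" "B m" K] yL[OF m(1)] pclqD[OF K(1)] by (simp add: L_def)
  have ymA: "y m \<notin> A n" "L m - {y m} \<subseteq> A n" using stay[of m n] m by auto
  have EK: "E = K - {y m}"
  proof (rule card_subset_eq)
    show "E \<subseteq> K - {y m}" using K(2) privD(1)[OF E] ymA by blast
  qed (use pclqD[OF K(1)] ymK privD[OF E] in simp_all)
  have LmK: "L m \<subseteq> K" using kernD[of _ "B m" K] pclqD[OF K(1)] by (auto simp: L_def)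
  obtain F where F: "priv (B m) t F" "F \<inter> kern (B m) = {}"
    using priv_off_kern[OF cm tB[OF m(1)] EB g p4] by metis
  have FL: "F \<inter> L m = {}" using F by (simp add: L_def)
  have FAm: "F \<subseteq> A m" using privD(1)[OF F(1)] FL xL[OF m(1)] by (auto simp: B_def)
  have "\<not> F \<subseteq> A n"
  proof
    assume FA: "F \<subseteq> A n"
    have d: "F \<inter> (L m - {y m}) = {}" using FL by blast
    have fL: "finite (L m)" using LmK pclqD(4)[OF K(1)] finite_subset by blast
    have "card (F \<union> (L m - {y m})) \<le> card (nb t \<inter> A n)"
    proof (rule card_mono)
      show "F \<union> (L m - {y m}) \<subseteq> nb t \<inter> A n"
        using FA privD(2)[OF F(1)] ymA LmK EK privD(2)[OF E] by blast
    qed (use fin_nb in simp)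
    moreover have "card (F \<union> (L m - {y m})) = (p - 1) + card (L m - {y m})"
      using card_Un_disjoint[OF _ _ d] privD[OF F(1)] fL by simp
    moreover have "card (L m - {y m}) \<ge> p - 2"
      using kern_card[OF cm] yL[OF m(1)] fL by (simp add: L_def)
    ultimately show False using in_le p4 by simp
  qed
  then obtain i where i: "m \<le> i" "i < n" "y i \<in> F"
    using down[of m n] FAm m by force
  define c where "c = (LEAST i. m \<le> i \<and> i < n \<and> y i \<in> F)"
  have c: "m \<le> c" "c < n" "y c \<in> F"
    using LeastI[of "\<lambda>i. m \<le> i \<and> i < n \<and> y i \<in> F" i] i by (auto simp: c_def)
  have cmin: "y j \<notin> F" if "m \<le> j" "j < c" for j
    using not_less_Least[of j "\<lambda>i. m \<le> i \<and> i < n \<and> y i \<in> F"] that c by (auto simp: c_def)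
  have "c \<noteq> m" using c FL yL[OF m(1)] by blast
  then have mc: "m < c" using c by simp
  have FAc: "F \<subseteq> A c"
  proof -
    have "F \<inter> y ` {m..<c} = {}" using cmin by auto
    moreover have "F \<subseteq> A c \<union> y ` {m..<c}" using down[of m c] FAm c by auto
    ultimately show ?thesis by blast
  qed
  have Fc: "priv (B c) t F" using FAc F(1) by (auto simp: priv_def B_def)
  have cc: "cfg (B c)" using cB[OF c(2)] .
  have kc: "y c \<in> kern (B c)" "x c \<in> kern (B c)" using yL[OF c(2)] xL[OF c(2)] by (auto simp: L_def)
  obtain K' where K': "pclq (B c) K'" "F \<subseteq> K'"
    using priv_in_pclq[OF cc tB[OF c(2)] Fc c(3) kc(1) p4] by blast
  have xcK': "x c \<in> K'" using kernD[OF kc(2)] pclqD[OF K'(1)] by blast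
  have xcF: "x c \<notin> F" using FAc xA[OF c(2)] by blast
  have FK': "F = K' - {x c}"
  proof (rule card_subset_eq)
    show "F \<subseteq> K' - {x c}" using K'(2) xcF by blast
  qed (use pclqD[OF K'(1)] xcK' privD[OF F(1)] in simp_all)
  have LcK': "L c \<subseteq> K'" using kernD[of _ "B c" K'] pclqD[OF K'(1)] by (auto simp: L_def)
  have xyc: "x c \<noteq> y c" using xA[OF c(2)] yA[OF c(2)] by auto
  have fLc: "finite (L c)" using LcK' pclqD(4)[OF K'(1)] finite_subset by blast
  have ELc: "E \<inter> L c = {}" using mx[OF mc c(2)] .
  have stc: "L c - {y c} \<subseteq> A n" "y c \<notin> A n" using stay[of c n] c by auto
  have sub: "E \<union> (L c - {x c, y c}) \<subseteq> nb t \<inter> A n"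
    using privD[OF E] stc LcK' FK' privD(2)[OF F(1)] by blast
  have cardU: "card (E \<union> (L c - {x c, y c})) = (p - 1) + (card (L c) - 2)"
  proof -
    have "E \<inter> (L c - {x c, y c}) = {}" using ELc by blast
    moreover have "card (L c - {x c, y c}) = card (L c) - 2"
      using xL[OF c(2)] yL[OF c(2)] xyc fLc by (simp add: card_Diff_subset)
    ultimately show ?thesis using card_Un_disjoint[of E "L c - {x c, y c}"] privD[OF E] fLc by simp
  qed
  have "card (E \<union> (L c - {x c, y c})) \<le> p"
    using card_mono[OF _ sub] fin_nb in_le by fastforce
  then have Lc3: "card (L c) = 3" and p_eq: "p = 4"
    using cardU kern_card[OF cc] p4 by (auto simp: L_def)
  have nbt: "nb t \<inter> A n = E \<union> (L c - {x c, y c})"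
    using card_seteq[OF _ sub] fin_nb cardU in_le Lc3 p_eq by simp
  have "card (L c - {x c, y c}) = 1"
    using xL[OF c(2)] yL[OF c(2)] xyc fLc Lc3 by (simp add: card_Diff_subset)
  then obtain e where e: "L c - {x c, y c} = {e}" by (auto simp: card_1_singleton_iff)
  have eL: "e \<in> L c" "e \<noteq> x c" "e \<noteq> y c" using e by auto
  have nbt': "nb t \<inter> A n = insert e E" using nbt e by blast
  have eE: "e \<notin> E" using ELc eL by blast
  have ek: "e \<in> kern (B c)" using eL by (simp add: L_def)
  obtain K0 a0 b0 where dbl: "b0 \<in> K0" "a0 \<notin> K0" "\<not> adj a0 b0" "kern (B c) = K0 - {b0}"
    "\<And>u. u \<in> K0 - {b0} \<Longrightarrow> nb u \<inter> B c = insert a0 K0 - {u}"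
    "\<And>u. u \<in> K0 - {b0} \<Longrightarrow> card (nb u \<inter> B c) = p"
    using cc
  proof (cases rule: cfg_structure)
    case (single K)
    have "card (L c) = p" using pclqD(3)[OF single(1)] single(2) by (simp add: L_def)
    then show ?thesis using Lc3 p_eq by simp
  next
    case (double K a b)
    then show ?thesis using that by metis
  qed
  have eK0: "e \<in> K0 - {b0}" using ek dbl(4) by simp
  have nbe: "nb e \<inter> B c = insert a0 K0 - {e}" using dbl(5)[OF eK0] .
  have K0e: "K0 = insert b0 (L c)" using dbl(1,4) by (auto simp: L_def)
  obtain De where De: "De \<subseteq> nb e - B c" "clq adj (insert e De)" "card De = q - 1"
    using cfg_D[OF cc ek] by metis
  have DeE: "nb e - B c = De" using cfg_out_le[OF cc ek _ De(1,3)] dbl(6)[OF eK0] by simp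
  have eF: "e \<in> F" using eL LcK' FK' by blast
  have tDe: "t \<in> De"
  proof -
    have "t \<in> nb e" using eF privD(2)[OF F(1)] nb_sym[OF tV(1)] by blast
    then show ?thesis using DeE tB[OF c(2)] by blast
  qed
  obtain Q where Q: "Q \<in> qs (A n)" using bad tokD(1)[OF tt] by blast
  have tQ: "t \<in> Q" using tokD(5)[OF tt Q] .
  have nbo: "nb t - A n = Q - {t}"
  proof (rule card_seteq[symmetric])
    show "Q - {t} \<subseteq> nb t - A n" using q_vertex_out(1)[OF Q tQ] .
    have cQ: "card Q = q" using Q by (simp add: qs_def)
    have "card (nb t \<inter> A n) = p" using nbt cardU Lc3 p_eq by simp
    then have "card (nb t - A n) \<le> q - 1" using nb_split[of t "A n"] deg_nb[OF tV(1)] by simp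
    then show "card (nb t - A n) \<le> card (Q - {t})" using cQ tQ by simp
  qed (use fin_nb in simp)
  have ycQ: "y c \<in> Q - {t}"
    using nbo c(3) privD(2)[OF F(1)] stc by blast
  have ycB: "y c \<in> B c" using kc kern_sub by blast
  have EBc: "E \<subseteq> B c" using Esub[of c] c by simp
  have DeQ: "De - {t} \<subseteq> Q - {t} - {y c}"
  proof
    fix z assume z: "z \<in> De - {t}"
    have zB: "z \<notin> B c" "z \<in> V" using z De(1) nb_sub by auto
    have "z \<in> nb t" using clqD[OF De(2), of t z] tDe z zB by (auto simp: nb_def)
    moreover have "z \<notin> A n"
    proof
      assume "z \<in> A n"
      then have "z \<in> insert e E" using nbt' \<open>z \<in> nb t\<close> by blast
      then show False using zB EBc ek kern_sub by blast
    qed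
    ultimately show "z \<in> Q - {t} - {y c}" using nbo ycB zB by blast
  qed
  have De_eq: "De - {t} = Q - {t} - {y c}"
  proof (rule card_seteq[OF _ DeQ])
    have "card Q = q" "finite Q" using Q fin_card(2)[of Q] by (auto simp: qs_def)
    then show "finite (Q - {t} - {y c})" "card (Q - {t} - {y c}) \<le> card (De - {t})"
      using tQ ycQ tDe De(3) by auto
  qed
  have "card (F - L c) = 1"
  proof -
    have "F - L c = K' - L c" using FK' xL[OF c(2)] by blast
    then show ?thesis using card_Diff_subset[OF fLc LcK'] pclqD(3)[OF K'(1)] Lc3 p_eq by simp
  qed
  then obtain b where b: "F - L c = {b}" by (auto simp: card_1_singleton_iff)
  have bF: "b \<in> F" "b \<notin> L c" using b by auto
  have bB: "b \<in> B c" using bF privD(1)[OF Fc] by blast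
  \<comment> \<open>The outer neighbours of \<open>t\<close> are \<open>Q - {t}\<close>, and these
    are \<open>y c\<close> and vertices of \<open>De\<close>. Since \<open>b\<close> is in
    \<open>B c\<close> it is none of them, so it is still in \<open>A n\<close>.\<close>
  have bE: "b \<in> E"
  proof (rule ccontr)
    assume nE: "b \<notin> E"
    have "b \<noteq> e" using bF eL by blast
    then have "b \<notin> A n" using nbt' nE bF privD(2)[OF F(1)] by blast
    then have "b \<in> Q - {t}" using nbo bF privD(2)[OF F(1)] by blast
    moreover have "b \<noteq> y c" using bF yL[OF c(2)] by blast
    ultimately have "b \<in> De" using De_eq by blast
    then show False using De(1) bB by blast
  qed
  \<comment> \<open>The only neighbour of \<open>t\<close> in \<open>A n\<close> beyond
    \<open>E\<close> is \<open>e\<close>. A private clique through \<open>e\<close> would need two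
    further vertices, and only the nonadjacent tips \<open>a0\<close> and \<open>b0\<close> are
    available.\<close>
  have b_core: "b \<in> core (A n) t"
  proof (rule coreI)
    show "b \<in> A n" using bE privD(1)[OF E] by blast
    fix E2 assume E2: "priv (A n) t E2"
    have sub2: "E2 \<subseteq> insert e E" using privD[OF E2] nbt' by blast
    show "b \<in> E2"
    proof (cases "e \<in> E2")
      case False
      then have "E2 \<subseteq> E" using sub2 by blast
      then have "E2 = E" using card_subset_eq[of E E2] privD[OF E] privD[OF E2] by simp
      then show ?thesis using bE by simp
    next
      case True
      have E2V: "E2 \<subseteq> V" using privD(1)[OF E2] tokD(2)[OF tt] by blast
      have "E2 - {e} \<subseteq> {a0, b0}"
      proof
        fix z assume z: "z \<in> E2 - {e}"
        have zE: "z \<in> E" using sub2 z by blast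
        have "z \<in> nb e \<inter> B c" using clq_nb[OF privD(3)[OF E2] E2V True] z zE EBc by blast
        then have "z \<in> insert a0 (insert b0 (L c))" using nbe K0e by blast
        then show "z \<in> {a0, b0}" using zE ELc by blast
      qed
      moreover have "\<not> (a0 \<in> E2 \<and> b0 \<in> E2)" using clqD[OF privD(3)[OF E2]] dbl(1-3) by blast
      ultimately have "E2 - {e} \<subseteq> {a0} \<or> E2 - {e} \<subseteq> {b0}" by blast
      then have "card (E2 - {e}) \<le> 1" using card_mono[of "{a0}"] card_mono[of "{b0}"] by fastforce
      then show ?thesis using privD[OF E2] True p_eq by simp
    qed
  qed
  obtain D' where D': "D' \<subseteq> V - (insert t (A n) - {b}) - {b}" "card D' = q - 1" "D' \<subseteq> nb b"
    using tok_q[OF swap_tok[OF tt b_core]] by metis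
  have EV: "E \<subseteq> V" using privD(1)[OF E] tokD(2)[OF tt] by blast
  have bV: "b \<in> V" using bE EV by blast
  have K'V: "K' \<subseteq> V" using pclqD(1)[OF K'(1)] cfg_sub[OF cc] by blast
  have bK': "b \<in> K'" "e \<in> K'" "b \<noteq> e" "b \<noteq> x c" using bF FK' eF eL by auto
  \<comment> \<open>Five neighbours of \<open>b\<close>, to which the exchange adds the
    \<open>q - 1\<close> vertices of \<open>D'\<close>; with \<open>p = 4\<close> the bound is
    \<open>q + 3\<close>.\<close>
  have S: "(E - {b}) \<union> {t, e, x c} \<subseteq> nb b"
  proof -
    have "E - {b} \<subseteq> nb b" using clq_nb[OF privD(3)[OF E] EV bE] .
    moreover have "t \<in> nb b" using bF privD(2)[OF F(1)] nb_sym[OF tV(1)] by blast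
    moreover have "e \<in> nb b" "x c \<in> nb b" using clq_nb[OF pclqD(2)[OF K'(1)] K'V bK'(1)] bK' xcK' by auto
    ultimately show ?thesis by blast
  qed
  have xcA: "x c \<in> A n" "e \<in> A n" using stc xL[OF c(2)] xyc eL by auto
  have cS: "card ((E - {b}) \<union> {t, e, x c}) = 5"
  proof -
    have "t \<notin> E" "t \<noteq> e" "t \<noteq> x c" using tV privD(1)[OF E] xcA by auto
    moreover have "x c \<notin> E" using ELc xL[OF c(2)] by blast
    moreover have "card (E - {b}) = 2" using privD[OF E] bE p_eq by simp
    ultimately show ?thesis using eE eL privD(5)[OF E] by simp
  qed
  have disj: "((E - {b}) \<union> {t, e, x c}) \<inter> D' = {}" using D'(1) xcA privD(1)[OF E] bK' tV bE by blast
  have "card (((E - {b}) \<union> {t, e, x c}) \<union> D') = 5 + (q - 1)"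
    using card_Un_disjoint[OF _ _ disj] cS D'(2) fin_card(4)[OF D'(2)] privD(5)[OF E] by simp
  moreover have "((E - {b}) \<union> {t, e, x c}) \<union> D' \<subseteq> nb b" using S D' by blast
  ultimately have "5 + (q - 1) + 1 \<le> p + q" using nb_bound[OF bV, of "((E - {b}) \<union> {t, e, x c}) \<union> D'"] by simp
  then show False using p_eq q3 by simp
qed

lemma extend: "\<exists>A x y. swap_walk V adj p q A x y (Suc n)"
proof -
  obtain t where t: "tok (A n) t" "t \<notin> y ` {..<n}" by (rule candidate)
  obtain E where E: "priv (A n) t E" "\<forall>j<n. E \<inter> L j = {}" using private_off_kernels[OF t] by blast
  obtain u where u: "u \<in> core (A n) t" using core_ne[OF t(1)] by blast
  let ?A = "A(Suc n := insert t (A n) - {u})" and ?x = "x(n := t)" and ?y = "y(n := u)"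
  have "swap_walk V adj p q ?A ?x ?y (Suc n)"
  proof unfold_locales
    show "\<exists>t. tok (?A 0) t" using start by simp
    show "4 \<le> p" by (rule p4)
    fix i assume i: "i < Suc n"
    show "tok (?A i) (?x i)" using tokx t i by (auto simp: less_Suc_eq)
    show "?y i \<in> core (?A i) (?x i)" using ycore u i by (auto simp: less_Suc_eq)
    show "?A (Suc i) = insert (?x i) (?A i) - {?y i}" using Anext i by (auto simp: less_Suc_eq)
    show "\<exists>E. priv (?A i) (?x i) E \<and> (\<forall>j<i. E \<inter> kern (insert (?x j) (?A j)) = {})"
    proof (cases "i = n")
      case True
      then show ?thesis using E by (auto simp: L_def B_def)
    next
      case False
      then show ?thesis using off[of i] i by auto
    qed
    show "?x i \<noteq> ?y j" if "j < i" for j using fresh[of i j] t i that by (auto simp: less_Suc_eq)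
  qed
  then show ?thesis by blast
qed

lemma length_le: "n \<le> card V"
proof -
  have "inj_on y {..<n}" using y_inj by (auto simp: inj_on_def)
  moreover have "y ` {..<n} \<subseteq> V" using yA tokD(2)[OF tokx] by blast
  ultimately show ?thesis using card_inj_on_le[of y "{..<n}" V] finV by simp
qed

end

text \<open>Walks can be extended to any length, while the vertices \<open>y i\<close> of a walk are
  distinct elements of \<open>V\<close>.\<close>

lemma (in clique_part) p_eq_3: "p = 3"
proof (rule ccontr)
  assume "p \<noteq> 3"
  then have p4: "4 \<le> p" using q3 qp by simp
  have "\<exists>A x y. swap_walk V adj p q A x y n" for n
  proof (induction n)
    case 0
    obtain A t where "tok A t" using tok_ex by blast
    then have "swap_walk V adj p q (\<lambda>_. A) (\<lambda>_. t) (\<lambda>_. t) 0" using p4 by unfold_locales auto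
    then show ?case by blast
  next
    case (Suc n)
    then show ?case using swap_walk.extend by blast
  qed
  then obtain A x y where "swap_walk V adj p q A x y (Suc (card V))" by blast
  then show False using swap_walk.length_le by fastforce
qed

context clique_part
begin

section \<open>The case \<open>p = q = 3\<close>\<close>

lemma q_eq_3: "q = 3" using p_eq_3 q3 qp by simp

lemma K4:
  assumes "{a, b, c, d} \<subseteq> V" "adj a b" "adj a c" "adj a d" "adj b c" "adj b d" "adj c d"
  shows False
proof -
  have "clq adj {a, b, c, d}" using assms adj_sym by (auto simp: clq_def)
  moreover have "card {a, b, c, d} = 4" using assms adj_neq by auto
  ultimately show False using no_big[of "{a, b, c, d}"] assms(1) p_eq_3 by simp
qed

lemma six_nb:
  assumes "v \<in> V" "{a, b, c, d, e, f} \<subseteq> nb v" "distinct [a, b, c, d, e, f]" shows False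
proof -
  have "card {a, b, c, d, e, f} = 6" using assms(3) by auto
  then show False using nb_bound[OF assms(1,2)] p_eq_3 q_eq_3 by simp
qed

lemma five_nb:
  assumes "v \<in> V" "{a, b, c, d, e} \<subseteq> nb v" "distinct [a, b, c, d, e]" shows "nb v = {a, b, c, d, e}"
proof -
  have "card {a, b, c, d, e} = 5" using assms(3) by auto
  moreover have "card (nb v) \<le> 5" using deg_nb[OF assms(1)] p_eq_3 q_eq_3 by simp
  ultimately show ?thesis using card_seteq[OF fin_nb assms(2)] by simp
qed

lemma tri_pclq: "{a, b, c} \<subseteq> B \<Longrightarrow> adj a b \<Longrightarrow> adj a c \<Longrightarrow> adj b c \<Longrightarrow> pclq B {a, b, c}"
  unfolding pclq_def using p_eq_3 adj_sym adj_neq[of a b] adj_neq[of a c] adj_neq[of b c] by (auto simp: clq_def)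

lemma card2_elim:
  assumes "card S = 2" "g \<in> S" obtains h where "S = {g, h}" "h \<noteq> g"
proof -
  have "finite S" using assms(1) card.infinite by fastforce
  then have "card (S - {g}) = 1" using assms by simp
  then obtain h where "S - {g} = {h}" by (auto simp: card_1_singleton_iff)
  then show ?thesis using that[of h] assms(2) by blast
qed

lemma card3_elim:
  assumes "card S = 3" "g \<in> S" obtains h k where "S = {g, h, k}" "h \<noteq> g" "k \<noteq> g" "h \<noteq> k"
proof -
  have "finite S" using assms(1) card.infinite by fastforce
  then have c: "card (S - {g}) = 2" using assms by simp
  then have "S - {g} \<noteq> {}" by (metis card.empty zero_neq_numeral)
  then obtain h where h: "h \<in> S - {g}" by blast
  obtain k where "S - {g} = {h, k}" "k \<noteq> h" using card2_elim[OF c h] by metis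
  then show ?thesis using that[of h k] assms(2) h by blast
qed

lemma priv_through:
  assumes "priv A x E" "g \<in> E"
  obtains f where "E = {g, f}" "g \<in> A" "f \<in> A" "adj x g" "adj x f" "adj g f"
proof -
  have "card E = 2" using privD(4)[OF assms(1)] p_eq_3 by simp
  then obtain f where f: "E = {g, f}" "f \<noteq> g" using card2_elim assms(2) by metis
  then show ?thesis
    using that[of f] privD[OF assms(1)] clqD[OF privD(3)[OF assms(1)], of g f] by (auto simp: nb_def)
qed

lemma priv_elim:
  assumes "priv A x E"
  obtains g f where "E = {g, f}" "g \<in> A" "f \<in> A" "adj x g" "adj x f" "adj g f"
proof -
  have "E \<noteq> {}" using privD(4)[OF assms] p_eq_3 by auto
  then obtain g where "g \<in> E" by blast
  then show ?thesis using priv_through[OF assms] that by metis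
qed

lemma priv_intro:
  assumes "A \<subseteq> V" "g \<in> A" "f \<in> A" "adj x g" "adj x f" "adj g f" shows "priv A x {g, f}"
  unfolding priv_def using assms adj_neq[of g f] p_eq_3 adj_sym by (auto simp: clq_def nb_def)

lemma opt_edge:
  assumes "opt A" "x \<in> V - A" obtains g f where "g \<in> A" "f \<in> A" "adj x g" "adj x f" "adj g f"
  using opt_priv[OF assms] priv_elim by metis

lemma core_adj:
  assumes "tok A t" "g \<in> core A t"
  obtains f where "g \<in> A" "f \<in> A" "adj t g" "adj t f" "adj g f"
proof -
  obtain E where E: "priv A t E" using priv_ex[OF assms(1)] .
  have "g \<in> E" using core_priv[OF assms(2) E] .
  then show ?thesis using priv_through[OF E] that by metis
qed

lemma core_edge:
  assumes "tok A t" "g \<in> core A t" "a \<in> A" "b \<in> A" "adj t a" "adj t b" "adj a b"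
  shows "g = a \<or> g = b"
  using core_priv[OF assms(2) priv_intro[of A a b t]] assms tokD(2)[OF assms(1)] by blast

lemma core_eq_pair:
  assumes "tok A t" "g \<in> core A t" "\<And>f. f \<in> A \<Longrightarrow> adj t f \<Longrightarrow> adj g f \<Longrightarrow> f = h"
  shows "core A t = {g, h}" "h \<in> A" "adj t h" "adj g h"
proof -
  obtain f where f: "g \<in> A" "f \<in> A" "adj t g" "adj t f" "adj g f" using core_adj[OF assms(1,2)] .
  then have fh: "f = h" using assms(3) by blast
  then show h: "h \<in> A" "adj t h" "adj g h" using f by auto
  have "h \<in> core A t"
  proof (rule coreI[OF h(1)])
    fix E assume E: "priv A t E"
    have "g \<in> E" using core_priv[OF assms(2) E] .
    then obtain f' where "E = {g, f'}" "f' \<in> A" "adj t f'" "adj g f'" using priv_through[OF E] by metis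
    then show "h \<in> E" using assms(3) by blast
  qed
  moreover have "v = g \<or> v = h" if "v \<in> core A t" for v
    using core_edge[OF assms(1) that f(1) h(1) f(3) h(2,3)] .
  ultimately show "core A t = {g, h}" using assms(2) by blast
qed

lemma tok_tri:
  assumes "tok A t" "{a, b, c} \<subseteq> V - A" "adj a b" "adj a c" "adj b c" shows "t = a \<or> t = b \<or> t = c"
proof -
  have "card {a, b, c} = 3" using assms adj_neq[of a b] adj_neq[of a c] adj_neq[of b c] by auto
  then have "{a, b, c} \<in> qs A" unfolding qs_def using assms adj_sym q_eq_3 by (auto simp: clq_def)
  then show ?thesis using tokD(5)[OF assms(1)] by blast
qed

lemma tok_tri_ex:
  assumes "tok A t"
  obtains d w where "d \<in> V" "d \<notin> A" "w \<in> V" "w \<notin> A" "adj t d" "adj t w" "adj d w"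
proof -
  obtain D where D: "D \<subseteq> V - A - {t}" "clq adj (insert t D)" "card D = q - 1" "D \<subseteq> nb t"
    using tok_q[OF assms] by metis
  have c2: "card D = 2" using D(3) q_eq_3 by simp
  then have "D \<noteq> {}" by auto
  then obtain d where d: "d \<in> D" by blast
  then obtain w where w: "D = {d, w}" "w \<noteq> d" using card2_elim[OF c2] by metis
  show ?thesis using that[of d w] D w clqD[OF D(2), of d w] by (auto simp: nb_def)
qed

lemma kern_tri_ex:
  assumes "cfg B" "u \<in> kern B"
  obtains d w where "d \<in> V" "d \<notin> B" "w \<in> V" "w \<notin> B" "adj u d" "adj u w" "adj d w"
proof -
  obtain d w where "d \<in> V" "d \<notin> B - {u}" "w \<in> V" "w \<notin> B - {u}" "adj u d" "adj u w" "adj d w"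
    using tok_tri_ex[OF cfg_kern_tok[OF assms]] .
  then show ?thesis using that[of d w] adj_irrefl by blast
qed

lemma tok_nb3:
  assumes "tok A t" "w \<in> V" "w \<notin> A" "d \<in> V" "d \<notin> A" "adj t d" "adj t w" "adj d w"
    and "card (nb t \<inter> A) = 3"
  shows "nb t - A = {d, w}"
proof -
  have sub: "{d, w} \<subseteq> nb t - A" using assms by (auto simp: nb_def)
  have c: "card {d, w} = 2" using assms(8) adj_neq by auto
  have "card (nb t \<inter> A) + card (nb t - A) \<le> 5"
    using nb_split[of t A] deg_nb[OF tokD(3)[OF assms(1)]] p_eq_3 q_eq_3 by simp
  then show ?thesis using card_seteq[OF _ sub] fin_nb c assms(9) by simp
qed

text \<open>The case \<open>p = q = 3\<close> of \<open>cfg_out_le\<close>: a full inner degree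
  leaves only the two outer neighbours that complete a triangle.\<close>

lemma kern_out:
  assumes "cfg B" "u \<in> kern B" "card (nb u \<inter> B) = 3" "t \<in> V - B" "adj t u"
  obtains v where "nb u - B = {t, v}" "v \<in> V - B" "adj u v" "adj t v"
proof -
  obtain D where D: "D \<subseteq> nb u - B" "clq adj (insert u D)" "card D = q - 1" using cfg_D[OF assms(1,2)] by metis
  have De: "nb u - B = D" using cfg_out_le[OF assms(1,2) _ D(1,3)] assms(3) p_eq_3 by simp
  have c2: "card D = 2" using D(3) q_eq_3 by simp
  have t: "t \<in> D" using assms(4,5) De adj_sym by (auto simp: nb_def)
  then obtain v where v: "D = {t, v}" "v \<noteq> t" using card2_elim[OF c2] by metis
  show ?thesis using that[of v] De D v clqD[OF D(2), of t v] by (auto simp: nb_def)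
qed

section \<open>Triangle configurations and the vertices around them\<close>

lemma kern_cases:
  assumes "cfg B" "c \<in> kern B"
  obtains (single) g h where "kern B = {c, g, h}" "c \<noteq> g" "c \<noteq> h" "g \<noteq> h" "adj c g" "adj c h" "adj g h"
      "{c, g, h} \<subseteq> B" "\<And>K. pclq B K \<Longrightarrow> K = {c, g, h}"
  | (double) u a b where "kern B = {c, u}" "c \<noteq> u" "nb c \<inter> B = {u, a, b}" "nb u \<inter> B = {c, a, b}"
      "a \<noteq> b" "a \<noteq> u" "b \<noteq> u" "a \<noteq> c" "b \<noteq> c" "\<not> adj a b" "adj c u" "adj c a" "adj c b" "adj u a" "adj u b"
      "{c, u, a, b} \<subseteq> B"
  using assms(1)
proof (cases rule: cfg_structure)
  case (single K)
  have "card K = 3" "c \<in> K" using pclqD(3)[OF single(1)] p_eq_3 single(2) assms(2) by auto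
  then obtain g h where K: "K = {c, g, h}" "g \<noteq> c" "h \<noteq> c" "g \<noteq> h" using card3_elim by metis
  have "adj c g" "adj c h" "adj g h" using clqD[OF pclqD(2)[OF single(1)]] K by auto
  then show ?thesis using that(1)[of g h] K single(2,3) pclqD(1)[OF single(1)] by metis
next
  case (double K a b)
  have "card (K - {b}) = 2" "c \<in> K - {b}" using pclqD[OF double(1)] double(4,7) assms(2) p_eq_3 by auto
  then obtain u where u: "K - {b} = {c, u}" "u \<noteq> c" using card2_elim by metis
  have K: "K = {c, u, b}" "b \<noteq> c" "b \<noteq> u" "u \<noteq> c" using u double(4) by auto
  have K': "insert a (K - {b}) = {c, u, a}" using u by auto
  have a: "a \<noteq> c" "a \<noteq> u" "a \<noteq> b" using double(3) K by auto
  have "adj c u" "adj c b" "adj u b" using clqD[OF pclqD(2)[OF double(1)]] K by auto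
  moreover have "adj c a" "adj u a" using clqD[OF pclqD(2)[OF double(6)]] K' a by auto
  moreover have "nb c \<inter> B = {u, a, b}" "nb u \<inter> B = {c, a, b}"
    using double(9)[of c] double(9)[of u] u K a by auto
  moreover have "{c, u, a, b} \<subseteq> B" using pclqD(1)[OF double(1)] K double(2) by auto
  ultimately show ?thesis using that(2)[of u a b] K u a double(5,7) by auto
qed

text \<open>The second alternative of \<open>cfg_structure\<close> seen from \<open>t\<close>: a
  diamond with middle edge \<open>t u\<close> and nonadjacent ends \<open>a\<close> and
  \<open>b\<close>.\<close>

definition double :: "'a set \<Rightarrow> 'a \<Rightarrow> 'a \<Rightarrow> 'a \<Rightarrow> 'a \<Rightarrow> bool" where
  "double A t u a b \<longleftrightarrow> tok A t \<and> core A t = {u} \<and> nb t \<inter> A = {u, a, b} \<and> nb u \<inter> insert t A = {t, a, b}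
     \<and> a \<noteq> b \<and> a \<noteq> u \<and> b \<noteq> u \<and> \<not> adj a b \<and> adj t u \<and> adj t a \<and> adj t b \<and> adj u a \<and> adj u b
     \<and> {u, a, b} \<subseteq> A"

lemma doubleD:
  assumes "double A t u a b"
  shows "tok A t" "core A t = {u}" "nb t \<inter> A = {u, a, b}" "nb u \<inter> insert t A = {t, a, b}"
    "a \<noteq> b" "a \<noteq> u" "b \<noteq> u" "\<not> adj a b" "adj t u" "adj t a" "adj t b" "adj u a" "adj u b"
    "u \<in> A" "a \<in> A" "b \<in> A"
  using assms by (auto simp: double_def)

lemma double_sym: "double A t u a b \<Longrightarrow> double A t u b a"
  using adj_sym unfolding double_def by (auto simp: insert_commute)

lemma double_card:
  assumes "double A t u a b" shows "card (nb t \<inter> A) = 3" "card (nb u \<inter> insert t A) = 3"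
proof -
  have "t \<noteq> a" "t \<noteq> b" using doubleD[OF assms] tokD(4)[OF doubleD(1)[OF assms]] by auto
  then show "card (nb t \<inter> A) = 3" "card (nb u \<inter> insert t A) = 3"
    using doubleD(3-7)[OF assms] by auto
qed

lemma double_kern: "double A t u a b \<Longrightarrow> kern (insert t A) = {t, u}"
  using kern_core[of A t] by (simp add: double_def)

lemma tok_cases:
  assumes "tok A t"
  obtains (single) g h where "core A t = {g, h}" "g \<noteq> h" "adj t g" "adj t h" "adj g h" "g \<in> A" "h \<in> A"
      "kern (insert t A) = {t, g, h}" "\<And>K. pclq (insert t A) K \<Longrightarrow> K = {t, g, h}"
  | (double) u a b where "double A t u a b"
proof -
  have c: "cfg (insert t A)" using cfg_tok[OF assms] .
  have tk: "t \<in> kern (insert t A)" using kern_core[OF assms] by simp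
  have tA: "t \<notin> A" using tokD(4)[OF assms] .
  have tc: "t \<notin> core A t" using core_sub tA by blast
  have ce: "core A t = kern (insert t A) - {t}" using kern_core[OF assms] tc by auto
  show thesis
    using c tk
  proof (cases rule: kern_cases)
    case (single g h)
    then show ?thesis using that(1)[of g h] ce by auto
  next
    case (double u a b)
    have "nb t \<inter> A = {u, a, b}" using double(3) nb_irrefl[of t] by auto
    moreover have "core A t = {u}" using ce double(1,2) by auto
    ultimately have "double A t u a b" using double assms by (auto simp: double_def)
    then show ?thesis by (rule that(2))
  qed
qed

text \<open>If \<open>z = z'\<close>, then \<open>g\<close>, \<open>h\<close>, \<open>x\<close>,
  \<open>z\<close> form a K_4. Otherwise \<open>x\<close> has six neighbours, one more than
  \<open>p + q - 1\<close>.\<close>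

lemma single_two_tri:
  assumes "x \<in> V - B" "{g, h, f, f'} \<subseteq> B" "distinct [g, h, f, f']" "B \<subseteq> V"
    and "adj x g" "adj x h" "adj x f" "adj x f'" "adj g h"
    and "z \<in> V - B" "adj g z" "adj x z" "z' \<in> V - B" "adj h z'" "adj x z'"
  shows False
proof (cases "z = z'")
  case True
  have "adj g x" "adj h z" "adj x z" "adj g z" "adj h x" using assms adj_sym True by blast+
  then show False using K4[of g h x z] assms by auto
next
  case False
  have "{g, h, f, f', z, z'} \<subseteq> nb x" using assms by (auto simp: nb_def)
  moreover have "distinct [g, h, f, f', z, z']" using assms False by auto
  moreover have "x \<in> V" using assms(1) by blast
  ultimately show False using six_nb by metis
qed

text \<open>Private edges of \<open>x\<close> avoiding \<open>g\<close>, respectively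
  \<open>h\<close>, either give the desired edge or run through the other vertex of the pair. If
  both do the latter, their ends \<open>f\<close>, \<open>f'\<close> differ since the triangle of
  \<open>B\<close> is unique. Then \<open>g\<close> and \<open>h\<close> have full inner degree, so
  each lies in an outer triangle with \<open>x\<close>, which \<open>single_two_tri\<close>
  excludes.\<close>

lemma single_edge:
  assumes cfg: "cfg B" and k: "kern B = {g, h, c}" "distinct [g, h, c]" "adj g h" "adj g c" "adj h c"
    and uni: "\<And>K. pclq B K \<Longrightarrow> K = {g, h, c}"
    and x: "x \<in> V - B" "adj x g" "adj x h"
  obtains f1 f2 where "f1 \<in> B - {g, h, c}" "f2 \<in> B - {g, h, c}" "adj x f1" "adj x f2" "adj f1 f2"
proof -
  have BV: "B \<subseteq> V" using cfg_sub[OF cfg] .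
  have KB: "g \<in> B" "h \<in> B" "c \<in> B" using k(1) kern_sub by blast+
  have xc: "\<not> adj x c"
  proof
    assume "adj x c"
    then show False using K4[of x g h c] x k BV KB by auto
  qed
  have key: "(\<exists>f1 f2. f1 \<in> B - {g, h, c} \<and> f2 \<in> B - {g, h, c} \<and> adj x f1 \<and> adj x f2 \<and> adj f1 f2)
     \<or> (\<exists>f. f \<in> B - {g, h, c} \<and> adj x f \<and> adj v f)" if uv: "{u, v} = {g, h}" for u v
  proof -
    have uk: "u \<in> kern B" using that k(1) by blast
    obtain F where pF: "priv (B - {u}) x F" using kern_priv[OF cfg uk x(1)] .
    obtain f1 f2 where f: "F = {f1, f2}" "f1 \<in> B - {u}" "f2 \<in> B - {u}" "adj x f1" "adj x f2" "adj f1 f2"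
      using priv_elim[OF pF] by metis
    have "f1 \<noteq> c" "f2 \<noteq> c" using f xc by auto
    then have "f1 \<in> B - {g, h, c} \<or> f1 = v" "f2 \<in> B - {g, h, c} \<or> f2 = v" using f that by auto
    then show ?thesis using f adj_sym adj_irrefl by metis
  qed
  show thesis
  proof (cases "\<exists>f1 f2. f1 \<in> B - {g, h, c} \<and> f2 \<in> B - {g, h, c} \<and> adj x f1 \<and> adj x f2 \<and> adj f1 f2")
    case True then show ?thesis using that by blast
  next
    case False
    obtain f where f: "f \<in> B - {g, h, c}" "adj x f" "adj h f" using key[of g h] False by blast
    obtain f' where f': "f' \<in> B - {g, h, c}" "adj x f'" "adj g f'" using key[of h g] False by blast
    have ff: "f \<noteq> f'"
    proof
      assume "f = f'"
      then have "{g, h, f} = {g, h, c}" using uni[OF tri_pclq[of g h f B]] KB k f f' by auto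
      then show False using f by auto
    qed
    have ex: "\<exists>z. z \<in> V - B \<and> adj v z \<and> adj x z" if v: "v \<in> {g, h}" and e: "e \<in> B - {g, h, c}" "adj v e" for v e
    proof -
      have vk: "v \<in> kern B" using v k by auto
      have sub: "insert e ({g, h, c} - {v}) \<subseteq> nb v \<inter> B" using v e k KB BV adj_sym by (auto simp: nb_def)
      have "card (insert e ({g, h, c} - {v})) = 3" using v e k(2) by auto
      then have "3 \<le> card (nb v \<inter> B)" using card_mono[OF _ sub] fin_nb by fastforce
      then have c3: "card (nb v \<inter> B) = 3" using cfg_in_le[OF cfg vk] p_eq_3 by simp
      have "adj x v" using x v by auto
      then show ?thesis using kern_out[OF cfg vk c3 x(1)] by metis
    qed
    obtain z where z: "z \<in> V - B" "adj g z" "adj x z" using ex[of g f'] f' by auto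
    obtain z' where z': "z' \<in> V - B" "adj h z'" "adj x z'" using ex[of h f] f by auto
    have False
      by (rule single_two_tri[of x B g h f f' z z']) (use x KB f f' ff k BV z z' in auto)
    then show ?thesis ..
  qed
qed

text \<open>Both kernel vertices have full inner degree, so each lies in an outer triangle with
  \<open>x\<close>. A private edge of \<open>x\<close> avoiding \<open>t\<close> either runs through
  \<open>u\<close>, and then to \<open>a\<close> or \<open>b\<close>, which gives a K_4, or
  contributes two more neighbours for \<open>single_two_tri\<close>.\<close>

lemma double_no_common:
  assumes cfg: "cfg B" and k: "kern B = {t, u}" "t \<noteq> u" and x: "x \<in> V - B" "adj x t" "adj x u"
  shows False
proof -
  have BV: "B \<subseteq> V" using cfg_sub[OF cfg] .
  have tk: "t \<in> kern B" "u \<in> kern B" using k by auto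
  show False
    using cfg tk(1)
  proof (cases rule: kern_cases)
    case (single g h)
    then have "card (kern B) = 3" by auto
    then show False using k by simp
  next
    case (double u' a b)
    have u': "u' = u" using double(1,2) k by (auto simp: doubleton_eq_iff)
    have t3: "card (nb t \<inter> B) = 3" "card (nb u \<inter> B) = 3" using double u' by auto
    obtain d where d: "d \<in> V - B" "adj x d" "adj t d" using kern_out[OF cfg tk(1) t3(1) x(1,2)] by metis
    obtain v where v: "v \<in> V - B" "adj x v" "adj u v" using kern_out[OF cfg tk(2) t3(2) x(1,3)] by metis
    have uB: "u \<in> B" "t \<in> B" using tk kern_sub by auto
    obtain F where pF: "priv (B - {t}) x F" using kern_priv[OF cfg tk(1) x(1)] .
    show False
    proof (cases "u \<in> F")
      case True
      then obtain f where f: "f \<in> B - {t}" "adj x f" "adj u f" using priv_through[OF pF] by metis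
      then have "f \<in> nb u \<inter> B" using BV by (auto simp: nb_def)
      then have "f = a \<or> f = b" using double(4) u' f by auto
      then have "adj t f" using double by auto
      then show False using K4[of x t u f] x f double u' BV uB by auto
    next
      case False
      obtain f1 f2 where f: "F = {f1, f2}" "f1 \<in> B - {t}" "f2 \<in> B - {t}" "adj x f1" "adj x f2" "adj f1 f2"
        using priv_elim[OF pF] by metis
      have "f1 \<noteq> f2" using f adj_irrefl by auto
      then show False
        by (intro single_two_tri[of x B t u f1 f2 d v]) (use x f k d v BV uB False double u' in auto)
    qed
  qed
qed

text \<open>The full inner degree of \<open>t\<close> leaves \<open>{d, w}\<close> as its outer
  neighbourhood. So \<open>{t, d, w}\<close> is the only outer triangle, and \<open>w\<close> may
  take over from \<open>t\<close>.\<close>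

lemma double_partner:
  assumes "double A t u a b" "w \<in> V" "w \<notin> A" "d \<in> V" "d \<notin> A" "adj t d" "adj t w" "adj d w"
  shows "nb t - A = {d, w}" "\<not> adj w u" "tok A w" "card (nb w \<inter> A) \<le> 3"
proof -
  have tt: "tok A t" using doubleD(1)[OF assms(1)] .
  show nbt: "nb t - A = {d, w}" using tok_nb3[OF tt assms(2-8) double_card(1)[OF assms(1)]] .
  have tu: "t \<noteq> u" using doubleD[OF assms(1)] tokD(4)[OF tt] by auto
  show "\<not> adj w u"
  proof
    assume "adj w u"
    moreover have "w \<noteq> t" "adj w t" using assms(7) adj_irrefl adj_sym by auto
    ultimately show False
      using double_no_common[OF cfg_tok[OF tt] double_kern[OF assms(1)] tu, of w] assms(2,3) by blast
  qed
  have "w \<in> Q" if Q: "Q \<in> qs A" for Q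
  proof -
    have tQ: "t \<in> Q" using tokD(5)[OF tt Q] .
    have "Q - {t} \<subseteq> {d, w}" using q_vertex_out(1)[OF Q tQ] nbt by simp
    moreover have "card Q = q" using Q by (simp add: qs_def)
    then have "card Q = 3" using q_eq_3 by simp
    then have "card (Q - {t}) = 2" using tQ by simp
    ultimately have "Q - {t} = {d, w}" using card_seteq[of "{d, w}" "Q - {t}"] by (simp add: card_insert_if)
    then show ?thesis by blast
  qed
  then show tw: "tok A w" using tokD(1)[OF tt] assms(2,3) by (simp add: tok_def)
  show "card (nb w \<inter> A) \<le> 3" using tok_in[OF tw] p_eq_3 by simp
qed

text \<open>Since \<open>w\<close> has at most three neighbours in \<open>A\<close>, its private
  edge joins one of \<open>a\<close>, \<open>b\<close> to a third vertex \<open>e\<close>. If only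
  one of them is adjacent to \<open>e\<close>, exchanging it with \<open>w\<close> overloads its
  degree. If both are, the two ends are traded for \<open>t\<close> and \<open>w\<close> at
  once.\<close>

lemma double_partner_ends:
  assumes dbl: "double A t u a b" and w: "w \<in> V" "w \<notin> A" "d \<in> V" "d \<notin> A" "adj t d" "adj t w" "adj d w"
    and wab: "adj w a" "adj w b"
  shows False
proof -
  note D = doubleD[OF dbl]
  note P = double_partner[OF dbl w]
  have tt: "t \<in> V" "t \<notin> A" "A \<subseteq> V" using tokD[OF D(1)] by auto
  have V: "a \<in> V" "b \<in> V" "u \<in> V" using D(14-16) tt by auto
  have oA: "opt A" using tokD(1)[OF D(1)] .
  have wt: "w \<noteq> t" "w \<noteq> d" "d \<noteq> t" using w adj_irrefl by auto
  obtain e' e where e': "e' \<in> {a, b}" "e \<in> A" "e \<noteq> a" "e \<noteq> b" "adj w e" "adj e' e"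
  proof -
    obtain g f where gf: "g \<in> A" "f \<in> A" "adj w g" "adj w f" "adj g f"
      using opt_edge[OF oA] w by blast
    have ab: "\<not> adj a b" "\<not> adj b a" using D(8) adj_sym by blast+
    have sub: "{a, b, g, f} \<subseteq> nb w \<inter> A" using wab gf D(15,16) tt(3) unfolding nb_def by blast
    have "card {a, b, g, f} \<le> 3" using card_mono[OF _ sub] P(4) fin_nb by fastforce
    then have "g \<in> {a, b} \<or> f \<in> {a, b}" using D(5) gf adj_neq[of g f] by (auto simp: card_insert_if split: if_splits)
    then show ?thesis using that[of g f] that[of f g] gf ab adj_sym adj_irrefl by (metis insert_iff singletonD)
  qed
  have eu: "e \<noteq> u" using e' P(2) by auto
  have eV: "e \<in> V" using e' tt by blast
  have te: "\<not> adj t e"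
  proof
    assume "adj t e"
    then have "e \<in> nb t \<inter> A" using e' eV by (auto simp: nb_def)
    then show False using D(3) e' eu by auto
  qed
  have nbw: "nb w \<inter> A = {a, b, e}"
  proof (rule card_seteq[symmetric])
    show "{a, b, e} \<subseteq> nb w \<inter> A" using wab e' D V eV by (auto simp: nb_def)
    have "card {a, b, e} = 3" using D(5) e' by auto
    then show "card (nb w \<inter> A) \<le> card {a, b, e}" using P(4) by simp
  qed (use fin_nb in simp)
  \<comment> \<open>Here \<open>x\<close> lies on every private edge of \<open>w\<close>. Its outer
    triangle after the exchange must reuse \<open>t\<close> to avoid six neighbours, hence also
    \<open>d\<close>, and \<open>t\<close>, \<open>d\<close>, \<open>w\<close>, \<open>x\<close>
    form a K_4.\<close>
  have one: False if xy: "{x, y} = {a, b}" "adj x e" "\<not> adj y e" for x y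
  proof -
    have xV: "x \<in> V" "x \<in> A" "y \<in> A" "x \<noteq> y" "adj t x" "adj w x" "adj u x" "\<not> adj x y"
      using xy V D wab adj_sym by (auto simp: doubleton_eq_iff)
    have xc: "x \<in> core A w"
    proof (rule coreI[OF xV(2)])
      fix E assume E: "priv A w E"
      obtain g f where gf: "E = {g, f}" "g \<in> A" "f \<in> A" "adj w g" "adj w f" "adj g f" using priv_elim[OF E] .
      have "g \<in> {x, y, e}" "f \<in> {x, y, e}" using nbw gf tt xy(1) by (auto simp: nb_def)
      then show "x \<in> E" using gf xy adj_irrefl adj_sym by auto
    qed
    obtain z1 z2 where z: "z1 \<in> V" "z1 \<notin> insert w A - {x}" "z2 \<in> V" "z2 \<notin> insert w A - {x}"
        "adj x z1" "adj x z2" "adj z1 z2"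
      using tok_tri_ex[OF swap_tok[OF P(3) xc]] .
    have zA: "z1 \<notin> A" "z2 \<notin> A" "z1 \<noteq> w" "z2 \<noteq> w" using z adj_irrefl xV w by auto
    have sub: "{t, u, w, e, z1, z2} \<subseteq> nb x" using z xV xy V eV tt w adj_sym by (auto simp: nb_def)
    have "t = z1 \<or> t = z2"
    proof (rule ccontr)
      assume "\<not> ?thesis"
      then have "distinct [t, u, w, e, z1, z2]"
        using z(7) adj_neq[of z1 z2] zA tt w(2) wt e' eu D(14) by auto
      then show False using six_nb[OF xV(1) sub] by blast
    qed
    then obtain z where z': "z \<in> V" "z \<notin> A" "z \<noteq> w" "adj x z" "adj t z" using z zA adj_sym by blast
    then have "z = d" using P(1) by (auto simp: nb_def)
    then show False using K4[of t d w x] z' xV tt w adj_sym[of x d] adj_sym[of w x]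
      by (metis adj_sym empty_subsetI insert_subset)
  qed
  show False
  proof (cases "adj a e \<and> adj b e")
    case False
    then show False using one[of a b] one[of b a] e' by auto
  next
    case True
    \<comment> \<open>This set has the size of \<open>A\<close> and no triangle, as \<open>t\<close>
      keeps only \<open>u\<close> and \<open>w\<close>, and \<open>w\<close> only \<open>t\<close>
      and \<open>e\<close>, as possible neighbours. A triangle outside it avoids \<open>t\<close>,
      so it contains \<open>a\<close> or \<open>b\<close>, which then has six neighbours.\<close>
    let ?A = "insert t (insert w (A - {a, b}))"
    have fA: "finite A" using fin_sub tt by blast
    have cA: "card ?A = card A"
    proof -
      have "card (A - {a, b}) = card A - 2" using D(5,15,16) fA by (simp add: card_Diff_subset)
      moreover have "card A \<ge> 2" using card_mono[OF fA, of "{a, b}"] D(5,15,16) by simp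
      ultimately show ?thesis using wt tt w fA by simp
    qed
    have nt: "nb t \<inter> ?A \<subseteq> {u, w}" using D(3) nb_irrefl[of t] by blast
    have nw: "nb w \<inter> ?A \<subseteq> {t, e}" using nbw nb_irrefl[of w] by blast
    have "free ?A"
      unfolding free_def
    proof (intro conjI allI impI)
      show AV: "?A \<subseteq> V" using tt w by auto
      fix C assume C: "C \<subseteq> ?A" "clq adj C"
      show "card C \<noteq> p"
      proof
        assume cp: "card C = p"
        have pC: "pclq ?A C" using C cp by (simp add: pclq_def)
        have tri: "\<exists>v v'. v \<in> nb c \<inter> ?A \<and> v' \<in> nb c \<inter> ?A \<and> adj v v'" if cC: "c \<in> C" for c
        proof -
          have "card C = 3" using cp p_eq_3 by simp
          then obtain h k where hk: "C = {c, h, k}" "h \<noteq> c" "k \<noteq> c" "h \<noteq> k"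
            using card3_elim[OF _ cC] by metis
          have "adj c h" "adj c k" "adj h k" using hk clqD[OF C(2)] by auto
          moreover have "h \<in> ?A" "k \<in> ?A" using hk C by auto
          ultimately show ?thesis using AV by (auto simp: nb_def)
        qed
        have "t \<notin> C"
        proof
          assume "t \<in> C"
          then obtain v v' where "v \<in> {u, w}" "v' \<in> {u, w}" "adj v v'"
            using tri[of t] nt by (meson subsetD)
          then show False using P(2) adj_irrefl adj_sym by blast
        qed
        moreover have "w \<notin> C"
        proof
          assume "w \<in> C"
          then obtain v v' where "v \<in> {t, e}" "v' \<in> {t, e}" "adj v v'"
            using tri[of w] nw by (meson subsetD)
          then show False using te adj_irrefl adj_sym by blast
        qed
        ultimately have "C \<subseteq> A" using C by blast
        then show False using opt_free[OF oA] C cp by (auto simp: free_def)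
      qed
    qed
    then have "opt ?A" using cA oA by (simp add: opt_def)
    then obtain Q where Q: "Q \<in> qs ?A" using bad by blast
    have Q': "Q \<subseteq> V - ?A" "clq adj Q" "card Q = 3" using Q q_eq_3 unfolding qs_def by auto
    have tQ: "t \<notin> Q" "w \<notin> Q" using Q' by auto
    have "Q \<notin> qs A" using tokD(5)[OF D(1)] tQ by blast
    then have "\<not> Q \<subseteq> V - A" using Q' q_eq_3 unfolding qs_def by simp
    then obtain x where x: "x \<in> Q" "x \<in> {a, b}" using Q' by blast
    obtain z1 z2 where z: "Q = {x, z1, z2}" "z1 \<noteq> x" "z2 \<noteq> x" "z1 \<noteq> z2" using card3_elim[OF Q'(3) x(1)] by metis
    have az: "adj x z1" "adj x z2" using clqD[OF Q'(2)] z by auto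
    have zV: "z1 \<in> V" "z2 \<in> V" using z Q' by auto
    have zA: "z1 \<notin> A" "z2 \<notin> A"
    proof -
      have "z1 \<notin> {a, b}" "z2 \<notin> {a, b}" using az z x D(8) adj_sym by auto
      then show "z1 \<notin> A" "z2 \<notin> A" using z Q' by auto
    qed
    have "adj t x" "adj u x" "adj w x" "adj x e" using x(2) D(10-13) wab True by auto
    then have "{t, u, w, e, z1, z2} \<subseteq> nb x" using az zV V(3) eV tt(1) w(1) adj_sym unfolding nb_def by blast
    moreover have "distinct [t, u, w, e, z1, z2]" using z zA tQ tt w(2) wt e' eu D(14) by auto
    moreover have "x \<in> V" using x V by auto
    ultimately show False using six_nb by metis
  qed
qed

lemma kern_edge:
  assumes "cfg B" "card (kern B) = 3" "g \<in> kern B" "h \<in> kern B" "g \<noteq> h" "x \<in> V - B" "adj x g" "adj x h"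
  obtains f1 f2 where "f1 \<in> B - kern B" "f2 \<in> B - kern B" "adj x f1" "adj x f2" "adj f1 f2"
  using assms(1,3)
proof (cases rule: kern_cases)
  case (single g' h')
  obtain c where k: "kern B = {g, h, c}" "g \<noteq> c" "h \<noteq> c" "adj g h" "adj g c" "adj h c" "{g', h'} = {h, c}"
    using single assms(4,5) adj_sym by (metis insert_commute insert_iff singletonD)
  have uni: "K = {g, h, c}" if "pclq B K" for K using single(9)[OF that] k(7) by auto
  show ?thesis
    by (rule single_edge[OF assms(1) k(1) _ k(4-6) uni assms(6-8)]) (use that k assms(5) in auto)
next
  case (double u a b)
  then show ?thesis using assms(2) by simp
qed

text \<open>The edge found by \<open>kern_edge\<close> supplies the two further neighbours of
  \<open>x\<close> that \<open>single_two_tri\<close> asks for.\<close>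

lemma kern_no_two_tri:
  assumes "cfg B" "card (kern B) = 3" "g \<in> kern B" "h \<in> kern B" "g \<noteq> h" "x \<in> V - B" "adj x g" "adj x h"
    and z: "z \<in> V - B" "adj g z" "adj x z" "z' \<in> V - B" "adj h z'" "adj x z'"
  shows False
proof -
  obtain f1 f2 where f: "f1 \<in> B - kern B" "f2 \<in> B - kern B" "adj x f1" "adj x f2" "adj f1 f2"
    by (rule kern_edge[OF assms(1-8)])
  have gh: "adj g h"
  proof -
    obtain K where K: "K \<subseteq> B" "clq adj K" "card K = p" using cfg_pclq[OF assms(1)] by metis
    then have "g \<in> K" "h \<in> K" using kernD assms(3,4) by blast+
    then show ?thesis using clqD[OF K(2)] assms(5) by blast
  qed
  have d: "distinct [g, h, f1, f2]" using f assms(3-5) adj_neq by auto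
  have s: "{g, h, f1, f2} \<subseteq> B" using f assms(3,4) kern_sub by blast
  show False
    by (rule single_two_tri[OF assms(6) s d cfg_sub[OF assms(1)] assms(7,8) f(3,4) gh z])
qed

text \<open>
  Choosing a state with the most edges inside \<open>A\<close> forces \<open>|N(u) \<inter> (A \<union> {t})| \<ge> |N(t) \<inter> A|\<close> for every
  exchangeable \<open>u\<close>, with equality precisely when the exchange again gives such a state.
\<close>

definition edge_count :: "'a set \<Rightarrow> nat" where
  "edge_count A = card {(v, w). v \<in> A \<and> w \<in> A \<and> adj v w}"

definition dense :: "'a set \<Rightarrow> bool" where
  "dense A \<longleftrightarrow> (\<exists>t. tok A t) \<and> (\<forall>B t. tok B t \<longrightarrow> edge_count B \<le> edge_count A)"

text \<open>Ordered pairs are counted, whence the factor 2.\<close>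

lemma edge_count_insert:
  assumes "A \<subseteq> V" "t \<in> V" "t \<notin> A"
  shows "edge_count (insert t A) = edge_count A + 2 * card (nb t \<inter> A)"
proof -
  let ?E = "{(v, w). v \<in> A \<and> w \<in> A \<and> adj v w}" and ?N = "nb t \<inter> A"
  have fA: "finite A" using fin_sub assms by blast
  have "?E \<subseteq> A \<times> A" by auto
  then have fE: "finite ?E" using fA finite_subset by blast
  have eq: "{(v, w). v \<in> insert t A \<and> w \<in> insert t A \<and> adj v w} = ?E \<union> (({t} \<times> ?N) \<union> (?N \<times> {t}))"
    (is "?L = ?R")
  proof (rule set_eqI)
    fix e show "e \<in> ?L \<longleftrightarrow> e \<in> ?R"
      using assms adj_irrefl[of t] adj_comm[of "fst e" t] by (cases e) (auto simp: nb_def)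
  qed
  have "card (({t} \<times> ?N) \<union> (?N \<times> {t})) = card ({t} \<times> ?N) + card (?N \<times> {t})"
    by (rule card_Un_disjoint) (use fA nb_irrefl in auto)
  moreover have "card (?E \<union> (({t} \<times> ?N) \<union> (?N \<times> {t}))) = card ?E + card (({t} \<times> ?N) \<union> (?N \<times> {t}))"
    by (rule card_Un_disjoint) (use fA fE assms in auto)
  ultimately show ?thesis unfolding edge_count_def eq by (simp add: card_cartesian_product)
qed

lemma edge_count_swap:
  assumes "tok A t" "u \<in> core A t"
  shows "edge_count (insert t A - {u}) + 2 * card (nb u \<inter> insert t A) = edge_count A + 2 * card (nb t \<inter> A)"
proof -
  have u: "u \<in> A" "t \<notin> A" "A \<subseteq> V" "t \<in> V" using core_sub[OF assms(2)] tokD[OF assms(1)] by auto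
  have "insert u (insert t A - {u}) = insert t A" using u by auto
  moreover have "nb u \<inter> (insert t A - {u}) = nb u \<inter> insert t A" using nb_irrefl[of u] by auto
  moreover have "insert t A - {u} \<subseteq> V" "u \<in> V" "u \<notin> insert t A - {u}" using u by auto
  ultimately show ?thesis
    using edge_count_insert[of "insert t A - {u}" u] edge_count_insert[of A t] u by metis
qed

lemma dense_swap_le:
  assumes "dense A" "tok A t" "u \<in> core A t" shows "card (nb t \<inter> A) \<le> card (nb u \<inter> insert t A)"
  using edge_count_swap[OF assms(2,3)] assms(1) swap_tok[OF assms(2,3)] unfolding dense_def by fastforce

lemma dense_swap:
  assumes "dense A" "tok A t" "u \<in> core A t" "card (nb u \<inter> insert t A) = card (nb t \<inter> A)"
  shows "dense (insert t A - {u})"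
  using edge_count_swap[OF assms(2,3)] assms(1,4) swap_tok[OF assms(2,3)] unfolding dense_def by fastforce

lemma dense_ex: "\<exists>A. dense A"
proof -
  let ?S = "{A. \<exists>t. tok A t}"
  have "?S \<subseteq> Pow V" using tokD by blast
  then have f: "finite ?S" using finV finite_subset by blast
  have ne: "?S \<noteq> {}" using tok_ex by blast
  have "Max (edge_count ` ?S) \<in> edge_count ` ?S" using f ne by (intro Max_in) auto
  then obtain A where A: "A \<in> ?S" "Max (edge_count ` ?S) = edge_count A" by blast
  have "edge_count B \<le> edge_count A" if "tok B t" for B t
  proof -
    have "edge_count B \<in> edge_count ` ?S" using that by blast
    then show ?thesis using Max_ge[of "edge_count ` ?S"] f A(2) by simp
  qed
  then show ?thesis using A(1) unfolding dense_def by blast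
qed

lemma core_card_le: "tok A t \<Longrightarrow> u \<in> core A t \<Longrightarrow> card (nb u \<inter> insert t A) \<le> 3"
  using cfg_in_le[OF cfg_tok, of A t u] kern_core[of A t] p_eq_3 by auto

text \<open>Three is the largest inner degree possible here, by \<open>core_card_le\<close>. In a
  dense set, a single triangle whose token has three inner neighbours produces such a pair through
  \<open>dense_swap_le\<close>.\<close>

definition heavy_pair :: "'a set \<Rightarrow> 'a \<Rightarrow> 'a \<Rightarrow> 'a \<Rightarrow> bool" where
  "heavy_pair A t g h \<longleftrightarrow> tok A t \<and> g \<in> core A t \<and> h \<in> core A t \<and> g \<noteq> h
     \<and> card (nb g \<inter> insert t A) = 3 \<and> card (nb h \<inter> insert t A) = 3"

text \<open>If \<open>a\<close> were exchangeable with \<open>w\<close>, its outer triangle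
  afterwards would give six neighbours or, through \<open>r\<close> and \<open>d\<close>, a K_4. So
  \<open>a\<close> is an additional neighbour of \<open>w\<close>. In a single triangle this would
  make the inner degree of \<open>w\<close> three and produce a heavy pair, so \<open>w\<close>
  belongs to a diamond that has \<open>a\<close> as an end.\<close>

lemma double_partner_center:
  assumes dn: "dense A" and no: "\<And>g h t. \<not> heavy_pair A t g h"
    and dbl: "double A r u a b" and w: "w \<in> V" "w \<notin> A" "d \<in> V" "d \<notin> A" "adj r d" "adj r w" "adj d w"
    and wa: "adj w a"
  obtains e c where "double A w e a c" "e \<noteq> u"
proof -
  note D = doubleD[OF dbl]
  note P = double_partner[OF dbl w]
  have rt: "r \<in> V" "r \<notin> A" "A \<subseteq> V" using tokD[OF D(1)] by auto
  have aV: "a \<in> V" "u \<in> V" using D rt by auto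
  have ac: "a \<notin> core A w"
  proof
    assume ac: "a \<in> core A w"
    obtain e where e: "e \<in> A" "adj w e" "adj a e" using core_adj[OF P(3) ac] by metis
    have eu: "e \<noteq> u" using e P(2) by auto
    obtain z1 z2 where z: "z1 \<in> V" "z1 \<notin> insert w A - {a}" "z2 \<in> V" "z2 \<notin> insert w A - {a}"
        "adj a z1" "adj a z2" "adj z1 z2"
      using tok_tri_ex[OF swap_tok[OF P(3) ac]] .
    have zA: "z1 \<notin> A" "z2 \<notin> A" "z1 \<noteq> w" "z2 \<noteq> w" using z adj_irrefl D w by auto
    have eV: "e \<in> V" using e rt by blast
    have sub: "{r, u, w, e, z1, z2} \<subseteq> nb a" using z e D eV aV rt w wa adj_sym by (auto simp: nb_def)
    have wr: "w \<noteq> r" using w adj_irrefl by auto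
    have "r = z1 \<or> r = z2"
    proof (rule ccontr)
      assume "\<not> ?thesis"
      then have "distinct [r, u, w, e, z1, z2]"
        using z(7) adj_neq[of z1 z2] zA rt w(2) wr e eu D(14) by auto
      then show False using six_nb[OF aV(1) sub] by blast
    qed
    then obtain z where z': "z \<in> V" "z \<notin> A" "z \<noteq> w" "adj a z" "adj r z" using z zA adj_sym by blast
    then have "z = d" using P(1) by (auto simp: nb_def)
    moreover have "{r, d, w, a} \<subseteq> V" using rt w aV by blast
    moreover have "adj d a" using z' \<open>z = d\<close> adj_sym by blast
    ultimately show False using K4[of r d w a] w wa D(10) by blast
  qed
  show thesis
    using P(3)
  proof (cases rule: tok_cases)
    case (single g h)
    have "{a, g, h} \<subseteq> nb w \<inter> A" using single wa D(15) rt by (auto simp: nb_def)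
    moreover have "card {a, g, h} = 3" using ac single(1,2) by auto
    ultimately have "3 \<le> card (nb w \<inter> A)" using card_mono[of "nb w \<inter> A" "{a, g, h}"] fin_nb by simp
    moreover have "card (nb v \<inter> insert w A) \<le> 3" "card (nb w \<inter> A) \<le> card (nb v \<inter> insert w A)"
      if "v \<in> core A w" for v
      using core_card_le[OF P(3) that] dense_swap_le[OF dn P(3) that] by auto
    ultimately have "heavy_pair A w g h" using single(1,2) P(3) by (fastforce simp: heavy_pair_def)
    then show ?thesis using no by blast
  next
    case (double e x y)
    note E = doubleD[OF double]
    have "a \<in> nb w \<inter> A" using wa D(15) aV by (auto simp: nb_def)
    then have "a = x \<or> a = y" using E(2,3) ac by auto
    moreover have "e \<noteq> u" using E(9) P(2) by auto
    ultimately show ?thesis using that double double_sym[OF double] by blast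
  qed
qed

end

section \<open>Walks through light states\<close>

locale light_walk = clique_part V adj p q
  for V :: "'a set" and adj p q +
  fixes A0 :: "'a set" and r g0 h0 :: 'a
  assumes start: "dense A0" "tok A0 r" "core A0 r = {g0, h0}" "nb r \<inter> A0 = {g0, h0}" "adj g0 h0"
    and light: "dense A \<Longrightarrow> tok A t \<Longrightarrow> \<exists>g h. core A t = {g, h} \<and> g \<noteq> h \<and> nb t \<inter> A = {g, h}
      \<and> adj g h \<and> adj t g \<and> adj t h \<and> nb g \<inter> insert t A = {t, h}"
begin

text \<open>
  \<open>X\<close> contains the vertices that have entered \<open>A0\<close> and \<open>Y\<close> those that have left it. As they are never moved
  again, \<open>V - A - Y\<close> shrinks with every exchange.
\<close>

definition entered :: "'a set \<Rightarrow> 'a set \<Rightarrow> 'a set \<Rightarrow> 'a \<Rightarrow> bool" where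
  "entered A X Y s \<longleftrightarrow> (\<exists>B h. cfg B \<and> card (kern B) = 3 \<and> s \<in> kern B \<and> h \<in> kern B \<and> s \<noteq> h \<and> r \<notin> B
     \<and> B \<subseteq> A \<union> Y \<and> nb s \<inter> (A - X) \<subseteq> {h})"

text \<open>\<open>B\<close> is the configuration that \<open>c\<close> left. Its inner degree 2
  there is what keeps \<open>Y - {r}\<close> independent.\<close>

definition left :: "'a set \<Rightarrow> 'a set \<Rightarrow> 'a set \<Rightarrow> 'a \<Rightarrow> bool" where
  "left A X Y c \<longleftrightarrow> (\<exists>B s h. nb c \<inter> B = {s, h} \<and> s \<in> X \<and> adj s h \<and> B \<subseteq> A \<union> Y \<and> A - X \<subseteq> B)"

text \<open>The clause on common neighbours says that a vertex which entered forms no triangle with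
  a fresh outer vertex except through \<open>A - X\<close>. It is true at entry because outer
  triangles contain \<open>d\<close>, which is in \<open>Y\<close>. The initial triangle is frozen:
  \<open>g0\<close>, \<open>h0\<close> stay in \<open>A\<close> and \<open>r\<close> stays
  outside.\<close>

definition inv :: "'a set \<Rightarrow> 'a \<Rightarrow> 'a set \<Rightarrow> 'a set \<Rightarrow> bool" where
  "inv A d X Y \<longleftrightarrow> dense A \<and> tok A d \<and> d \<in> Y \<and> r \<in> Y \<and> Y \<subseteq> V \<and> Y \<inter> A = {} \<and> X \<subseteq> A \<and> X \<inter> A0 = {}
    \<and> A0 \<subseteq> A \<union> Y \<and> A - X \<subseteq> A0 \<and> Y - {r} \<subseteq> A0 \<and> {g0, h0} \<subseteq> A
    \<and> (\<forall>s\<in>X. \<forall>x\<in>V - A - Y. adj s x \<longrightarrow> nb s \<inter> nb x - Y \<subseteq> A - X)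
    \<and> (\<forall>s\<in>X. entered A X Y s) \<and> (\<forall>c\<in>Y - {r}. left A X Y c)
    \<and> (\<forall>a\<in>Y - {r}. \<forall>b\<in>Y - {r}. \<not> adj a b)"

lemma step:
  assumes "inv A d X Y"
  shows "\<exists>A' d' X' Y'. inv A' d' X' Y' \<and> card (V - A' - Y') < card (V - A - Y)"
proof -
  have I1: "dense A" "tok A d" "d \<in> Y" "r \<in> Y" "Y \<subseteq> V" "Y \<inter> A = {}" "X \<subseteq> A" "X \<inter> A0 = {}"
    "A0 \<subseteq> A \<union> Y" "A - X \<subseteq> A0" "Y - {r} \<subseteq> A0" "{g0, h0} \<subseteq> A"
    using assms unfolding inv_def by - (elim conjE, assumption)+
  have "\<forall>s\<in>X. \<forall>x\<in>V - A - Y. adj s x \<longrightarrow> nb s \<inter> nb x - Y \<subseteq> A - X"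
    using assms unfolding inv_def by - (elim conjE, assumption)
  then have J: "nb s \<inter> nb x - Y \<subseteq> A - X" if "s \<in> X" "x \<in> V - A - Y" "adj s x" for s x
    using that by blast
  have "\<forall>s\<in>X. entered A X Y s"
    using assms unfolding inv_def by - (elim conjE, assumption)
  note RX = this[unfolded entered_def, rule_format]
  have "\<forall>c\<in>Y - {r}. left A X Y c"
    using assms unfolding inv_def by - (elim conjE, assumption)
  note RY = this[unfolded left_def, rule_format]
  have "\<forall>a\<in>Y - {r}. \<forall>b\<in>Y - {r}. \<not> adj a b"
    using assms unfolding inv_def by - (elim conjE, assumption)
  note NY = this[rule_format]
  have AV: "A \<subseteq> V" "opt A" using tokD[OF I1(2)] by auto
  have rA0: "r \<notin> A0" "r \<in> V" using tokD[OF start(2)] by auto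
  obtain t where t: "tok A t" "t \<notin> Y"
    using I1(2)
  proof (cases rule: qs_shape)
    case (one Q)
    have Q: "Q \<subseteq> V - A" "clq adj Q" "card Q = 3" using one q_eq_3 unfolding qs_def by auto
    have "\<not> Q \<subseteq> Y"
    proof
      assume QY: "Q \<subseteq> Y"
      have "finite Q" using Q(3) card.infinite by fastforce
      then have "card (Q - {r}) \<ge> 2" using Q(3) by (simp add: card_Diff_singleton_if)
      then have "\<not> card (Q - {r}) \<le> Suc 0" by simp
      then obtain a b where "a \<in> Q - {r}" "b \<in> Q - {r}" "a \<noteq> b"
        using card_le_Suc0_iff_eq[of "Q - {r}"] \<open>finite Q\<close> by blast
      then show False using NY[of a b] clqD[OF Q(2), of a b] QY by blast
    qed
    then obtain t where "t \<in> Q" "t \<notin> Y" by blast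
    then show ?thesis using that[of t] AV Q one by (auto simp: tok_def)
  next
    case (two I z1 z2)
    have QI: "insert z1 I \<in> qs A" using two(1) by blast
    have Q: "I \<subseteq> V - A" "clq adj I" using QI clq_subset[of adj "insert z1 I" I] unfolding qs_def by auto
    have "card I = 2" using two(6) q_eq_3 by simp
    then obtain c where c: "I = {d, c}" "c \<noteq> d" using card2_elim two(5) by metis
    have dc: "adj d c" using clqD[OF Q(2)] c by auto
    \<comment> \<open>By independence one of \<open>d\<close>, \<open>c\<close> would be
      \<open>r\<close>. The other is then a neighbour of \<open>r\<close> in \<open>A0\<close>, that
      is \<open>g0\<close> or \<open>h0\<close>, and these never left.\<close>
    have "\<not> I \<subseteq> Y"
    proof
      assume IY: "I \<subseteq> Y"
      have no_r: False if "e \<in> Y - {r}" "adj r e" for e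
      proof -
        have "e \<in> nb r \<inter> A0" using that I1(5,11) by (auto simp: nb_def)
        then have "e \<in> A" using start(4) I1(12) by blast
        then show False using that I1(6) by blast
      qed
      have "d = r \<or> c = r" using NY[of d c] dc c IY by blast
      then show False using no_r[of c] no_r[of d] dc c IY adj_sym[of d c] by auto
    qed
    then obtain t where t: "t \<in> I" "t \<notin> Y" by blast
    then have "tok A t" using AV Q two(1) by (auto simp: tok_def)
    then show ?thesis using that t by blast
  qed
  have tV: "t \<in> V" "t \<notin> A" using tokD[OF t(1)] by auto
  have tA0: "t \<notin> A0" "t \<noteq> r" using tV t(2) I1 by auto
  obtain y f where yf: "core A t = {y, f}" "y \<noteq> f" "nb t \<inter> A = {y, f}" "adj y f" "adj t y" "adj t f"
    "nb y \<inter> insert t A = {t, f}"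
    using light[OF I1(1) t(1)] by blast
  have yfA: "y \<in> A" "f \<in> A" using core_sub yf(1) by blast+
  \<comment> \<open>The token \<open>t\<close> has no neighbours in \<open>A\<close> besides
    \<open>y\<close> and \<open>f\<close>, so the edge would lie in the independent set
    \<open>Y - {r}\<close>.\<close>
  have no_new: False if "f1 \<in> B" "f2 \<in> B" "adj t f1" "adj t f2" "adj f1 f2" "B \<subseteq> A \<union> Y" "r \<notin> B"
    "f1 \<notin> {y, f}" "f2 \<notin> {y, f}" for B f1 f2
  proof -
    have "f1 \<notin> A" "f2 \<notin> A" using that yf(3) AV by (auto simp: nb_def)
    then have "f1 \<in> Y - {r}" "f2 \<in> Y - {r}" using that by auto
    then show False using NY that(5) by blast
  qed
  \<comment> \<open>Otherwise \<open>t\<close> is adjacent to two kernel vertices of the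
    configuration in which \<open>s\<close> entered, and \<open>kern_edge\<close> gives an edge that
    \<open>no_new\<close> forbids. The next step argues in the same way for the initial
    triangle.\<close>
  have EX: "s \<notin> X" if s: "s \<in> {y, f}" for s
  proof
    assume sX: "s \<in> X"
    obtain z where z: "{y, f} = {s, z}" "adj s z" "adj t z" "adj t s"
    proof (cases "s = y")
      case True then show ?thesis using that[of f] yf by blast
    next
      case False then show ?thesis using that[of y] s yf(4-6) adj_sym by blast
    qed
    have zA: "z \<in> A" using z(1) yfA by auto
    then have "z \<in> nb s \<inter> nb t - Y" using z AV I1(6) by (auto simp: nb_def)
    then have zX: "z \<in> A - X" using J[OF sX, of t] tV t(2) z(4) adj_sym by blast
    obtain B h where B: "cfg B" "card (kern B) = 3" "s \<in> kern B" "h \<in> kern B" "s \<noteq> h" "r \<notin> B"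
        "B \<subseteq> A \<union> Y" "nb s \<inter> (A - X) \<subseteq> {h}"
      using RX[OF sX] by blast
    have "z \<in> nb s" using z(2) zA AV by (auto simp: nb_def)
    then have zh: "z = h" using zX B(8) by blast
    have tB: "t \<in> V - B" using tV t(2) B(7) by blast
    obtain f1 f2 where "f1 \<in> B - kern B" "f2 \<in> B - kern B" "adj t f1" "adj t f2" "adj f1 f2"
      using kern_edge[OF B(1-5) tB] z zh by metis
    then show False using no_new[of f1 B f2] B z zh by auto
  qed
  have EP: "{y, f} \<noteq> {g0, h0}"
  proof
    assume e: "{y, f} = {g0, h0}"
    have c: "cfg (insert r A0)" using cfg_tok[OF start(2)] .
    have k: "kern (insert r A0) = {r, g0, h0}" using kern_core[OF start(2)] start(3) by simp
    have gh: "g0 \<in> A0" "h0 \<in> A0" "g0 \<noteq> h0" using core_sub start(3) adj_neq[OF start(5)] by blast+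
    have "r \<noteq> g0" "r \<noteq> h0" using gh rA0 by auto
    then have k3: "card (kern (insert r A0)) = 3" using k gh by simp
    have tg: "adj t g0" "adj t h0" using yf(5,6) e by (auto simp: doubleton_eq_iff)
    obtain f1 f2 where f: "f1 \<in> insert r A0 - kern (insert r A0)" "f2 \<in> insert r A0 - kern (insert r A0)"
        "adj t f1" "adj t f2" "adj f1 f2"
      using kern_edge[OF c k3 _ _ gh(3) _ tg] k tV tA0 by blast
    then show False using no_new[of f1 A0 f2] k e I1(9) rA0 by auto
  qed
  \<comment> \<open>The other frozen vertex would be a neighbour of \<open>y\<close> in
    \<open>A\<close>, hence equal to \<open>f\<close>.\<close>
  have yP: "y \<notin> {g0, h0}"
  proof
    assume y: "y \<in> {g0, h0}"
    obtain z where z: "{g0, h0} = {y, z}" "adj y z"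
    proof (cases "y = g0")
      case True then show ?thesis using that[of h0] start(5) by blast
    next
      case False then show ?thesis using that[of g0] y start(5) adj_sym by blast
    qed
    have "z \<in> A" using z(1) I1(12) by blast
    then have "z \<in> nb y \<inter> insert t A" using z(2) AV by (auto simp: nb_def)
    then have "z \<in> {t, f}" using yf(7) by simp
    then have "z = f" using \<open>z \<in> A\<close> tV by auto
    then show False using EP z(1) by blast
  qed
  have yX: "y \<in> A - X" "f \<in> A - X" using EX yfA by auto
  let ?A = "insert t A - {y}" and ?X = "insert t X" and ?Y = "insert y Y"
  have tokn: "tok ?A y" using swap_tok[OF t(1)] yf(1) by blast
  have "card (nb y \<inter> insert t A) = card (nb t \<inter> A)" using yf(2,3,7) tV yfA by auto
  then have dn: "dense ?A" using dense_swap[OF I1(1) t(1)] yf(1) by blast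
  \<comment> \<open>In the configuration that \<open>a\<close> left, \<open>y\<close> would be the
    neighbour \<open>h\<close>, adjacent to the entered vertex \<open>s\<close>. But in
    \<open>A\<close> the only neighbour of \<open>y\<close> is \<open>f\<close>, which is not in
    \<open>X\<close>.\<close>
  have NYn: "\<not> adj a y" if a: "a \<in> Y - {r}" for a
  proof
    assume ay: "adj a y"
    obtain B s h where B: "nb a \<inter> B = {s, h}" "s \<in> X" "adj s h" "B \<subseteq> A \<union> Y" "A - X \<subseteq> B" using RY[OF a] by blast
    have "y \<in> nb a \<inter> B" using ay yX B(5) AV by (auto simp: nb_def)
    then have "y \<in> {s, h}" using B(1) by simp
    then have "y = h" using B(2) yX by auto
    then have "s \<in> nb y \<inter> insert t A" using B(2,3) I1(7) AV adj_sym by (auto simp: nb_def)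
    then have "s \<in> {t, f}" using yf(7) by simp
    then have "s = f" using B(2) I1(7) tV by auto
    then show False using B(2) yX by blast
  qed
  have "inv ?A y ?X ?Y"
    unfolding inv_def
  proof (intro conjI ballI impI)
    show "dense ?A" "tok ?A y" "y \<in> ?Y" "r \<in> ?Y" "?Y \<subseteq> V" by (use dn tokn I1 yfA AV in auto)
    show "?Y \<inter> ?A = {}" "?X \<subseteq> ?A" "?X \<inter> A0 = {}" "A0 \<subseteq> ?A \<union> ?Y" "?A - ?X \<subseteq> A0" "?Y - {r} \<subseteq> A0" "{g0, h0} \<subseteq> ?A"
      by (use I1 t tV yX yP tA0 in blast)+
    show "nb s \<inter> nb x - ?Y \<subseteq> ?A - ?X" if s: "s \<in> ?X" and x: "x \<in> V - ?A - ?Y" and sx: "adj s x" for s x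
    proof -
      have x': "x \<in> V - A - Y" "x \<noteq> t" using x by auto
      show ?thesis
      proof (cases "s = t")
        case False
        then have "nb s \<inter> nb x - Y \<subseteq> A - X" using J[of s x] s x' sx by blast
        then show ?thesis using tV by blast
      next
        case True
        show ?thesis
        proof
          fix z assume z: "z \<in> nb s \<inter> nb x - ?Y"
          have az: "adj t z" "adj x z" "z \<in> V" "z \<notin> Y" "z \<noteq> y" using z True by (auto simp: nb_def)
          have zA: "z \<in> A"
          proof (rule ccontr)
            assume "z \<notin> A"
            then have "d = t \<or> d = x \<or> d = z"
              using tok_tri[OF I1(2), of t x z] az sx True x' tV by auto
            then show False using I1(3) t(2) x' az by blast
          qed
          moreover have "z \<notin> X"
          proof
            assume zX: "z \<in> X"
            have "t \<in> nb z \<inter> nb x - Y" using az sx True tV t(2) adj_sym by (auto simp: nb_def)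
            then show False using J[OF zX x'(1)] az adj_sym tV by blast
          qed
          ultimately show "z \<in> ?A - ?X" using az tV by auto
        qed
      qed
    qed
    show "entered ?A ?X ?Y s" if s: "s \<in> ?X" for s
    proof (cases "s = t")
      case True
      have k: "kern (insert t A) = {t, y, f}" using kern_core[OF t(1)] yf(1) by simp
      have "t \<noteq> y" "t \<noteq> f" using yfA tV by auto
      then have "card (kern (insert t A)) = 3" using k yf(2) by simp
      moreover have "f \<noteq> t" using yfA tV by auto
      moreover have "r \<notin> insert t A" using tA0 I1(4,6) by auto
      moreover have "nb t \<inter> (?A - ?X) \<subseteq> {f}" using yf(3) by blast
      ultimately have "cfg (insert t A) \<and> card (kern (insert t A)) = 3 \<and> t \<in> kern (insert t A)
        \<and> f \<in> kern (insert t A) \<and> t \<noteq> f \<and> r \<notin> insert t A \<and> insert t A \<subseteq> ?A \<union> ?Y \<and> nb t \<inter> (?A - ?X) \<subseteq> {f}"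
        using cfg_tok[OF t(1)] k by auto
      then show ?thesis using True unfolding entered_def by blast
    next
      case False
      then obtain B h where B: "cfg B" "card (kern B) = 3" "s \<in> kern B" "h \<in> kern B" "s \<noteq> h" "r \<notin> B"
        "B \<subseteq> A \<union> Y" "nb s \<inter> (A - X) \<subseteq> {h}"
        using RX[of s] s by blast
      have "B \<subseteq> ?A \<union> ?Y" "nb s \<inter> (?A - ?X) \<subseteq> {h}" using B(7,8) by blast+
      then show ?thesis using B(1-6) unfolding entered_def by blast
    qed
    show "left ?A ?X ?Y c" if c: "c \<in> ?Y - {r}" for c
    proof (cases "c = y")
      case True
      have "nb y \<inter> insert t A = {t, f} \<and> t \<in> ?X \<and> adj t f \<and> insert t A \<subseteq> ?A \<union> ?Y \<and> ?A - ?X \<subseteq> insert t A"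
        using yf by blast
      then show ?thesis using True unfolding left_def by blast
    next
      case False
      then obtain B s h where B: "nb c \<inter> B = {s, h}" "s \<in> X" "adj s h" "B \<subseteq> A \<union> Y" "A - X \<subseteq> B"
        using RY[of c] c by blast
      have "s \<in> ?X" "B \<subseteq> ?A \<union> ?Y" "?A - ?X \<subseteq> B" using B by blast+
      then show ?thesis using B(1,3) unfolding left_def by blast
    qed
    show "\<not> adj a b" if "a \<in> ?Y - {r}" "b \<in> ?Y - {r}" for a b
      using NY[of a b] NYn[of a] NYn[of b] that adj_irrefl[of y] adj_sym by blast
  qed
  moreover have "card (V - ?A - ?Y) < card (V - A - Y)"
  proof (rule psubset_card_mono)
    show "V - ?A - ?Y \<subset> V - A - Y" using tV t(2) by blast
  qed (use finV in simp)
  ultimately show ?thesis by blast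
qed

lemma contradiction: False
proof -
  have no: "\<not> inv A d X Y" if "card (V - A - Y) = n" for A d X Y n
    using that
  proof (induction n arbitrary: A d X Y rule: less_induct)
    case (less n)
    then show ?case using step[of A d X Y] by blast
  qed
  have t: "r \<in> V" "r \<notin> A0" "A0 \<subseteq> V" using tokD[OF start(2)] by auto
  have "{g0, h0} \<subseteq> A0" using core_sub start(3) by blast
  then have "inv A0 r {} {r}" unfolding inv_def using start t by auto
  then show False using no by blast
qed

end

section \<open>Walks with a frozen vertex set\<close>

context clique_part
begin

text \<open>Pure bookkeeping: \<open>P\<close> is frozen inside \<open>A\<close>. The initial token
  \<open>r\<close> is counted in \<open>Y\<close> although it was never in \<open>A0\<close>, so
  that it cannot enter either.\<close>

definition guarded :: "'a set \<Rightarrow> 'a \<Rightarrow> 'a set \<Rightarrow> 'a set \<Rightarrow> 'a \<Rightarrow> 'a set \<Rightarrow> 'a set \<Rightarrow> bool" where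
  "guarded A0 r P A d X Y \<longleftrightarrow> tok A d \<and> d \<in> Y \<and> r \<in> Y \<and> Y \<subseteq> V \<and> Y \<inter> A = {} \<and> X \<subseteq> A \<and> X \<inter> A0 = {}
    \<and> A0 \<subseteq> A \<union> Y \<and> A - X \<subseteq> A0 \<and> Y - {r} \<subseteq> A0 \<and> P \<subseteq> A"

text \<open>
  Recorded when \<open>s\<close> is exchanged with \<open>c\<close> in the configuration \<open>B\<close>. It rules out that later both triangles outside
  \<open>A\<close> contain \<open>c\<close>, the only way in which all candidates for the next exchange could be used up.
\<close>

definition bridged :: "'a set \<Rightarrow> 'a set \<Rightarrow> 'a set \<Rightarrow> 'a set \<Rightarrow> 'a \<Rightarrow> 'a \<Rightarrow> bool" where
  "bridged P X Y B s c \<longleftrightarrow> (\<forall>h\<in>B - P - X. \<forall>x\<in>V - B - Y. \<forall>v\<in>V - B.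
     adj s h \<and> adj c h \<and> adj x s \<and> adj x h \<and> adj v s \<and> adj v c \<and> v \<noteq> x \<longrightarrow> (\<exists>e\<in>V - B. adj e v \<and> adj e s))"

lemma guardedD:
  assumes "guarded A0 r P A d X Y"
  shows "tok A d" "d \<in> Y" "r \<in> Y" "Y \<subseteq> V" "Y \<inter> A = {}" "X \<subseteq> A" "X \<inter> A0 = {}" "A0 \<subseteq> A \<union> Y"
    "A - X \<subseteq> A0" "Y - {r} \<subseteq> A0" "P \<subseteq> A"
  using assms unfolding guarded_def by - (elim conjE, assumption)+

lemma bridged_mono:
  assumes "bridged P X Y B s c" "X \<subseteq> X'" "Y \<subseteq> Y'" shows "bridged P X' Y' B s c"
  unfolding bridged_def
proof (intro ballI impI)
  fix h x v
  assume "h \<in> B - P - X'" "x \<in> V - B - Y'" and v: "v \<in> V - B"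
    and a: "adj s h \<and> adj c h \<and> adj x s \<and> adj x h \<and> adj v s \<and> adj v c \<and> v \<noteq> x"
  then have "h \<in> B - P - X" "x \<in> V - B - Y" using assms(2,3) by auto
  then show "\<exists>e\<in>V - B. adj e v \<and> adj e s"
    using assms(1)[unfolded bridged_def, THEN bspec, THEN bspec, THEN bspec, THEN mp, OF _ _ v a] by blast
qed

text \<open>
  The frozen vertex \<open>g \<in> P\<close> need not be given up for \<open>t\<close>: \<open>f\<close> is exchanged instead, and this leaves no pair of
  vertices \<open>g\<close>, \<open>s\<close> in \<open>A\<close> adjacent to both \<open>t\<close> and some \<open>w\<close>.
\<close>

definition replaceable :: "'a set \<Rightarrow> 'a set \<Rightarrow> 'a \<Rightarrow> 'a set \<Rightarrow> 'a set \<Rightarrow> 'a \<Rightarrow> 'a \<Rightarrow> bool" where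
  "replaceable P A d X Y t g \<longleftrightarrow> (\<exists>f. core A t = {g, f} \<and> f \<notin> X \<and> f \<notin> P
     \<and> \<not> (\<exists>w s. w \<in> V - A - Y \<and> adj d t \<and> adj d w \<and> adj t w \<and> adj w g
          \<and> s \<in> A \<and> s \<noteq> g \<and> s \<noteq> f \<and> adj s t \<and> adj s w))"

lemma core_pair_adj:
  assumes "tok A t" "g \<in> core A t" "h \<in> core A t" "g \<noteq> h" shows "adj g h"
proof -
  obtain E where E: "priv A t E" using priv_ex[OF assms(1)] .
  then show ?thesis using clqD[OF privD(3)[OF E]] core_priv[OF _ E] assms(2-4) by blast
qed

end

locale guarded_walk = clique_part V adj p q
  for V :: "'a set" and adj p q +
  fixes A0 :: "'a set" and r :: 'a and P :: "'a set" and g0 h0 :: 'a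
  assumes start: "tok A0 r" "P \<subseteq> A0" "core A0 r \<inter> P \<noteq> {}" "g0 \<in> P" "h0 \<in> P" "g0 \<noteq> h0" "adj r g0" "adj r h0"
    and clean: "guarded A0 r P A d X Y \<Longrightarrow> tok A t \<Longrightarrow> t \<notin> Y \<Longrightarrow> g \<in> P \<Longrightarrow> g \<in> core A t \<Longrightarrow>
      replaceable P A d X Y t g"
begin

text \<open>Uniqueness of the common neighbour ensures that a core vertex in \<open>X\<close> always
  has a partner in the core that may still be exchanged. The last clause keeps, for each
  \<open>c\<close> that left, the configuration in which \<open>s\<close> replaced it.\<close>

definition inv :: "'a set \<Rightarrow> 'a \<Rightarrow> 'a set \<Rightarrow> 'a set \<Rightarrow> bool" where
  "inv A d X Y \<longleftrightarrow> guarded A0 r P A d X Y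
    \<and> (\<forall>s\<in>X. \<forall>x\<in>V - A - Y. adj s x \<longrightarrow> nb s \<inter> nb x - Y \<subseteq> A - X \<and> (\<exists>z. nb s \<inter> nb x - Y \<subseteq> {z}))
    \<and> (\<forall>c\<in>Y - {r}. \<exists>B s. cfg B \<and> s \<in> X \<and> c \<in> kern B \<and> s \<in> kern B \<and> B \<subseteq> A \<union> Y \<and> A - X \<subseteq> B \<and> r \<notin> B
         \<and> (d \<noteq> c \<longrightarrow> d \<in> B) \<and> bridged P X Y B s c)"

lemma invD:
  assumes "inv A d X Y"
  shows "guarded A0 r P A d X Y"
    "s \<in> X \<Longrightarrow> x \<in> V - A - Y \<Longrightarrow> adj s x \<Longrightarrow> nb s \<inter> nb x - Y \<subseteq> A - X"
    "s \<in> X \<Longrightarrow> x \<in> V - A - Y \<Longrightarrow> adj s x \<Longrightarrow> \<exists>z. nb s \<inter> nb x - Y \<subseteq> {z}"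
    "c \<in> Y - {r} \<Longrightarrow> \<exists>B s. cfg B \<and> s \<in> X \<and> c \<in> kern B \<and> s \<in> kern B \<and> B \<subseteq> A \<union> Y \<and> A - X \<subseteq> B \<and> r \<notin> B
         \<and> (d \<noteq> c \<longrightarrow> d \<in> B) \<and> bridged P X Y B s c"
proof -
  note i = assms[unfolded inv_def]
  show "guarded A0 r P A d X Y" using i by (rule conjunct1)
  note j = i[THEN conjunct2, THEN conjunct1, rule_format] and k = i[THEN conjunct2, THEN conjunct2, rule_format]
  show "s \<in> X \<Longrightarrow> x \<in> V - A - Y \<Longrightarrow> adj s x \<Longrightarrow> nb s \<inter> nb x - Y \<subseteq> A - X" using j by (rule conjunct1)
  show "s \<in> X \<Longrightarrow> x \<in> V - A - Y \<Longrightarrow> adj s x \<Longrightarrow> \<exists>z. nb s \<inter> nb x - Y \<subseteq> {z}" using j by (rule conjunct2)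
  show "c \<in> Y - {r} \<Longrightarrow> \<exists>B s. cfg B \<and> s \<in> X \<and> c \<in> kern B \<and> s \<in> kern B \<and> B \<subseteq> A \<union> Y \<and> A - X \<subseteq> B \<and> r \<notin> B
         \<and> (d \<noteq> c \<longrightarrow> d \<in> B) \<and> bridged P X Y B s c" using k .
qed

text \<open>All of \<open>Y\<close> lies in \<open>insert r A0\<close>, where every triangle
  contains each core vertex of \<open>r\<close>; one of these is in \<open>P\<close> and has never
  left \<open>A\<close>.\<close>

lemma frozen_tri_free:
  assumes "guarded A0 r P A d X Y" "{a, b, c} \<subseteq> Y" "adj a b" "adj a c" "adj b c" shows False
proof -
  obtain k where k: "k \<in> core A0 r" "k \<in> P" using start(3) by blast
  have "{a, b, c} \<subseteq> insert r A0" using assms(2) guardedD(10)[OF assms(1)] by blast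
  then have pc: "pclq (insert r A0) {a, b, c}" using tri_pclq[of a b c "insert r A0"] assms(3-5) by blast
  have "k \<in> kern (insert r A0)" using kern_core[OF start(1)] k by blast
  then have "k \<in> {a, b, c}" using kernD[of k "insert r A0" "{a, b, c}"] pclqD[OF pc] by simp
  then show False using assms(2) guardedD(5,11)[OF assms(1)] k(2) by blast
qed

text \<open>With nonadjacent outer neighbours \<open>z1\<close>, \<open>z2\<close>, \<open>c\<close>
  cannot have full inner degree in \<open>B\<close>, so \<open>B\<close> has the single triangle
  \<open>{c, s, d}\<close>. Degree counts force private edges of \<open>c\<close> and of
  \<open>d\<close> through \<open>s\<close>, to vertices \<open>v\<close> and \<open>t\<close>
  outside \<open>B\<close>. The triangle of \<open>c\<close> outside \<open>B\<close> must use
  \<open>v\<close>, and \<open>bridged\<close> gives one on \<open>v\<close> and \<open>s\<close>.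
  So \<open>v\<close> violates \<open>kern_no_two_tri\<close> for \<open>c\<close> and
  \<open>s\<close>.\<close>

lemma shared_kernel_contradiction:
  assumes gd: "guarded A0 r P A d X Y"
    and B: "cfg B" "s \<in> X" "c \<in> kern B" "s \<in> kern B" "B \<subseteq> A \<union> Y" "d \<in> B" "bridged P X Y B s c"
    and c: "c \<in> Y" "c \<noteq> d" "adj c d"
    and z: "{z1, z2} \<subseteq> V - A - Y" "z1 \<noteq> z2" "\<not> adj z1 z2" "adj c z1" "adj c z2" "adj d z1" "adj d z2"
  shows False
proof -
  note G = guardedD[OF gd]
  have AV: "A \<subseteq> V" "opt A" using tokD[OF G(1)] by auto
  have BV: "B \<subseteq> V" using cfg_sub[OF B(1)] .
  have sA: "s \<in> A" "s \<notin> Y" using B(2) G(5,6) by auto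
  have cd: "c \<notin> A" "d \<notin> A" "c \<in> V" "d \<in> V" using c G by auto
  have zB: "z1 \<in> V - B" "z2 \<in> V - B" using z(1) B(5) by auto
  have zA: "z1 \<notin> A" "z2 \<notin> A" "z1 \<notin> Y" "z2 \<notin> Y" "z1 \<in> V" "z2 \<in> V" using z(1) by auto
  have cs: "c \<noteq> s" "d \<noteq> s" using sA cd by auto
  have cB: "c \<in> B" "s \<in> B" using B(3,4) kern_sub by auto
  have n3: "card (nb c \<inter> B) \<noteq> 3"
  proof
    assume c3: "card (nb c \<inter> B) = 3"
    obtain v where v: "nb c - B = {z1, v}" "adj z1 v" using kern_out[OF B(1,3) c3 zB(1) adj_sym[OF z(4)]] by metis
    have "z2 \<in> nb c - B" using zB z(5) by (auto simp: nb_def)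
    then have "adj z1 z2" using v z(2) by auto
    then show False using z(3) by blast
  qed
  obtain h where h: "kern B = {c, s, h}" "h \<noteq> c" "h \<noteq> s" "adj c h" "adj s h" "adj c s" "h \<in> B"
    and uni: "\<And>K. pclq B K \<Longrightarrow> K = {c, s, h}"
    using B(1,3)
  proof (cases rule: kern_cases)
    case (single g h)
    show ?thesis
    proof (cases "s = g")
      case True
      show ?thesis by (rule that[of h]) (use single True in auto)
    next
      case False
      then have sh: "s = h" using single(1) B(4) cs by auto
      show ?thesis by (rule that[of g]) (use single sh adj_sym in \<open>auto simp: insert_commute\<close>)
    qed
  next
    case (double u a b)
    then show ?thesis using n3 by auto
  qed
  have nbc: "nb c \<inter> B = {s, h}"
  proof (rule card_seteq[symmetric])
    show "{s, h} \<subseteq> nb c \<inter> B" using h cB BV by (auto simp: nb_def)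
    have "card (nb c \<inter> B) \<le> 3" using cfg_in_le[OF B(1,3)] p_eq_3 by simp
    then show "card (nb c \<inter> B) \<le> card {s, h}" using n3 h(3) by simp
  qed (use fin_nb in simp)
  have "d \<in> nb c \<inter> B" using B(6) c(3) cd by (auto simp: nb_def)
  then have dh: "d = h" using nbc cs by auto
  note h = h[folded dh] and uni = uni[folded dh] and nbc = nbc[folded dh]
  obtain v where v: "v \<in> A" "adj c v" "adj s v"
  proof -
    obtain g f where gf: "g \<in> A" "f \<in> A" "adj c g" "adj c f" "adj g f"
      using opt_edge[OF AV(2)] cd by blast
    have "s = g \<or> s = f"
    proof (rule ccontr)
      assume "\<not> ?thesis"
      then have "distinct [s, d, z1, z2, g, f]" using gf adj_neq[OF gf(5)] cs sA cd zA z(2) G(2) by auto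
      moreover have "{s, d, z1, z2, g, f} \<subseteq> nb c" using h c(3) z gf AV(1) sA(1) cd zB by (auto simp: nb_def)
      ultimately show False using six_nb[OF cd(3)] by metis
    qed
    then show ?thesis using that gf adj_sym by blast
  qed
  have vV: "v \<in> V" "v \<noteq> s" "v \<noteq> d" "v \<noteq> c" using v AV adj_irrefl cd by auto
  have vB: "v \<in> V - B"
  proof -
    have "v \<notin> B" using nbc v vV by (auto simp: nb_def)
    then show ?thesis using vV by blast
  qed
  have nbc5: "nb c = {s, d, z1, z2, v}"
  proof (rule five_nb[OF cd(3)])
    show "{s, d, z1, z2, v} \<subseteq> nb c" using h c(3) z v vV sA(1) AV(1) cd zB by (auto simp: nb_def)
    show "distinct [s, d, z1, z2, v]" using vV v cs sA cd zA z(2) G(2) by auto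
  qed
  obtain t where t: "t \<in> A" "adj d t" "adj s t"
  proof -
    obtain g f where gf: "g \<in> A" "f \<in> A" "adj d g" "adj d f" "adj g f"
      using opt_edge[OF AV(2)] cd by blast
    have "s = g \<or> s = f"
    proof (rule ccontr)
      assume "\<not> ?thesis"
      then have "distinct [s, c, z1, z2, g, f]" using gf adj_neq[OF gf(5)] cs sA cd zA z(2) c(1) by auto
      moreover have "{s, c, z1, z2, g, f} \<subseteq> nb d"
        using h(5) adj_sym[OF h(5)] adj_sym[OF c(3)] z gf AV(1) sA(1) cd zB by (auto simp: nb_def)
      ultimately show False using six_nb[OF cd(4)] by metis
    qed
    then show ?thesis using that gf adj_sym by blast
  qed
  have tV: "t \<in> V" "t \<notin> Y" "t \<noteq> c" using t AV G(5) cd by auto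
  have tB: "t \<notin> B"
  proof
    assume "t \<in> B"
    then have "{d, s, t} = {c, s, d}"
      using uni[OF tri_pclq[of d s t B]] t h(5) adj_sym[OF h(5)] B(6) cB by auto
    then show False using cs c(2) tV by auto
  qed
  have vt: "v \<noteq> t"
  proof
    assume "v = t"
    then show False using K4[of c s d v] h(4-6) v t cd sA AV by auto
  qed
  obtain e where e: "e \<in> V - B" "adj e v" "adj e s"
  proof -
    have "d \<in> B - P - X" "t \<in> V - B - Y" using B(6) cd G(6,11) tV tB by auto
    moreover have "adj t s" "adj t d" "adj v s" "adj v c" using t v adj_sym by auto
    ultimately show ?thesis using B(7) vB vt h(4,5) that unfolding bridged_def by blast
  qed
  obtain z where zz: "z \<in> {z1, z2}" "adj v z"
  proof -
    obtain y1 y2 where y: "y1 \<in> V" "y1 \<notin> B" "y2 \<in> V" "y2 \<notin> B" "adj c y1" "adj c y2" "adj y1 y2"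
      using kern_tri_ex[OF B(1,3)] .
    have "y1 \<in> {s, d, z1, z2, v}" "y2 \<in> {s, d, z1, z2, v}" using nbc5 y by (auto simp: nb_def)
    then have "y1 \<in> {z1, z2, v}" "y2 \<in> {z1, z2, v}" using y cB B(6) by auto
    then show ?thesis using y(7) z(3) that adj_sym adj_irrefl by (metis insert_iff singletonD)
  qed
  have k3: "card (kern B) = 3" using h(1) cs h(2,3) by auto
  have zV: "z \<in> V - B" "adj c z" using zz zB z by auto
  show False
    by (rule kern_no_two_tri[OF B(1) k3 B(3,4) cs(1) vB, of z e])
      (use v e zV zz adj_sym in auto)
qed

text \<open>As \<open>Y\<close> spans no triangle, only two outer triangles on an edge
  \<open>d c\<close> inside \<open>Y\<close> could use up the candidates. For \<open>c = r\<close>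
  the neighbourhood of \<open>r\<close> is determined, and its initial outer triangle would need
  \<open>z1\<close> adjacent to \<open>z2\<close>. Otherwise
  \<open>shared_kernel_contradiction\<close> applies.\<close>

lemma candidate:
  assumes inv: "inv A d X Y"
  obtains t where "tok A t" "t \<notin> Y"
proof -
  note gd = invD(1)[OF inv]
  note G = guardedD[OF gd]
  have AV: "A \<subseteq> V" "opt A" using tokD[OF G(1)] by auto
  show thesis
    using G(1)
  proof (cases rule: qs_shape)
    case (one Q)
    have Q: "Q \<subseteq> V - A" "clq adj Q" "card Q = 3" using one q_eq_3 unfolding qs_def by auto
    have "\<not> Q \<subseteq> Y"
    proof
      assume QY: "Q \<subseteq> Y"
      have "Q \<noteq> {}" using Q(3) by auto
      then obtain a where "a \<in> Q" by blast
      then obtain b c where Qe: "Q = {a, b, c}" "b \<noteq> a" "c \<noteq> a" "b \<noteq> c" using card3_elim[OF Q(3)] by metis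
      then show False using frozen_tri_free[OF gd, of a b c] clqD[OF Q(2)] QY by auto
    qed
    then obtain t where "t \<in> Q" "t \<notin> Y" by blast
    then show ?thesis using that[of t] AV Q one by (auto simp: tok_def)
  next
    case (two I z1 z2)
    have QI: "insert z1 I \<in> qs A" "insert z2 I \<in> qs A" using two(1) by auto
    have Q: "insert z1 I \<subseteq> V - A" "clq adj (insert z1 I)" "insert z2 I \<subseteq> V - A" "clq adj (insert z2 I)"
      using QI unfolding qs_def by auto
    have "card I = 2" using two(6) q_eq_3 by simp
    then obtain c where c: "I = {d, c}" "c \<noteq> d" using card2_elim two(5) by metis
    have dc: "adj d c" "adj c d" using clqD[OF Q(2)] c by auto
    have za: "adj d z1" "adj c z1" "adj d z2" "adj c z2" using clqD[OF Q(2)] clqD[OF Q(4)] c two(3,4) by auto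
    have "\<not> I \<subseteq> Y"
    proof
      assume IY: "I \<subseteq> Y"
      have zY: "z1 \<notin> Y" "z2 \<notin> Y"
        using frozen_tri_free[OF gd, of d c z1] frozen_tri_free[OF gd, of d c z2] za dc c IY by auto
      have zV: "{z1, z2} \<subseteq> V - A - Y" using Q zY by auto
      show False
      proof (cases "c = r")
        case False
        then obtain B s where B: "cfg B" "s \<in> X" "c \<in> kern B" "s \<in> kern B" "B \<subseteq> A \<union> Y" "A - X \<subseteq> B" "r \<notin> B"
          "d \<noteq> c \<longrightarrow> d \<in> B" "bridged P X Y B s c"
          using invD(4)[OF inv, of c] c IY by blast
        have dB: "d \<in> B" using B(8) c by blast
        have cY: "c \<in> Y" using c IY by blast
        show False
          by (rule shared_kernel_contradiction[OF gd B(1-5) dB B(9) cY c(2) dc(2) zV two(2,7) za(2,4,1,3)])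
      next
        case True
        have dA: "d \<in> A0" "d \<in> V" "d \<notin> A" using G c True by auto
        have rV: "r \<in> V" using tokD[OF start(1)] by blast
        have gh: "g0 \<in> A" "h0 \<in> A" "g0 \<in> A0" "h0 \<in> A0" using start(2,4,5) G(11) by auto
        have nbr: "nb r = {g0, h0, d, z1, z2}"
        proof (rule five_nb[OF rV])
          show "{g0, h0, d, z1, z2} \<subseteq> nb r" using start(7,8) gh AV dA dc za zV True by (auto simp: nb_def)
          show "distinct [g0, h0, d, z1, z2]" using start(6) gh dA zV two(2,3,4,5) by auto
        qed
        obtain v1 v2 where v: "v1 \<in> V" "v1 \<notin> A0" "v2 \<in> V" "v2 \<notin> A0" "adj r v1" "adj r v2" "adj v1 v2"
          using tok_tri_ex[OF start(1)] .
        have "v1 \<in> {g0, h0, d, z1, z2}" "v2 \<in> {g0, h0, d, z1, z2}" using nbr v by (auto simp: nb_def)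
        then have "v1 \<in> {z1, z2}" "v2 \<in> {z1, z2}" using v gh dA by auto
        then show False using v(7) two(7) adj_sym adj_irrefl by auto
      qed
    qed
    then obtain t where t: "t \<in> I" "t \<notin> Y" by blast
    then have "tok A t" using AV Q two(1) by (auto simp: tok_def)
    then show ?thesis using that t by blast
  qed
qed

text \<open>The last two conclusions prepare \<open>bridged\<close> and the uniqueness of common
  neighbours for the next state. If a core vertex adjacent to \<open>w\<close> endangers them, that
  vertex itself is exchanged: two core vertices adjacent to \<open>w\<close> would form a K_4 with
  \<open>t\<close> and \<open>w\<close>.\<close>

lemma exchange_choice:
  assumes inv: "inv A d X Y" and t: "tok A t" "t \<notin> Y"
    and w: "w \<in> V" "w \<notin> A" "adj d t" "adj d w" "adj t w"
  obtains y where "y \<in> core A t" "y \<notin> X" "y \<notin> P"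
    "card (nb t \<inter> A) = 2 \<longrightarrow> w \<notin> Y \<longrightarrow> (\<forall>h\<in>core A t - {y} - P. \<not> adj w h)"
    "card (nb t \<inter> A) = 3 \<longrightarrow> w \<notin> Y \<longrightarrow> (\<forall>h\<in>core A t - {y}. \<forall>s\<in>nb t \<inter> A - core A t. \<not> (adj w h \<and> adj w s))"
proof -
  note gd = invD(1)[OF inv]
  note G = guardedD[OF gd]
  have AV: "A \<subseteq> V" "t \<in> V" "t \<notin> A" using tokD[OF t(1)] by auto
  have cA: "u \<in> A" "adj t u" "u \<in> V" "u \<notin> Y" if "u \<in> core A t" for u
  proof -
    show "u \<in> A" "adj t u" using core_adj[OF t(1) that] by metis+
    then show "u \<in> V" "u \<notin> Y" using AV G(5) by auto
  qed
  have JX: "\<exists>z. core A t = {u, z} \<and> z \<notin> X" if u: "u \<in> core A t" "u \<in> X" for u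
  proof -
    have ut: "adj u t" using cA(2)[OF u(1)] adj_sym by blast
    have tV: "t \<in> V - A - Y" using AV t(2) by blast
    obtain z where z: "nb u \<inter> nb t - Y \<subseteq> {z}" using invD(3)[OF inv u(2) tV ut] by blast
    have z': "nb u \<inter> nb t - Y \<subseteq> A - X" using invD(2)[OF inv u(2) tV ut] .
    have *: "f = z" if "f \<in> A" "adj t f" "adj u f" for f
    proof -
      have "f \<in> nb u \<inter> nb t - Y" using that AV(1) G(5) unfolding nb_def by blast
      then show ?thesis using z by blast
    qed
    note c = core_eq_pair[OF t(1) u(1) *]
    have "z \<in> nb u \<inter> nb t - Y" using c AV(1) G(5) unfolding nb_def by blast
    then show ?thesis using c(1) z' by blast
  qed
  \<comment> \<open>An entered \<open>u\<close> would have the outer vertex \<open>w\<close> as a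
    common neighbour with \<open>t\<close>, against the invariant.\<close>
  have wX: "u \<notin> X" if u: "u \<in> core A t" "adj w u" "w \<notin> Y" for u
  proof
    assume "u \<in> X"
    then have "nb u \<inter> nb t - Y \<subseteq> A - X" using invD(2)[OF inv, of u t] cA(2)[OF u(1)] adj_sym AV t(2) by blast
    moreover have "w \<in> nb u \<inter> nb t - Y" using u w adj_sym by (auto simp: nb_def)
    ultimately show False using w by blast
  qed
  obtain y0 where y0: "y0 \<in> core A t" "y0 \<notin> X" "y0 \<notin> P"
  proof (cases "\<exists>g. g \<in> P \<and> g \<in> core A t")
    case True
    then show ?thesis using clean[OF gd t] that unfolding replaceable_def by blast
  next
    case False
    obtain u where u: "u \<in> core A t" using core_ne[OF t(1)] by blast
    show ?thesis
    proof (cases "u \<in> X")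
      case True then show ?thesis using JX[OF u] False that by blast
    next
      case nX: False then show ?thesis using that u False by blast
    qed
  qed
  have no4: False if "g \<in> core A t" "h \<in> core A t" "g \<noteq> h" "adj w g" "adj w h" for g h
    using K4[of w t g h] core_pair_adj[OF t(1) that(1-3)] that cA AV w adj_sym[OF w(5)] by auto
  consider (a) u where "card (nb t \<inter> A) = 2" "u \<in> core A t" "u \<notin> P" "w \<notin> Y" "adj w u"
    | (b) "card (nb t \<inter> A) = 2" "\<And>u. u \<in> core A t \<Longrightarrow> u \<notin> P \<Longrightarrow> w \<notin> Y \<Longrightarrow> adj w u \<Longrightarrow> False"
    | (c) u s where "card (nb t \<inter> A) \<noteq> 2" "u \<in> core A t" "s \<in> nb t \<inter> A - core A t" "w \<notin> Y" "adj w u" "adj w s"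
    | (d) "card (nb t \<inter> A) \<noteq> 2" "\<And>u s. u \<in> core A t \<Longrightarrow> s \<in> nb t \<inter> A - core A t \<Longrightarrow> w \<notin> Y \<Longrightarrow> adj w u \<Longrightarrow> adj w s \<Longrightarrow> False"
    by blast
  then show thesis
  proof cases
    case a
    show ?thesis by (rule that[of u]) (use a wX no4 in auto)
  next
    case b
    show ?thesis by (rule that[OF y0]) (use b in auto)
  next
    case c
    \<comment> \<open>This is the situation that the second half of \<open>replaceable\<close>
      excludes for frozen vertices.\<close>
    have "u \<notin> P"
    proof
      assume uP: "u \<in> P"
      obtain f where f: "core A t = {u, f}" "\<not> (\<exists>w s. w \<in> V - A - Y \<and> adj d t \<and> adj d w \<and> adj t w
          \<and> adj w u \<and> s \<in> A \<and> s \<noteq> u \<and> s \<noteq> f \<and> adj s t \<and> adj s w)"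
        using clean[OF gd t uP c(2)] unfolding replaceable_def by blast
      have "s \<in> A" "s \<noteq> u" "s \<noteq> f" "adj s t" "adj s w" using c f(1) adj_sym by (auto simp: nb_def)
      then show False using f(2) w c(4,5) by blast
    qed
    then show ?thesis by (intro that[of u]) (use c wX no4 in auto)
  next
    case d
    show ?thesis by (rule that[OF y0]) (use d in auto)
  qed
qed

lemma step:
  assumes inv: "inv A d X Y"
  shows "\<exists>A' d' X' Y'. inv A' d' X' Y' \<and> card (V - A' - Y') < card (V - A - Y)"
proof -
  note gd = invD(1)[OF inv]
  note G = guardedD[OF gd]
  have dV: "d \<in> V" "d \<notin> A" using tokD[OF G(1)] by auto
  obtain t where t: "tok A t" "t \<notin> Y" using candidate[OF inv] .
  have AV: "A \<subseteq> V" "t \<in> V" "t \<notin> A" using tokD[OF t(1)] by auto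
  have tA0: "t \<notin> A0" "t \<noteq> r" using AV t(2) G by auto
  obtain w where w: "w \<in> V" "w \<notin> A" "adj d t" "adj d w" "adj t w"
  proof -
    obtain a b where ab: "a \<in> V" "a \<notin> A" "b \<in> V" "b \<notin> A" "adj t a" "adj t b" "adj a b" using tok_tri_ex[OF t(1)] .
    have "d = t \<or> d = a \<or> d = b" using tok_tri[OF G(1), of t a b] ab AV by auto
    then have "d = a \<or> d = b" using G(2) t(2) by auto
    then show ?thesis using that[of a] that[of b] ab adj_sym by blast
  qed
  have wt: "w \<noteq> t" "adj t d" using w adj_irrefl adj_sym by auto
  have tle: "card (nb t \<inter> A) \<le> 3" using tok_in[OF t(1)] p_eq_3 by simp
  have t3: "nb t - A = {d, w}" if "card (nb t \<inter> A) = 3"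
    using tok_nb3[OF t(1) w(1,2) dV wt(2) w(5) w(4)] that .
  obtain y where y: "y \<in> core A t" "y \<notin> X" "y \<notin> P"
    and R1: "card (nb t \<inter> A) = 2 \<longrightarrow> w \<notin> Y \<longrightarrow> (\<forall>h\<in>core A t - {y} - P. \<not> adj w h)"
    and R2: "card (nb t \<inter> A) = 3 \<longrightarrow> w \<notin> Y \<longrightarrow> (\<forall>h\<in>core A t - {y}. \<forall>s\<in>nb t \<inter> A - core A t. \<not> (adj w h \<and> adj w s))"
    using exchange_choice[OF inv t w] .
  have yA: "y \<in> A" "adj t y" using core_adj[OF t(1) y(1)] by metis+
  have yV: "y \<in> V" "y \<noteq> t" using yA AV by auto
  let ?A = "insert t A - {y}" and ?X = "insert t X" and ?Y = "insert y Y"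
  have tokn: "tok ?A y" using swap_tok[OF t(1) y(1)] .
  have gdn: "guarded A0 r P ?A y ?X ?Y"
    unfolding guarded_def
  proof (intro conjI)
    show "tok ?A y" by (rule tokn)
    show "?Y \<inter> ?A = {}" "A0 \<subseteq> ?A \<union> ?Y" "?A - ?X \<subseteq> A0" using G(5,8,9) t(2) by blast+
    show "?X \<subseteq> ?A" using G(6) y(2) yV by blast
    show "?X \<inter> A0 = {}" using G(7) tA0 by blast
    show "?Y - {r} \<subseteq> A0" using G(9,10) yA y(2) by blast
    show "P \<subseteq> ?A" using G(11) y(3) by blast
  qed (use G yV in auto)
  \<comment> \<open>A common outer neighbour would complete an outer triangle, which has to contain
    \<open>d\<close>; none of its vertices is in \<open>Y\<close>.\<close>
  have Jsub: "nb t \<inter> nb x - ?Y \<subseteq> ?A - ?X" if x: "x \<in> V - A - Y" "x \<noteq> t" "adj t x" for x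
  proof
    fix z assume z: "z \<in> nb t \<inter> nb x - ?Y"
    have az: "adj t z" "adj x z" "z \<in> V" "z \<notin> Y" "z \<noteq> y" using z by (auto simp: nb_def)
    have zA: "z \<in> A"
    proof (rule ccontr)
      assume "z \<notin> A"
      then have "d = t \<or> d = x \<or> d = z" using tok_tri[OF G(1), of t x z] az x AV by auto
      then show False using G(2) t(2) x az by blast
    qed
    moreover have "z \<notin> X"
    proof
      assume zX: "z \<in> X"
      have "t \<in> nb z \<inter> nb x - Y" using az x AV t(2) adj_sym by (auto simp: nb_def)
      then show False using invD(2)[OF inv zX x(1)] az adj_sym AV by blast
    qed
    ultimately show "z \<in> ?A - ?X" using az AV by auto
  qed
  \<comment> \<open>Two common neighbours would make the inner degree of \<open>t\<close> three,
    which forces \<open>x = w\<close>. For a diamond this contradicts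
    \<open>double_partner_ends\<close>, for a single triangle the choice of
    \<open>y\<close>.\<close>
  have Juni: "\<exists>z. nb t \<inter> nb x - ?Y \<subseteq> {z}" if x: "x \<in> V - A - Y" "x \<noteq> t" "adj t x" for x
  proof (rule ccontr)
    assume neg: "\<not> ?thesis"
    then obtain z1 where z1: "z1 \<in> nb t \<inter> nb x - ?Y" by blast
    obtain z2 where z2: "z2 \<in> nb t \<inter> nb x - ?Y" "z2 \<noteq> z1" using neg by blast
    have zA: "z1 \<in> A" "z2 \<in> A" using Jsub[OF x] z1 z2 AV by auto
    have za: "z1 \<in> nb t" "z2 \<in> nb t" "adj x z1" "adj x z2" "z1 \<noteq> y" "z2 \<noteq> y" using z1 z2 by (auto simp: nb_def)
    have sub: "{y, z1, z2} \<subseteq> nb t \<inter> A" using zA za yA yV by (auto simp: nb_def)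
    have c3: "card {y, z1, z2} = 3" using za z2 by auto
    have nbt: "nb t \<inter> A = {y, z1, z2}" using card_seteq[OF _ sub] fin_nb tle c3 by simp
    then have "nb t - A = {d, w}" using t3 c3 by simp
    moreover have "x \<in> nb t - A" using x by (auto simp: nb_def)
    ultimately have "x \<in> {d, w}" by simp
    then have xw: "x = w" using x(1) G(2) by auto
    have wY: "w \<notin> Y" using x(1) xw by blast
    show False
      using t(1)
    proof (cases rule: tok_cases)
      case (double u a b)
      have "y = u" using doubleD(2)[OF double] y by blast
      then have "{z1, z2} = {a, b}" using nbt doubleD(3,6,7)[OF double] za by blast
      then have "adj w a" "adj w b" using za(3,4) xw by (auto simp: doubleton_eq_iff)
      then show False using double_partner_ends[OF double w(1,2) dV wt(2) w(5) w(4)] by blast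
    next
      case (single g h)
      have "y = g \<or> y = h" using single(1) y(1) by simp
      then obtain h' where h': "core A t = {y, h'}" "h' \<noteq> y" using single(1,2) by (auto simp: insert_commute)
      have "h' \<in> nb t \<inter> A" using single h' AV by (auto simp: nb_def doubleton_eq_iff)
      then have "h' = z1 \<or> h' = z2" using nbt h'(2) by blast
      then show False
      proof
        assume "h' = z1"
        then show False using R2 nbt c3 h' za z2 wY xw by auto
      next
        assume "h' = z2"
        then show False using R2 nbt c3 h' za z2 wY xw by auto
      qed
    qed
  qed
  \<comment> \<open>If \<open>v\<close> is \<open>d\<close> or \<open>w\<close>, the other one
    serves as \<open>e\<close>. Otherwise \<open>t\<close> has three outer neighbours, so its inner
    degree is two and \<open>x = w\<close>, which the choice of \<open>y\<close> rules out.\<close>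
  have br: "bridged P ?X ?Y (insert t A) t y"
    unfolding bridged_def
  proof (intro ballI impI)
    fix h x v
    assume h: "h \<in> insert t A - P - ?X" and x: "x \<in> V - insert t A - ?Y" and v: "v \<in> V - insert t A"
      and a: "adj t h \<and> adj y h \<and> adj x t \<and> adj x h \<and> adj v t \<and> adj v y \<and> v \<noteq> x"
    have hA: "h \<in> A" "h \<noteq> y" using h a adj_irrefl by auto
    have xv: "x \<in> nb t - A" "v \<in> nb t - A" "x \<noteq> d" using x v a adj_sym G(2) by (auto simp: nb_def)
    have ed: "d \<in> V - insert t A" "w \<in> V - insert t A" using dV w wt G(2) t(2) by auto
    have sub: "{y, h} \<subseteq> nb t \<inter> A" using hA yA a AV by (auto simp: nb_def)
    have two: "2 \<le> card (nb t \<inter> A)" using card_mono[OF _ sub] fin_nb hA by auto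
    show "\<exists>e\<in>V - insert t A. adj e v \<and> adj e t"
    proof (cases "v \<in> {d, w}")
      case True
      then show ?thesis using ed w wt adj_sym by blast
    next
      case False
      have n3: "card (nb t \<inter> A) \<noteq> 3" using t3 xv(2) False by auto
      then have c2: "card (nb t \<inter> A) = 2" using two tle by simp
      have nbt: "nb t \<inter> A = {y, h}" using card_seteq[OF _ sub] fin_nb c2 hA by simp
      have "core A t = {y, h}"
      proof (rule core_eq_pair(1)[OF t(1) y(1)])
        fix f assume f: "f \<in> A" "adj t f" "adj y f"
        then have "f \<in> {y, h}" using nbt AV by (auto simp: nb_def)
        then show "f = h" using f adj_irrefl by auto
      qed
      then have hc: "h \<in> core A t" by blast
      have sub3: "{d, w, v} \<subseteq> nb t - A" using xv w dV wt by (auto simp: nb_def)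
      have "card {d, w, v} = 3" using False adj_neq[OF w(4)] by auto
      moreover have "card (nb t - A) \<le> 3" using nb_split[of t A] deg_nb[OF AV(2)] c2 p_eq_3 q_eq_3 by simp
      ultimately have "nb t - A = {d, w, v}" using card_seteq[OF _ sub3] fin_nb by simp
      then have xw: "x = w" using xv a by auto
      have "w \<notin> Y" "adj w h" "h \<notin> P" using x xw a h by auto
      then show ?thesis using R1 c2 hc hA(2) by blast
    qed
  qed
  have "inv ?A y ?X ?Y"
    unfolding inv_def
  proof (intro conjI[OF gdn] conjI ballI impI)
    fix s x assume s: "s \<in> ?X" and x: "x \<in> V - ?A - ?Y" and sx: "adj s x"
    have x': "x \<in> V - A - Y" "x \<noteq> t" using x by auto
    show "nb s \<inter> nb x - ?Y \<subseteq> ?A - ?X"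
    proof (cases "s = t")
      case False
      then have "nb s \<inter> nb x - Y \<subseteq> A - X" using invD(2)[OF inv, of s x] s x' sx by blast
      then show ?thesis using AV by blast
    next
      case True
      then show ?thesis using Jsub[OF x'] sx by blast
    qed
    show "\<exists>z. nb s \<inter> nb x - ?Y \<subseteq> {z}"
    proof (cases "s = t")
      case False
      then obtain z where "nb s \<inter> nb x - Y \<subseteq> {z}" using invD(3)[OF inv, of s x] s x' sx by blast
      then show ?thesis by blast
    next
      case True
      then show ?thesis using Juni[OF x'] sx by blast
    qed
  next
    fix c assume c: "c \<in> ?Y - {r}"
    show "\<exists>B s. cfg B \<and> s \<in> ?X \<and> c \<in> kern B \<and> s \<in> kern B \<and> B \<subseteq> ?A \<union> ?Y \<and> ?A - ?X \<subseteq> B \<and> r \<notin> B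
         \<and> (y \<noteq> c \<longrightarrow> y \<in> B) \<and> bridged P ?X ?Y B s c"
    proof (cases "c = y")
      case True
      have "kern (insert t A) = insert t (core A t)" using kern_core[OF t(1)] .
      then have "y \<in> kern (insert t A)" "t \<in> kern (insert t A)" using y by auto
      moreover have "r \<notin> insert t A" using tA0 G(3,5) by blast
      moreover have "insert t A \<subseteq> ?A \<union> ?Y" "?A - ?X \<subseteq> insert t A" by blast+
      ultimately show ?thesis using cfg_tok[OF t(1)] br True by blast
    next
      case False
      then obtain B s where B: "cfg B" "s \<in> X" "c \<in> kern B" "s \<in> kern B" "B \<subseteq> A \<union> Y" "A - X \<subseteq> B" "r \<notin> B"
          "bridged P X Y B s c"
        using invD(4)[OF inv, of c] c by blast
      have "B \<subseteq> ?A \<union> ?Y" "?A - ?X \<subseteq> B" "y \<in> B" "s \<in> ?X" using B(2,5,6) yA y(2) by blast+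
      moreover have "bridged P ?X ?Y B s c" using bridged_mono[OF B(8)] by blast
      ultimately show ?thesis using B by blast
    qed
  qed
  moreover have "card (V - ?A - ?Y) < card (V - A - Y)"
  proof (rule psubset_card_mono)
    show "V - ?A - ?Y \<subset> V - A - Y" using AV t(2) by blast
  qed (use finV in simp)
  ultimately show ?thesis by blast
qed

lemma contradiction: False
proof -
  have no: "\<not> inv A d X Y" if "card (V - A - Y) = n" for A d X Y n
    using that
  proof (induction n arbitrary: A d X Y rule: less_induct)
    case (less n)
    then show ?case using step[of A d X Y] by blast
  qed
  have t: "r \<in> V" "r \<notin> A0" "A0 \<subseteq> V" using tokD[OF start(1)] by auto
  have "guarded A0 r P A0 r {} {r}" unfolding guarded_def using start t by auto
  then have "inv A0 r {} {r}" unfolding inv_def by blast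
  then show False using no by blast
qed

end

section \<open>Excluding heavy pairs and diamonds, and the final contradiction\<close>

context clique_part
begin

text \<open>The full inner degree of \<open>g\<close> determines its neighbourhood
  \<open>{r, h, s, t, x}\<close>. Here \<open>t\<close> is not adjacent to \<open>h\<close> by
  \<open>kern_no_two_tri\<close>, while \<open>r\<close> and \<open>x\<close> are outside
  \<open>A\<close>, so \<open>s\<close> is the other core vertex. A forbidden \<open>w\<close> would
  be \<open>x\<close>; its remaining neighbours are the edge from \<open>kern_edge\<close>, and that
  edge forms a K_4 with \<open>t\<close> and \<open>x\<close>.\<close>

lemma heavy_clean:
  assumes hv: "heavy_pair A0 r g h" and gd: "guarded A0 r {g, h} A d X Y"
    and t: "tok A t" "t \<notin> Y" and gc: "g \<in> core A t"
  shows "replaceable {g, h} A d X Y t g"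
proof -
  note G = guardedD[OF gd]
  have H: "tok A0 r" "g \<in> core A0 r" "h \<in> core A0 r" "g \<noteq> h" "card (nb g \<inter> insert r A0) = 3"
    "card (nb h \<inter> insert r A0) = 3"
    using hv by (auto simp: heavy_pair_def)
  let ?B = "insert r A0"
  have cB: "cfg ?B" using cfg_tok[OF H(1)] .
  have BV: "?B \<subseteq> V" using cfg_sub[OF cB] .
  have kg: "g \<in> kern ?B" "h \<in> kern ?B" using kern_core[OF H(1)] H(2,3) by auto
  have rA0: "r \<notin> A0" "r \<in> V" using tokD[OF H(1)] by auto
  have gA0: "g \<in> A0" "h \<in> A0" using core_sub H(2,3) by auto
  obtain k: "kern ?B = {r, g, h}" "adj r g" "adj r h" "adj g h" and uni: "\<And>K. pclq ?B K \<Longrightarrow> K = {r, g, h}"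
    using H(1)
  proof (cases rule: tok_cases)
    case (single g' h')
    have e: "{g', h'} = {g, h}" using single(1,2) H(2-4) by auto
    show ?thesis
      by (rule that) (use single e adj_sym in \<open>auto simp: doubleton_eq_iff\<close>)
  next
    case (double u a b)
    then show ?thesis using H(2-4) doubleD(2)[OF double] by auto
  qed
  have "r \<noteq> g" "r \<noteq> h" using gA0 rA0 by auto
  then have k3: "card (kern ?B) = 3" using k(1) H(4) by simp
  have gV: "g \<in> V" "h \<in> V" using gA0 BV by auto
  have rg: "r \<in> nb g \<inter> ?B" "h \<in> nb g \<inter> ?B" using k rA0 gA0 gV adj_sym by (auto simp: nb_def)
  have rh: "r \<noteq> h" "r \<noteq> g" using gA0 rA0 by auto
  obtain s where s: "nb g \<inter> ?B = {r, h, s}" "s \<noteq> r" "s \<noteq> h"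
  proof -
    obtain x y where xy: "nb g \<inter> ?B = {r, x, y}" "x \<noteq> r" "y \<noteq> r" "x \<noteq> y" using card3_elim[OF H(5) rg(1)] .
    then have "h = x \<or> h = y" using rg(2) rh by auto
    then show ?thesis using that[of x] that[of y] xy by auto
  qed
  have sN: "s \<in> nb g \<inter> ?B" using s(1) by simp
  have sA0: "s \<in> A0" "s \<in> V" "adj g s" "s \<noteq> g" using sN s(2) BV adj_irrefl by (auto simp: nb_def)
  have rs: "\<not> adj r s"
  proof
    assume "adj r s"
    then have "{r, g, s} = {r, g, h}" using uni[OF tri_pclq[of r g s ?B]] k(2) sA0 gA0 by auto
    then show False using s sA0 by auto
  qed
  have tV: "t \<in> V" "t \<notin> A" "A \<subseteq> V" using tokD[OF t(1)] by auto
  have tB: "t \<in> V - ?B" using tV t(2) G by blast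
  have gt: "g \<in> A" "adj t g" using core_adj[OF t(1) gc] by metis+
  obtain x where x: "nb g - ?B = {t, x}" "adj t x" "adj g x" "x \<in> V - ?B"
    using kern_out[OF cB kg(1) H(5) tB gt(2)] by metis
  have nbg: "nb g = {r, h, s, t, x}"
  proof -
    have "nb g = (nb g \<inter> ?B) \<union> (nb g - ?B)" by blast
    then show ?thesis using s(1) x(1) by auto
  qed
  have th: "\<not> adj t h"
  proof
    assume a: "adj t h"
    obtain z where z: "z \<in> V - ?B" "adj h z" "adj t z" using kern_out[OF cB kg(2) H(6) tB a] by metis
    show False
      by (rule kern_no_two_tri[OF cB k3 kg H(4) tB gt(2) a x(4,3,2) z])
  qed
  have rA: "r \<notin> A" and hA: "h \<in> A" using G(3,5,11) by auto
  obtain z1 z2 where z: "z1 \<in> V" "z1 \<notin> insert t A - {g}" "z2 \<in> V" "z2 \<notin> insert t A - {g}"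
      "adj g z1" "adj g z2" "adj z1 z2"
    using tok_tri_ex[OF swap_tok[OF t(1) gc]] .
  have z': "z1 \<in> {r, s, x}" "z2 \<in> {r, s, x}" "z1 \<notin> A" "z2 \<notin> A"
  proof -
    have g: "z1 \<noteq> g" "z2 \<noteq> g" using z adj_irrefl by auto
    then show "z1 \<notin> A" "z2 \<notin> A" using z by auto
    have "z1 \<in> nb g" "z2 \<in> nb g" using z by (auto simp: nb_def)
    then have "z1 \<in> {r, h, s, t, x}" "z2 \<in> {r, h, s, t, x}" using nbg by simp_all
    then show "z1 \<in> {r, s, x}" "z2 \<in> {r, s, x}" using g z hA by auto
  qed
  have xA: "x \<notin> A"
    using z' z(7) rs adj_sym[of s r] adj_irrefl by auto
  have f_s: "f = s" if "f \<in> A" "adj t f" "adj g f" for f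
  proof -
    have "f \<in> nb g" using that tV by (auto simp: nb_def)
    then have "f \<in> {r, h, s, t, x}" using nbg by simp
    then show ?thesis using that rA tV th xA by auto
  qed
  note cs = core_eq_pair[OF t(1) gc f_s]
  have rx: "adj r x" using z' z(7) cs(2) adj_sym[of x r] adj_irrefl by auto
  have "s \<notin> X" using G(7) sA0 by blast
  moreover have "s \<notin> {g, h}" using s sA0 by auto
  moreover have False
    if w: "w \<in> V - A - Y" "adj d t" "adj d w" "adj t w" "adj w g" and v: "v \<in> A" "v \<noteq> g" "v \<noteq> s" "adj v t" "adj v w" for w v
  proof -
    have "w \<in> nb g" using w adj_sym by (auto simp: nb_def)
    then have "w \<in> {r, h, s, t, x}" using nbg by simp
    then have wx: "w = x" using w(1,4) G(3) hA cs(2) adj_irrefl by auto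
    have xr: "adj x r" "adj x g" "adj x t" using rx x adj_sym by auto
    obtain f1 f2 where f: "f1 \<in> ?B - kern ?B" "f2 \<in> ?B - kern ?B" "adj x f1" "adj x f2" "adj f1 f2"
      using kern_edge[OF cB k3 _ kg(1) rh(2) x(4) xr(1,2)] k(1) by blast
    have fk: "f1 \<in> A0" "f2 \<in> A0" "f1 \<noteq> g" "f2 \<noteq> g" using f k(1) by auto
    have xV: "x \<in> V" using x by blast
    have tr: "t \<noteq> r" "t \<noteq> g" using tB gA0 by auto
    have nbx: "nb x = {r, g, t, f1, f2}"
    proof (rule five_nb[OF xV])
      show "{r, g, t, f1, f2} \<subseteq> nb x" using xr f rA0 gV tV fk BV by (auto simp: nb_def)
      show "distinct [r, g, t, f1, f2]" using rh tr fk rA0 tB adj_neq[OF f(5)] by auto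
    qed
    have dV: "d \<in> V" "d \<notin> A" using tokD[OF G(1)] by auto
    have "d \<in> nb x" "v \<in> nb x" using w(3) v(1,5) wx dV tV adj_sym by (auto simp: nb_def)
    then have dv: "d \<in> {r, g, t, f1, f2}" "v \<in> {r, g, t, f1, f2}" using nbx by simp_all
    have dr: "d \<noteq> r"
    proof
      assume "d = r"
      then show False using K4[of r g t x] w(2) k(2) rx adj_sym[OF gt(2)] x rA0 gV tV xV by auto
    qed
    have "d \<in> {f1, f2}" using dv dr dV gt(1) w(2) adj_irrefl by auto
    moreover have "v \<in> {f1, f2}" using dv v rA tV by auto
    moreover have "d \<noteq> v" using dV v by auto
    ultimately have "adj d v" using f(5) adj_sym by auto
    then show False using K4[of d v t x] w(2,3) v(1,4,5) wx x(2) dV tV xV by auto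
  qed
  ultimately show ?thesis using cs(1) unfolding replaceable_def by blast
qed

lemma double_swap:
  assumes "double A t u a b" shows "double (insert t A - {u}) u t a b"
proof -
  note D = doubleD[OF assms]
  have tA: "t \<notin> A" using tokD(4)[OF D(1)] .
  have tu: "t \<noteq> a" "t \<noteq> b" "t \<noteq> u" using tA D by auto
  have uc: "u \<in> core A t" using D(2) by simp
  have tk: "tok (insert t A - {u}) u" using swap_tok[OF D(1) uc] .
  have ins: "insert u (insert t A - {u}) = insert t A" using D(14) by auto
  have "u \<notin> core (insert t A - {u}) u" using core_sub by blast
  then have c: "core (insert t A - {u}) u = {t}"
    using kern_core[OF tk] double_kern[OF assms] ins tu(3) by auto
  have "nb u \<inter> (insert t A - {u}) = {t, a, b}" using D(4) nb_irrefl[of u] by auto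
  moreover have "nb t \<inter> insert u (insert t A - {u}) = {u, a, b}"
    using D(3) nb_irrefl[of t] ins by auto
  ultimately show ?thesis
    unfolding double_def using tk c D tu adj_sym[OF D(9)] by auto
qed

text \<open>After exchanging \<open>u\<close>, its outer triangle could use only \<open>r\<close>
  and the outer neighbour \<open>v\<close>, since \<open>a\<close>, \<open>b\<close> and
  \<open>t\<close> are inside. But \<open>v\<close> adjacent to both \<open>r\<close> and
  \<open>u\<close> contradicts \<open>double_no_common\<close>.\<close>

lemma double_clean_center:
  assumes dbl: "double A0 r u a b" and gd: "guarded A0 r {u, a, b} A d X Y"
    and t: "tok A t" "t \<notin> Y"
  shows "u \<notin> core A t"
proof
  assume uc: "u \<in> core A t"
  note G = guardedD[OF gd] and D = doubleD[OF dbl]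
  let ?B = "insert r A0"
  have cB: "cfg ?B" using cfg_tok[OF D(1)] .
  have k: "kern ?B = {r, u}" using double_kern[OF dbl] .
  have ru: "r \<noteq> u" using D(9) adj_irrefl by auto
  have tV: "t \<in> V" "t \<notin> A" "A \<subseteq> V" using tokD[OF t(1)] by auto
  have tB: "t \<in> V - ?B" using tV t(2) G by blast
  have tu: "adj t u" using core_adj[OF t(1) uc] by metis
  have uk: "u \<in> kern ?B" using k by simp
  obtain v where vt: "nb u - ?B = {t, v}" "v \<in> V - ?B" "adj u v"
    using kern_out[OF cB uk double_card(2)[OF dbl] tB tu] by metis
  have nbu: "nb u = {r, a, b, t, v}"
  proof -
    have "nb u = (nb u \<inter> ?B) \<union> (nb u - ?B)" by blast
    then show ?thesis using D(4) vt(1) by auto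
  qed
  obtain z1 z2 where z: "z1 \<in> V" "z1 \<notin> insert t A - {u}" "z2 \<in> V" "z2 \<notin> insert t A - {u}"
      "adj u z1" "adj u z2" "adj z1 z2"
    using tok_tri_ex[OF swap_tok[OF t(1) uc]] .
  have zu: "z1 \<noteq> u" "z2 \<noteq> u" using z adj_irrefl by auto
  have "z1 \<in> nb u" "z2 \<in> nb u" using z by (auto simp: nb_def)
  then have "z1 \<in> {r, a, b, t, v}" "z2 \<in> {r, a, b, t, v}" using nbu by simp_all
  then have "z1 \<in> {r, v}" "z2 \<in> {r, v}" using z zu G(11) by auto
  then have "adj v r" using z(7) adj_sym adj_irrefl by auto
  then show False using double_no_common[OF cB k ru vt(2)] adj_sym[OF vt(3)] by blast
qed

text \<open>If \<open>a\<close> is exchangeable with \<open>t\<close>, some outer \<open>w1\<close>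
  is adjacent to \<open>r\<close> and \<open>a\<close>, for otherwise \<open>u\<close> would be in
  the core. By \<open>double_partner_center\<close>, \<open>w1\<close> has its own diamond with end
  \<open>a\<close> and center \<open>e\<close>. This determines the neighbourhood of
  \<open>a\<close> and makes \<open>e\<close> the replacement for \<open>a\<close>.\<close>

lemma double_clean_end:
  assumes dn: "dense A0" and no: "\<And>A t g h. dense A \<Longrightarrow> \<not> heavy_pair A t g h"
    and dbl: "double A0 r u a b" and gd: "guarded A0 r {u, a, b} A d X Y"
    and t: "tok A t" "t \<notin> Y" and ac: "a \<in> core A t"
  shows "replaceable {u, a, b} A d X Y t a"
proof -
  note G = guardedD[OF gd] and D = doubleD[OF dbl]
  let ?B = "insert r A0"
  have A0V: "A0 \<subseteq> V" "r \<in> V" "r \<notin> A0" using tokD[OF D(1)] by auto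
  have V: "a \<in> V" "u \<in> V" "b \<in> V" using D A0V by auto
  have tV: "t \<in> V" "t \<notin> A" "A \<subseteq> V" using tokD[OF t(1)] by auto
  have tB: "t \<notin> A0" "t \<noteq> r" using tV t(2) G by blast+
  have inA: "u \<in> A" "a \<in> A" "b \<in> A" "r \<notin> A" using G(3,5,11) by auto
  have ta: "adj t a" "adj a t" using core_adj[OF t(1) ac] adj_sym by metis+
  have tne: "t \<noteq> u" "t \<noteq> a" using tV inA by auto
  have ar: "adj a r" "adj a u" using D(10,12) adj_sym by auto
  have ru: "r \<noteq> u" "r \<noteq> a" using inA by auto
  have uc: "u \<notin> core A t" using double_clean_center[OF dbl gd t] .
  obtain z1 z2 where z: "z1 \<in> V" "z1 \<notin> insert t A - {a}" "z2 \<in> V" "z2 \<notin> insert t A - {a}"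
      "adj a z1" "adj a z2" "adj z1 z2"
    using tok_tri_ex[OF swap_tok[OF t(1) ac]] .
  have za: "z1 \<noteq> a" "z2 \<noteq> a" using z adj_irrefl by auto
  have zA: "z1 \<notin> A" "z2 \<notin> A" "z1 \<noteq> t" "z2 \<noteq> t" using z za tne by auto
  have "r = z1 \<or> r = z2"
  proof (rule ccontr)
    assume nr: "\<not> ?thesis"
    have "nb a = {r, u, t, z1, z2}"
    proof (rule five_nb[OF V(1)])
      show "{r, u, t, z1, z2} \<subseteq> nb a" using ar ta z A0V V tV by (auto simp: nb_def)
      show "distinct [r, u, t, z1, z2]" using nr ru tne tB zA inA adj_neq[OF z(7)] by auto
    qed
    then have f_u: "f = u" if "f \<in> A" "adj t f" "adj a f" for f
    proof -
      have "f \<in> {r, u, t, z1, z2}" using that tV \<open>nb a = _\<close> by (auto simp: nb_def)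
      then show ?thesis using that inA tV zA by auto
    qed
    have "core A t = {a, u}" by (rule core_eq_pair(1)[OF t(1) ac f_u])
    then show False using uc by blast
  qed
  then obtain w1 where w1: "w1 \<in> V" "w1 \<notin> A" "w1 \<noteq> t" "adj a w1" "adj r w1" using z zA adj_sym by blast
  have w1A0: "w1 \<notin> A0"
  proof
    assume "w1 \<in> A0"
    then have "w1 \<in> nb r \<inter> A0" using w1 by (auto simp: nb_def)
    then have "w1 \<in> {u, a, b}" using D(3) by simp
    then show False using w1(2) inA by auto
  qed
  have w1r: "w1 \<noteq> r" "adj w1 a" using w1 adj_irrefl adj_sym by auto
  obtain d1 where d1: "d1 \<in> V" "d1 \<notin> A0" "adj r d1" "adj d1 w1"
  proof -
    obtain d0 w0 where dw: "d0 \<in> V" "d0 \<notin> A0" "w0 \<in> V" "w0 \<notin> A0" "adj r d0" "adj r w0" "adj d0 w0"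
      using tok_tri_ex[OF D(1)] .
    have "w1 \<in> nb r - A0" using w1 w1A0 by (auto simp: nb_def)
    then have "w1 \<in> {d0, w0}" using double_partner(1)[OF dbl dw(3,4,1,2,5,6,7)] by simp
    then show ?thesis using that[of d0] that[of w0] dw adj_sym by auto
  qed
  obtain e c where e: "double A0 w1 e a c" "e \<noteq> u"
    using double_partner_center[OF dn no[OF dn] dbl w1(1) w1A0 d1(1-3) w1(5) d1(4) w1r(2)] by metis
  note E = doubleD[OF e(1)]
  have eV: "e \<in> V" using E(14) A0V by blast
  have ae: "adj a e" using adj_sym[OF E(12)] .
  have ea: "e \<noteq> a" using ae adj_irrefl by auto
  have nba: "nb a = {r, u, w1, e, t}"
  proof (rule five_nb[OF V(1)])
    show "{r, u, w1, e, t} \<subseteq> nb a" using ar ta w1 ae A0V V tV eV by (auto simp: nb_def)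
    show "distinct [r, u, w1, e, t]" using ru w1r(1) w1(3) w1A0 D(14) E(14) A0V tB tne e(2) by auto
  qed
  have e_notP: "e \<notin> {u, a, b}"
  proof -
    have "e \<noteq> b" using E(12) D(8) adj_sym by blast
    then show ?thesis using e(2) ea by blast
  qed
  \<comment> \<open>Seen from the diamond with \<open>r\<close> and \<open>u\<close> interchanged,
    \<open>t\<close> would also be a partner adjacent to \<open>a\<close>, and its diamond has the
    same center \<open>e\<close>. The full degree of \<open>e\<close> then gives an outer vertex
    adjacent to both \<open>t\<close> and \<open>e\<close>, against
    \<open>double_no_common\<close>.\<close>
  have tu: "\<not> adj t u"
  proof
    assume tu: "adj t u"
    let ?A1 = "insert r A0 - {u}"
    have dbl1: "double ?A1 u r a b" using double_swap[OF dbl] .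
    have dn1: "dense ?A1"
      using dense_swap[OF dn D(1), of u] D(2) double_card[OF dbl] by simp
    have uk: "u \<in> kern ?B" using double_kern[OF dbl] by simp
    obtain v where vt: "v \<in> V" "v \<notin> ?B" "adj u v" "adj v t"
      using kern_out[OF cfg_tok[OF D(1)] uk double_card(2)[OF dbl] _ tu] tB tV adj_sym
      by (metis DiffE DiffI insertE)
    have tA1: "t \<notin> ?A1" "v \<notin> ?A1" using tB vt by auto
    obtain e' c' where e': "double ?A1 t e' a c'" "e' \<noteq> r"
      using double_partner_center[OF dn1 no[OF dn1] dbl1 tV(1) tA1(1) vt(1) tA1(2) vt(3) adj_sym[OF tu] vt(4) ta(1)] by metis
    note E' = doubleD[OF e'(1)]
    have e'V: "e' \<in> ?A1" "e' \<in> V" using E'(14) A0V by auto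
    then have "e' \<in> nb a" using adj_sym[OF E'(12)] by (auto simp: nb_def)
    then have "e' \<in> {r, u, w1, e, t}" using nba by simp
    then have ee: "e' = e" using e' e'V w1A0 tA1 by auto
    have te: "adj t e" using E'(9) ee by simp
    have ek: "e \<in> kern (insert w1 A0)" using double_kern[OF e(1)] by simp
    have "t \<in> V - insert w1 A0" using tV tB w1(3) by auto
    then obtain v where "v \<in> V - insert w1 A0" "adj e v" "adj t v"
      using kern_out[OF cfg_tok[OF E(1)] ek double_card(2)[OF e(1)] _ te] by metis
    then have v: "v \<in> V" "v \<notin> A0" "adj v t" "adj v e" using adj_sym by auto
    have "v \<noteq> r"
    proof
      assume "v = r"
      then have "e \<in> nb r \<inter> A0" using v(4) E(14) eV by (auto simp: nb_def)
      then show False using D(3) e_notP by blast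
    qed
    moreover have "v \<noteq> t" using v(3) adj_irrefl by auto
    ultimately have vB: "v \<in> V - insert t ?A1" using v by auto
    have "t \<noteq> e" using te adj_irrefl by auto
    then show False
      using double_no_common[OF cfg_tok[OF E'(1)] double_kern[OF e'(1), unfolded ee] _ vB v(3,4)] by blast
  qed
  have f_e: "f = e" if "f \<in> A" "adj t f" "adj a f" for f
  proof -
    have "f \<in> {r, u, w1, e, t}" using that tV nba by (auto simp: nb_def)
    then show ?thesis using that inA tV w1(2) tu by auto
  qed
  note ce = core_eq_pair[OF t(1) ac f_e]
  have "e \<notin> X" using G(7) E(14) by blast
  moreover have False
    if w: "w \<in> V - A - Y" "adj t w" "adj w a" for w
  proof -
    have "w \<in> nb a" using w adj_sym by (auto simp: nb_def)
    then have "w \<in> {r, u, w1, e, t}" using nba by simp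
    then have ww: "w = w1" using w G(3) inA ce(2) adj_irrefl by auto
    have "nb w1 - A0 = {r, d1}"
      by (rule tok_nb3[OF E(1) d1(1,2) A0V(2,3) adj_sym[OF w1(5)] adj_sym[OF d1(4)] d1(3) double_card(1)[OF e(1)]])
    moreover have "t \<in> nb w1 - A0" using w(2) ww tV tB adj_sym by (auto simp: nb_def)
    ultimately have "t = d1" using tB by blast
    then show False using K4[of r w1 t a] w1 d1 ta(1) D(10) w1r(2) A0V V adj_sym[OF d1(4)] by auto
  qed
  ultimately show ?thesis using ce(1) e_notP unfolding replaceable_def by blast
qed

lemma no_heavy_pair:
  assumes "heavy_pair A t g h" shows False
proof -
  have H: "tok A t" "g \<in> core A t" "h \<in> core A t" "g \<noteq> h" using assms by (auto simp: heavy_pair_def)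
  have sym: "heavy_pair A t h g" using assms by (auto simp: heavy_pair_def)
  have a: "adj t g" "adj t h" using core_adj[OF H(1,2)] core_adj[OF H(1,3)] by metis+
  interpret W: guarded_walk V adj p q A t "{g, h}" g h
  proof unfold_locales
    show "tok A t" "g \<noteq> h" "adj t g" "adj t h" "g \<in> {g, h}" "h \<in> {g, h}" "{g, h} \<subseteq> A" "core A t \<inter> {g, h} \<noteq> {}"
      using H a core_sub by auto
    show "replaceable {g, h} A' d X Y t' v"
      if gd: "guarded A t {g, h} A' d X Y" and t': "tok A' t'" "t' \<notin> Y" "v \<in> {g, h}" "v \<in> core A' t'" for A' d X Y t' v
    proof (cases "v = g")
      case True
      then show ?thesis using heavy_clean[OF assms gd t'(1,2)] t'(4) by blast
    next
      case False
      then have vh: "v = h" using t'(3) by simp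
      have "guarded A t {h, g} A' d X Y" using gd by (simp add: insert_commute)
      from heavy_clean[OF sym this t'(1,2) t'(4)[unfolded vh]]
      show ?thesis unfolding vh by (simp add: insert_commute)
    qed
  qed
  show False by (rule W.contradiction)
qed

lemma no_dense_double:
  assumes dn: "dense A" and dbl: "double A r u a b" shows False
proof -
  note D = doubleD[OF dbl]
  have no: "\<not> heavy_pair A' t g h" if "dense A'" for A' t g h using no_heavy_pair by blast
  interpret W: guarded_walk V adj p q A r "{u, a, b}" u a
  proof unfold_locales
    show "tok A r" "u \<noteq> a" "adj r u" "adj r a" "u \<in> {u, a, b}" "a \<in> {u, a, b}" "{u, a, b} \<subseteq> A" "core A r \<inter> {u, a, b} \<noteq> {}"
      using D by auto
    show "replaceable {u, a, b} A' d X Y t' v"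
      if gd: "guarded A r {u, a, b} A' d X Y" and t': "tok A' t'" "t' \<notin> Y" "v \<in> {u, a, b}" "v \<in> core A' t'" for A' d X Y t' v
    proof -
      have "v \<noteq> u" using double_clean_center[OF dbl gd t'(1,2)] t'(4) by blast
      then consider "v = a" | "v = b" using t'(3) by blast
      then show ?thesis
      proof cases
        case 1
        show ?thesis using double_clean_end[OF dn no dbl gd t'(1,2) t'(4)[unfolded 1]] unfolding 1 .
      next
        case 2
        have gd': "guarded A r {u, b, a} A' d X Y" using gd by (simp add: insert_commute)
        from double_clean_end[OF dn no double_sym[OF dbl] gd' t'(1,2) t'(4)[unfolded 2]]
        show ?thesis unfolding 2 by (simp add: insert_commute)
      qed
    qed
  qed
  show False by (rule W.contradiction)
qed

text \<open>With diamonds excluded, an inner degree of three at \<open>t\<close> would by density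
  force full inner degree at both core vertices, a heavy pair. So \<open>t\<close> has two inner
  neighbours, and one core vertex has no further neighbour either.\<close>

lemma dense_light:
  assumes dn: "dense A" and t: "tok A t"
  shows "\<exists>g h. core A t = {g, h} \<and> g \<noteq> h \<and> nb t \<inter> A = {g, h}
      \<and> adj g h \<and> adj t g \<and> adj t h \<and> nb g \<inter> insert t A = {t, h}"
  using t
proof (cases rule: tok_cases)
  case (double u a b)
  then show ?thesis using no_dense_double[OF dn] by blast
next
  case (single g h)
  have tV: "A \<subseteq> V" "t \<in> V" "t \<notin> A" using tokD[OF t] by auto
  have gh: "g \<in> core A t" "h \<in> core A t" using single(1) by auto
  have sub: "{g, h} \<subseteq> nb t \<inter> A" using single tV by (auto simp: nb_def)
  have le: "card (nb t \<inter> A) \<le> 3" using tok_in[OF t] p_eq_3 by simp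
  have not33: "card (nb g \<inter> insert t A) \<noteq> 3 \<or> card (nb h \<inter> insert t A) \<noteq> 3"
    using no_heavy_pair[of A t g h] t gh single(2) by (auto simp: heavy_pair_def)
  have "card (nb t \<inter> A) \<noteq> 3"
    using not33 core_card_le[OF t] dense_swap_le[OF dn t] gh by (metis le_antisym)
  then have c2: "card (nb t \<inter> A) \<le> 2" using le by simp
  have nbt: "nb t \<inter> A = {g, h}" using card_seteq[OF _ sub] fin_nb c2 single(2) by simp
  have light: "nb x \<inter> insert t A = {t, y}" if "{x, y} = {g, h}" "card (nb x \<inter> insert t A) \<noteq> 3" for x y
  proof -
    have xy: "x \<in> core A t" "x \<in> A" "y \<in> A" "adj x y" "adj x t" using that single adj_sym by (auto simp: doubleton_eq_iff)
    have s: "{t, y} \<subseteq> nb x \<inter> insert t A" using xy tV by (auto simp: nb_def)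
    have "card (nb x \<inter> insert t A) \<le> 2" using core_card_le[OF t xy(1)] that(2) by simp
    moreover have "t \<noteq> y" using xy tV by auto
    then have "card {t, y} = 2" by simp
    ultimately show ?thesis using card_seteq[OF _ s] fin_nb by simp
  qed
  from not33 show ?thesis
  proof
    assume "card (nb g \<inter> insert t A) \<noteq> 3"
    then have "nb g \<inter> insert t A = {t, h}" using light[of g h] by simp
    then show ?thesis using single nbt by blast
  next
    assume "card (nb h \<inter> insert t A) \<noteq> 3"
    then have "nb h \<inter> insert t A = {t, g}" using light[of h g] by (simp add: insert_commute)
    moreover have "core A t = {h, g}" "nb t \<inter> A = {h, g}" using single(1) nbt by auto
    ultimately show ?thesis
      by (intro exI[of _ h] exI[of _ g]) (use single(2-5) adj_sym[OF single(5)] in simp)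
  qed
qed

lemma contradiction: False
proof -
  obtain A r where A: "dense A" "tok A r" using dense_ex unfolding dense_def by blast
  obtain g h where gh: "core A r = {g, h}" "nb r \<inter> A = {g, h}" "adj g h" using dense_light[OF A] by blast
  interpret W: light_walk V adj p q A r g h
    by unfold_locales (use A gh dense_light in auto)
  show False by (rule W.contradiction)
qed

end

section \<open>Minimal counterexamples\<close>

lemma (in clique_graph) opt_ex: assumes "0 < p" shows "\<exists>A. opt A"
proof -
  have "finite {A. free A}" using finite_subset[of "{A. free A}" "Pow V"] finV free_sub by blast
  moreover have "free {}" using assms by (auto simp: free_def)
  ultimately have M: "Max (card ` {A. free A}) \<in> card ` {A. free A}"
    "\<And>B. free B \<Longrightarrow> card B \<le> Max (card ` {A. free A})"
    by (auto intro!: Max_in)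
  then obtain A where "free A" "\<And>B. free B \<Longrightarrow> card B \<le> card A" by auto
  then show ?thesis by (auto simp: opt_def)
qed

theorem clique_partition:
  fixes V :: "'a set" and adj :: "'a \<Rightarrow> 'a \<Rightarrow> bool"
  assumes "finite V" and sym: "\<And>u v. adj u v \<Longrightarrow> adj v u" and irr: "\<And>v. \<not> adj v v"
    and "\<And>v. v \<in> V \<Longrightarrow> card {u \<in> V. adj v u} + 1 \<le> p + q"
    and "\<And>C. C \<subseteq> V \<Longrightarrow> clq adj C \<Longrightarrow> card C \<le> p"
    and "3 \<le> q" "q \<le> p"
  shows "\<exists>A. clique_graph.opt V adj p A \<and> clique_graph.qs V adj q A = {}"
  using assms(1,4,5)
proof (induction V rule: finite_psubset_induct)
  case (psubset V)
  interpret G: clique_graph V adj p q using psubset(1) sym irr by unfold_locales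
  show ?case
  proof (rule ccontr)
    assume neg: "\<not> ?thesis"
    have tok: "\<exists>A t. G.tok A t"
    proof -
      obtain A where oA: "G.opt A" using G.opt_ex assms(6,7) by auto
      then have A: "G.free A" "\<And>B. G.free B \<Longrightarrow> card B \<le> card A" by (auto simp: G.opt_def)
      obtain Q where Q: "Q \<in> G.qs A" using neg oA by blast
      then have "card Q = q" "Q \<subseteq> V - A" by (auto simp: G.qs_def)
      then obtain w where w: "w \<in> V" "w \<notin> A" using assms(6) by (metis DiffD1 DiffD2 card.empty ex_in_conv not_numeral_le_zero subsetD)
      let ?W = "V - {w}"
      interpret W: clique_graph ?W adj p q using psubset(1) sym irr by unfold_locales auto
      have "\<exists>A. W.opt A \<and> W.qs A = {}"
      proof (rule psubset(2))
        show "?W \<subset> V" using w by blast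
        show "card {u \<in> ?W. adj v u} + 1 \<le> p + q" if "v \<in> ?W" for v
        proof -
          have "card {u \<in> ?W. adj v u} \<le> card {u \<in> V. adj v u}" using psubset(1) by (intro card_mono) auto
          then show ?thesis using psubset(3)[of v] that by simp
        qed
        show "card C \<le> p" if "C \<subseteq> ?W" "clq adj C" for C using psubset(4)[of C] that by blast
      qed
      then obtain A' where A': "W.opt A'" "W.qs A' = {}" by blast
      have fW: "W.free B \<longleftrightarrow> G.free B \<and> w \<notin> B" for B by (auto simp: W.free_def G.free_def)
      \<comment> \<open>As \<open>A\<close> misses \<open>w\<close>, it is still a competitor after
        the deletion, so the maximum size does not drop.\<close>
      have "card A \<le> card A'" using A' A(1) w fW by (simp add: W.opt_def)
      then have oA': "G.opt A'" using A A' fW unfolding G.opt_def W.opt_def by (meson le_trans)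
      have "w \<in> Q" if "Q \<in> G.qs A'" for Q
      proof (rule ccontr)
        assume "w \<notin> Q"
        then have "Q \<in> W.qs A'" using that by (auto simp: W.qs_def G.qs_def)
        then show False using A' by blast
      qed
      moreover have "w \<notin> A'" using A'(1) fW by (simp add: W.opt_def)
      ultimately have "G.tok A' w" using oA' w by (simp add: G.tok_def)
      then show ?thesis by blast
    qed
    interpret C: clique_part V adj p q
      by unfold_locales (use psubset assms(6,7) neg tok in auto)
    show False by (rule C.contradiction)
  qed
qed

section \<open>Translation between the digraph model and the adjacency relation\<close>

lemma (in graph) complete_free_induce_iff:
  assumes "W \<subseteq> verts G"
  shows "complete_free n (G \<restriction> W) \<longleftrightarrow> (\<forall>C\<subseteq>W. clq (\<lambda>u v. (u, v) \<in> arcs_ends G) C \<longrightarrow> card C \<noteq> n)"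
proof -
  have 1: "\<exists>C\<subseteq>W. clq (\<lambda>u v. (u, v) \<in> arcs_ends G) C \<and> card C = n"
    if S: "subgraph S (G \<restriction> W)" "complete_digraph n S" for S
  proof (intro exI conjI)
    show "verts S \<subseteq> W" using S(1) by (auto simp: subgraph_def)
    have "arcs_ends S \<subseteq> arcs_ends G"
      using arcs_ends_mono[OF subgraph_trans[OF S(1) subgraph_induce_subgraphI[OF assms]]] .
    then show "clq (\<lambda>u v. (u, v) \<in> arcs_ends G) (verts S)"
      using S(2) by (auto simp: clq_def complete_digraph_def)
    show "card (verts S) = n" using S(2) by (simp add: complete_digraph_def)
  qed
  \<comment> \<open>The library's complete digraphs are required to be graphs, so symmetry and the
    digraph axioms must be shown for the subgraph induced on the clique.\<close>
  have 2: "subgraph (G \<restriction> C) (G \<restriction> W) \<and> complete_digraph n (G \<restriction> C)"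
    if C: "C \<subseteq> W" "clq (\<lambda>u v. (u, v) \<in> arcs_ends G) C" "card C = n" for C
  proof -
    have ends: "arcs_ends (G \<restriction> C) = {(u, v). u \<in> C \<and> v \<in> C \<and> (u, v) \<in> arcs_ends G}"
      by (auto simp: arcs_ends_def arc_to_ends_def)
    have loop: "(u, u) \<notin> arcs_ends G" for u
      using no_loops by (auto simp: arcs_ends_def arc_to_ends_def)
    have CV: "C \<subseteq> verts G" using C(1) assms by blast
    have d: "digraph (G \<restriction> C)" using digraph_subgraph[OF subgraph_induce_subgraphI[OF CV]] .
    have "symmetric (G \<restriction> C)"
      using sym_arcs unfolding symmetric_def ends by (auto simp: sym_def)
    then have "graph (G \<restriction> C)"
      using d by (simp add: graph_def pseudo_graph_def sym_digraph_def sym_digraph_axioms_def digraph_def fin_digraph_def)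
    moreover have "arcs_ends (G \<restriction> C) = {(u, v). (u, v) \<in> verts (G \<restriction> C) \<times> verts (G \<restriction> C) \<and> u \<noteq> v}"
      using C(2) loop unfolding ends by (auto simp: clq_def)
    moreover have "subgraph (G \<restriction> C) (G \<restriction> W)"
      using C(1) wellformed_induce_subgraph by (auto simp: subgraph_def compatible_def)
    ultimately show ?thesis using C(3) by (simp add: complete_digraph_def)
  qed
  show ?thesis unfolding complete_free_def using 1 2 by blast
qed

lemma (in graph) card_neighbours_le: "card {u \<in> verts G. (v, u) \<in> arcs_ends G} \<le> out_degree G v"
proof -
  have "{u \<in> verts G. (v, u) \<in> arcs_ends G} \<subseteq> head G ` out_arcs G v"
    by (auto simp: arcs_ends_def arc_to_ends_def out_arcs_def)
  moreover have "finite (out_arcs G v)" by (simp add: out_arcs_def)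
  ultimately show ?thesis unfolding out_degree_def by (rule surj_card_le[rotated])
qed

theorem theorem2:
  fixes H :: "('a, 'b) pre_digraph" and p q :: nat
  assumes "graph H" and "connected H"
    and "max_degree H \<ge> 5"
    and "p \<ge> 3" and "q \<ge> 3"
    and "clique_number H = p"
    and "p + q = max_degree H + 1"
  shows "\<exists>V1. V1 \<subseteq> verts H \<and> max_complete_free_subset p H V1 \<and>
               complete_free q (H \<restriction> (verts H - V1))"
proof -
  interpret H: graph H by fact
  define adj where "adj = (\<lambda>u v. (u, v) \<in> arcs_ends H)"
  have sym: "adj v u" if "adj u v" for u v
    using that H.sym_arcs by (auto simp: adj_def symmetric_def sym_def)
  have irr: "\<not> adj v v" for v
    using H.no_loops by (auto simp: adj_def arcs_ends_def arc_to_ends_def)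
  interpret G: clique_graph "verts H" adj p q using sym irr by unfold_locales simp_all
  note iff = H.complete_free_induce_iff[folded adj_def]
  have free: "G.free W \<longleftrightarrow> W \<subseteq> verts H \<and> complete_free p (H \<restriction> W)" for W
    unfolding G.free_def using iff by blast
  have opt: "max_complete_free_subset p H W" if "G.opt W" for W
    using that free unfolding G.opt_def max_complete_free_subset_def by blast
  have qs: "complete_free q (H \<restriction> (verts H - W))" if "G.qs W = {}" for W
    using that iff[of "verts H - W" q] unfolding G.qs_def by blast
  have big: "card C \<le> p" if C: "C \<subseteq> verts H" "clq adj C" for C
  proof -
    have "\<not> complete_free (card C) (H \<restriction> verts H)"
      using iff[of "verts H" "card C"] C by blast
    then obtain S where S: "subgraph S (H \<restriction> verts H)" "complete_digraph (card C) S" by (auto simp: complete_free_def)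
    have "subgraph S H" using subgraph_trans[OF S(1) H.subgraph_induce_subgraphI] by simp
    then have "card C \<in> {n. \<exists>S. subgraph S H \<and> complete_digraph n S}" using S(2) by blast
    then show ?thesis using Max_ge[OF H.clique_number_set(1)] assms(6) by (simp add: clique_number_def)
  qed
  have deg: "card {u \<in> verts H. adj v u} + 1 \<le> p + q" if "v \<in> verts H" for v
  proof -
    have "out_degree H v \<le> max_degree H" using that by (simp add: max_degree_def)
    then show ?thesis using H.card_neighbours_le[of v] assms(7) by (simp add: adj_def)
  qed
  have "\<exists>A. G.opt A \<and> G.qs A = {}"
  proof (cases "q \<le> p")
    case True
    show ?thesis by (rule clique_partition[OF _ sym irr deg big assms(5) True]) simp_all
  next
    case False
    obtain A where "G.opt A" using G.opt_ex assms(4) by auto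
    moreover have "G.qs A = {}"
    proof -
      have False if "Q \<in> G.qs A" for Q
        using big[of Q] that False by (auto simp: G.qs_def)
      then show ?thesis by blast
    qed
    ultimately show ?thesis by blast
  qed
  then obtain A where A: "G.opt A" "G.qs A = {}" by blast
  then show ?thesis using opt[OF A(1)] qs[OF A(2)] G.opt_sub by blast
qed

end
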